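(* Let $V$ be an irreducible integrable $\widetilde{LT}$-module on which $K_1,\dots,K_n$ act trivially, and suppose that the linear functional $\overline\lambda\in\mathfrak h_{\overline0}^*$ by which $\mathfrak h_{\overline0}$ acts on the highest weight space $V_+$ is non-zero. Let $W_+\subseteq V_+$ be the subspace defined in the context, and let $V'=U(LT)W_+$ and $\overline V'=V/V'$. Then: (1) $V'$ is a proper $LT$-submodule of $V$. (2) $\overline V'$ is a finite-dimensional $LT$-module. (3) $V$ admits a finite-dimensional irreducible quotient over $LT$; more precisely, there exists an $LT$-submodule $V''$ of $V$ containing $V'$ such that $V/V''$ is a finite-dimensional irreducible module for $LT$.
   Context: Everything is over $\mathbb C$; $U(\cdot)$ denotes the universal enveloping algebra. **The Lie torus.** $\mathfrak g$ is a finite-dimensional simple Lie algebra with a symmetric non-degenerate invariant bilinear form $(\cdot|\cdot)$, invariant under all automorphisms of $\mathfrak g$. $n\in\mathbb N$, $A=\mathbb C[t_1^{\pm1},\dots,t_n^{\pm1}]$, $t^{\underline k}=t_1^{k_1}\cdots t_n^{k_n}$ and $x(\underline k)=x\otimes t^{\underline k}$ for $\underline k\in\mathbb Z^n$. $\sigma_1,\dots,\sigma_n$ are commuting automorphisms of $\mathfrak g$ of finite orders $m_1,\dots,m_n$; $\xi_i$ is a primitive $m_i$-th root of unity; $\Gamma=m_1\mathbb Z\oplus\cdots\oplus m_n\mathbb Z$; $\overline k$ is the class of $\underline k$ in $\mathbb Z^n/\Gamma$; $\mathfrak g_{\overline k}=\{x\in\mathfrak g:\sigma_ix=\xi_i^{k_i}x,\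 1\le i\le n\}$. $LT=\bigoplus_{\underline k\in\mathbb Z^n}\mathfrak g_{\overline k}\otimes\mathbb Ct^{\underline k}$ with bracket $[x\otimes f,y\otimes g]=[x,y]\otimes fg$. Standing assumption: $LT$ is a Lie torus, i.e. (1) $\mathfrak g_{\overline 0}$ is a finite-dimensional simple Lie algebra (with Cartan subalgebra $\mathfrak h_{\overline0}$); (2) for $\overline k\ne\overline0$ with $\mathfrak g_{\overline k}\neq0$, as $\mathfrak g_{\overline0}$-module $\mathfrak g_{\overline k}\cong U_{\overline k}\oplus W_{\overline k}$ with $U_{\overline k}$ trivial and $W_{\overline k}$ either zero or irreducible of dimension $>1$ with all $\mathfrak h_{\overline0}$-weights in $\Delta_{0,\mathrm{en}}$; (3) $|\langle\sigma_1,\dots,\sigma_n\rangle|=\prod_i m_i$. Here $\Delta_0^\times$ is the set of non-zero roots of $(\mathfrak g_{\overline0},\mathfrak h_{\overline0})$, $\Delta_{0,\mathrm{en}}^\times=\Delta_0^\times\cup2\Delta^\times_{0,\mathrm{sh}}$ ($\mathrm{sh}$ = short roots) if $\Delta_0^\times$ is of type $B_l$ ($l\ge1$, $B_1=A_1$), $\Delta_{0,\mathrm{en}}^\times=\Delta_0^\times$ otherwise, and $\Delta_{0,\mathrm{en}}=\Delta_{0,\mathrm{en}}^\times\cup\{0\}$. For $\alpha\in\mathfrak h_{\overline0}^*$, $\mathfrak g_{\overline k}(\alpha)=\{x\in\mathfrak g_{\overline k}:[h,x]=\alpha(h)x\ \forall h\in\mathfrak h_{\overline0}\}$. Fix simple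 roots of $\mathfrak g_{\overline0}$; $\Delta_{0,\mathrm{en}}^{\times,\pm}$ are the corresponding positive/negative elements of $\Delta_{0,\mathrm{en}}^\times$. **The graded Lie torus.** $\mathcal Z(\underline m)$ is the space spanned by symbols $t^{\underline k}K_i$ ($\underline k\in\Gamma$, $1\le i\le n$) modulo the relations $\sum_ik_it^{\underline k}K_i=0$; $K_i=t^{\underline0}K_i$. $D$ has basis $d_1,\dots,d_n$. $\widetilde{LT}=LT\oplus\mathcal Z(\underline m)\oplus D$ with $[x(\underline k),y(\underline l)]=[x,y](\underline k+\underline l)+(x|y)\sum_ik_it^{\underline k+\underline l}K_i$, $\mathcal Z(\underline m)$ central in $LT\oplus\mathcal Z(\underline m)$, $[d_i,x(\underline k)]=k_ix(\underline k)$, $[d_i,t^{\underline k}K_j]=k_it^{\underline k}K_j$, $[d_i,d_j]=0$. $\widetilde{\mathfrak h}=\mathfrak h_{\overline0}\oplus\sum_i\mathbb CK_i\oplus\sum_i\mathbb Cd_i$. $(\widetilde{LT})_{+}=\bigoplus_{\alpha\in\Delta_{0,\mathrm{en}}^{\times,+},\,\underline k\in\mathbb Z^n}\mathfrak g_{\overline k}(\alpha)\otimes\mathbb Ct^{\underline k}$ and $(LT)_0=\bigoplus_{\underline k\in\mathbb Z^n}\mathfrak g_{\overline k}(0)\otimes\mathbb Ct^{\underline k}$. **Integrable.** An $\widetilde{LT}$-module $V$ is integrable if it is the direct sum of its weight spaces $V_\lambda$ ($\lambda\in\widetilde{\mathfrak h}^*$), all $V_\lambda$ are finite-dimensional, and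 every element of $\mathfrak g_{\overline k}(\alpha)\otimes\mathbb Ct^{\underline k}$ with $\alpha\neq0$ acts locally nilpotently on $V$. **The setting.** For $V$ as in the claim, $V_+=\{v\in V:(\widetilde{LT})_+.v=0\}$ is non-zero, $\mathfrak h_{\overline0}$ acts on it by a single functional $\overline\lambda$, and $\mathcal Z(\underline m)$ acts trivially on $V$, so $V$ is a module for $\widehat{LT}=LT\oplus D=\widetilde{LT}/\mathcal Z(\underline m)$ and for $LT$. A highest central operator of degree $\underline r\in\mathbb Z^n$ is a linear map $z:V_+\to V_+$ commuting with the action of $(LT)_0$ and satisfying $d_iz-zd_i=r_iz$ for all $i$. Let $S\subseteq\Gamma$ be the subgroup generated by all $\underline r\in\Gamma$ such that $h\otimes t^{\underline r}$ acts as a non-zero operator on $V_+$ for some $h\in\mathfrak h_{\overline0}$. Then $S$ has rank $n$, and up to a change of coordinates there are a $\mathbb Z$-basis $f_1,\dots,f_n$ of $\mathbb Z^n$, non-zero integers $l_1,\dots,l_n$ with $S=\bigoplus_i\mathbb Zl_if_i$, and non-zero highest central operators $z_1,\dots,z_n$ on $V_+$ with $z_i$ of degree $l_if_i$, such that $W_+=\operatorname{span}\{z_iv-v: v\in V_+,\ 1\le i\le n\}$ is a proper $(LT)_0$-submodule of $V_+$. Fix such data. *)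

theory Defs
  imports
    "HOL-Analysis.Finite_Cartesian_Product"
    "HOL-Library.Poly_Mapping"
    "HOL-Library.Function_Algebras"
    "HOL-Computational_Algebra.Group_Closure"
    "HOL-Algebra.Bij"
    "HOL-Algebra.Generated_Groups"
begin

section \<open>Complex Lie algebras and their modules\<close>

text \<open>The addition of a Lie algebra is that of the surrounding type, of which it is a subspace.\<close>

record 'l lie_alg =
  elems :: "'l set"
  smul :: "complex \<Rightarrow> 'l \<Rightarrow> 'l"
  brk :: "'l \<Rightarrow> 'l \<Rightarrow> 'l"

definition lie_algebra :: "('l::ab_group_add) lie_alg \<Rightarrow> bool" where
  "lie_algebra L \<longleftrightarrow>
     vector_space (smul L) \<and> module.subspace (smul L) (elems L) \<and>
     (\<forall>x\<in>elems L. \<forall>y\<in>elems L. brk L x y \<in> elems L) \<and>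
     (\<forall>x\<in>elems L. \<forall>y\<in>elems L. \<forall>z\<in>elems L. brk L (x + y) z = brk L x z + brk L y z) \<and>
     (\<forall>x\<in>elems L. \<forall>y\<in>elems L. \<forall>z\<in>elems L. brk L z (x + y) = brk L z x + brk L z y) \<and>
     (\<forall>c. \<forall>x\<in>elems L. \<forall>y\<in>elems L. brk L (smul L c x) y = smul L c (brk L x y)) \<and>
     (\<forall>c. \<forall>x\<in>elems L. \<forall>y\<in>elems L. brk L x (smul L c y) = smul L c (brk L x y)) \<and>
     (\<forall>x\<in>elems L. brk L x x = 0) \<and>
     (\<forall>x\<in>elems L. \<forall>y\<in>elems L. \<forall>z\<in>elems L.
        brk L x (brk L y z) + brk L y (brk L z x) + brk L z (brk L x y) = 0)"

definition lie_ideal :: "('l::ab_group_add) lie_alg \<Rightarrow> 'l set \<Rightarrow> bool" where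
  "lie_ideal L I \<longleftrightarrow> I \<subseteq> elems L \<and> module.subspace (smul L) I \<and>
     (\<forall>x\<in>elems L. \<forall>y\<in>I. brk L x y \<in> I)"

definition simple_lie_algebra :: "('l::ab_group_add) lie_alg \<Rightarrow> bool" where
  "simple_lie_algebra L \<longleftrightarrow> lie_algebra L \<and>
     (\<exists>x\<in>elems L. \<exists>y\<in>elems L. brk L x y \<noteq> 0) \<and>
     (\<forall>I. lie_ideal L I \<longrightarrow> I = {0} \<or> I = elems L)"

definition fd_subspace :: "(complex \<Rightarrow> 'a \<Rightarrow> 'a) \<Rightarrow> ('a::ab_group_add) set \<Rightarrow> bool" where
  "fd_subspace sc S \<longleftrightarrow> (\<exists>B. finite B \<and> S = module.span sc B)"

text \<open>Cartan subalgebra, in the form used for semisimple complex Lie algebras: a maximal abelian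
  subalgebra consisting of ad-diagonalizable elements.\<close>

definition toral_subalgebra :: "('l::ab_group_add) lie_alg \<Rightarrow> 'l set \<Rightarrow> bool" where
  "toral_subalgebra L H \<longleftrightarrow> H \<subseteq> elems L \<and> module.subspace (smul L) H \<and>
     (\<forall>x\<in>H. \<forall>y\<in>H. brk L x y = 0) \<and>
     (\<forall>h\<in>H. elems L = module.span (smul L) {x \<in> elems L. \<exists>c. brk L h x = smul L c x})"

definition cartan_subalgebra :: "('l::ab_group_add) lie_alg \<Rightarrow> 'l set \<Rightarrow> bool" where
  "cartan_subalgebra L H \<longleftrightarrow> toral_subalgebra L H \<and>
     (\<forall>H'. toral_subalgebra L H' \<and> H \<subseteq> H' \<longrightarrow> H' = H)"

text \<open>Modules carry their own carrier and operations, so that submodules and quotients (whose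
  elements are cosets) are modules in the same sense.\<close>

record ('l, 'm) lie_mod =
  vecs :: "'m set"
  vadd :: "'m \<Rightarrow> 'm \<Rightarrow> 'm"
  vzero :: 'm
  vscale :: "complex \<Rightarrow> 'm \<Rightarrow> 'm"
  act :: "'l \<Rightarrow> 'm \<Rightarrow> 'm"

definition lie_module :: "('l::ab_group_add) lie_alg \<Rightarrow> ('l, 'm) lie_mod \<Rightarrow> bool" where
  "lie_module L M \<longleftrightarrow> lie_algebra L \<and>
     comm_group \<lparr>carrier = vecs M, monoid.mult = vadd M, one = vzero M\<rparr> \<and>
     (\<forall>c. \<forall>v\<in>vecs M. vscale M c v \<in> vecs M) \<and>
     (\<forall>c. \<forall>v\<in>vecs M. \<forall>w\<in>vecs M. vscale M c (vadd M v w) = vadd M (vscale M c v) (vscale M c w)) \<and>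
     (\<forall>c d. \<forall>v\<in>vecs M. vscale M (c + d) v = vadd M (vscale M c v) (vscale M d v)) \<and>
     (\<forall>c d. \<forall>v\<in>vecs M. vscale M c (vscale M d v) = vscale M (c * d) v) \<and>
     (\<forall>v\<in>vecs M. vscale M 1 v = v) \<and>
     (\<forall>x\<in>elems L. \<forall>v\<in>vecs M. act M x v \<in> vecs M) \<and>
     (\<forall>x\<in>elems L. \<forall>v\<in>vecs M. \<forall>w\<in>vecs M. act M x (vadd M v w) = vadd M (act M x v) (act M x w)) \<and>
     (\<forall>x\<in>elems L. \<forall>c. \<forall>v\<in>vecs M. act M x (vscale M c v) = vscale M c (act M x v)) \<and>
     (\<forall>x\<in>elems L. \<forall>y\<in>elems L. \<forall>v\<in>vecs M. act M (x + y) v = vadd M (act M x v) (act M y v)) \<and>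
     (\<forall>c. \<forall>x\<in>elems L. \<forall>v\<in>vecs M. act M (smul L c x) v = vscale M c (act M x v)) \<and>
     (\<forall>x\<in>elems L. \<forall>y\<in>elems L. \<forall>v\<in>vecs M.
        act M x (act M y v) = vadd M (act M (brk L x y) v) (act M y (act M x v)))"

definition lie_submodule ::
  "('l::ab_group_add) lie_alg \<Rightarrow> ('l, 'm) lie_mod \<Rightarrow> 'm set \<Rightarrow> bool" where
  "lie_submodule L M N \<longleftrightarrow> lie_module L M \<and> N \<subseteq> vecs M \<and> vzero M \<in> N \<and>
     (\<forall>v\<in>N. \<forall>w\<in>N. vadd M v w \<in> N) \<and> (\<forall>c. \<forall>v\<in>N. vscale M c v \<in> N) \<and>
     (\<forall>x\<in>elems L. \<forall>v\<in>N. act M x v \<in> N)"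

definition irreducible_module :: "('l::ab_group_add) lie_alg \<Rightarrow> ('l, 'm) lie_mod \<Rightarrow> bool" where
  "irreducible_module L M \<longleftrightarrow> lie_module L M \<and> vecs M \<noteq> {vzero M} \<and>
     (\<forall>N. lie_submodule L M N \<longrightarrow> N = {vzero M} \<or> N = vecs M)"

inductive_set vspan :: "('l, 'm) lie_mod \<Rightarrow> 'm set \<Rightarrow> 'm set"
  for M :: "('l, 'm) lie_mod" and B :: "'m set" where
  zero: "vzero M \<in> vspan M B"
| base: "v \<in> B \<Longrightarrow> v \<in> vspan M B"
| add: "v \<in> vspan M B \<Longrightarrow> w \<in> vspan M B \<Longrightarrow> vadd M v w \<in> vspan M B"
| scale: "v \<in> vspan M B \<Longrightarrow> vscale M c v \<in> vspan M B"

definition fd_module :: "('l, 'm) lie_mod \<Rightarrow> bool" where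
  "fd_module M \<longleftrightarrow> (\<exists>B. finite B \<and> B \<subseteq> vecs M \<and> vecs M = vspan M B)"

definition quotient_module :: "('l, 'm) lie_mod \<Rightarrow> 'm set \<Rightarrow> ('l, 'm set) lie_mod" where
  "quotient_module M W =
    \<lparr>vecs = {{vadd M v w |w. w \<in> W} |v. v \<in> vecs M},
     vadd = (\<lambda>A B. {vadd M a b |a b. a \<in> A \<and> b \<in> B}),
     vzero = W,
     vscale = (\<lambda>c A. {vadd M (vscale M c a) w |a w. a \<in> A \<and> w \<in> W}),
     act = (\<lambda>x A. {vadd M (act M x a) w |a w. a \<in> A \<and> w \<in> W})\<rparr>"

text \<open>\<open>U(L) W\<close>: the enveloping algebra is spanned by the monomials \<open>x\<^sub>1 \<cdots> x\<^sub>r\<close> (\<open>r \<ge> 0\<close>) in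
  elements of \<open>L\<close>.\<close>

definition envelope_span :: "'l lie_alg \<Rightarrow> ('l, 'm) lie_mod \<Rightarrow> 'm set \<Rightarrow> 'm set" where
  "envelope_span L M W = vspan M {foldr (act M) xs w |xs w. set xs \<subseteq> elems L \<and> w \<in> W}"

definition module_on ::
  "('m::ab_group_add) set \<Rightarrow> (complex \<Rightarrow> 'm \<Rightarrow> 'm) \<Rightarrow> ('l \<Rightarrow> 'm \<Rightarrow> 'm) \<Rightarrow> ('l, 'm) lie_mod" where
  "module_on S sc \<rho> = \<lparr>vecs = S, vadd = (+), vzero = 0, vscale = sc, act = \<rho>\<rparr>"

section \<open>Linear functionals and root systems\<close>

text \<open>The dual of a subspace \<open>H\<close>. Functionals are extended by zero outside \<open>H\<close>, so that equality
  and the pointwise operations on functions are those of the dual space.\<close>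

definition dual_space :: "(complex \<Rightarrow> 'a \<Rightarrow> 'a) \<Rightarrow> ('a::ab_group_add) set \<Rightarrow> ('a \<Rightarrow> complex) set" where
  "dual_space sc H = {f. (\<forall>x\<in>H. \<forall>y\<in>H. f (x + y) = f x + f y) \<and>
     (\<forall>c. \<forall>x\<in>H. f (sc c x) = c * f x) \<and> (\<forall>x. x \<notin> H \<longrightarrow> f x = 0)}"

definition fscale :: "complex \<Rightarrow> ('a \<Rightarrow> complex) \<Rightarrow> 'a \<Rightarrow> complex" where
  "fscale c f = (\<lambda>x. c * f x)"

definition nat_cone :: "('a \<Rightarrow> complex) set \<Rightarrow> ('a \<Rightarrow> complex) set" where
  "nat_cone P = {\<Sum>\<beta>\<in>P. fscale (of_nat (c \<beta>)) \<beta> |c :: ('a \<Rightarrow> complex) \<Rightarrow> nat. True}"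

definition simple_roots :: "('a \<Rightarrow> complex) set \<Rightarrow> ('a \<Rightarrow> complex) set \<Rightarrow> bool" where
  "simple_roots R P \<longleftrightarrow> P \<subseteq> R \<and> finite P \<and> \<not> module.dependent fscale P \<and>
     (\<forall>\<alpha>\<in>R. \<alpha> \<in> nat_cone P \<or> - \<alpha> \<in> nat_cone P)"

text \<open>\<open>B_frame R E\<close>: the linearly independent set \<open>E = {\<epsilon>\<^sub>1, \<dots>, \<epsilon>\<^sub>l}\<close>, \<open>l \<ge> 1\<close>, identifies \<open>R\<close> with the
  standard root system \<open>{\<plusminus>\<epsilon>\<^sub>i} \<union> {\<plusminus>\<epsilon>\<^sub>i \<plusminus> \<epsilon>\<^sub>j | i \<noteq> j}\<close> of type \<open>B\<^sub>l\<close>, in which the short roots are the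
  \<open>\<plusminus>\<epsilon>\<^sub>i\<close>; for \<open>l = 1\<close> this is \<open>A\<^sub>1\<close> with all roots short. If \<open>E\<close> is a frame, so is any set obtained
  from it by changing signs.\<close>

definition B_frame :: "('a \<Rightarrow> complex) set \<Rightarrow> ('a \<Rightarrow> complex) set \<Rightarrow> bool" where
  "B_frame R E \<longleftrightarrow> finite E \<and> E \<noteq> {} \<and> \<not> module.dependent fscale E \<and>
     R = (\<Union>\<epsilon>\<in>E. {\<epsilon>, - \<epsilon>}) \<union>
         (\<Union>\<epsilon>\<in>E. \<Union>\<delta>\<in>E - {\<epsilon>}. {\<epsilon> + \<delta>, \<epsilon> - \<delta>, - \<epsilon> + \<delta>, - \<epsilon> - \<delta>})"

definition type_B :: "('a \<Rightarrow> complex) set \<Rightarrow> bool" where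
  "type_B R \<longleftrightarrow> (\<exists>E. B_frame R E)"

definition type_B_short_roots :: "('a \<Rightarrow> complex) set \<Rightarrow> ('a \<Rightarrow> complex) set" where
  "type_B_short_roots R = {\<alpha>. \<exists>E. B_frame R E \<and> (\<alpha> \<in> E \<or> - \<alpha> \<in> E)}"

definition enlarged_roots :: "('a \<Rightarrow> complex) set \<Rightarrow> ('a \<Rightarrow> complex) set" where
  "enlarged_roots R = (if type_B R then R \<union> fscale 2 ` type_B_short_roots R else R)"

section \<open>Lie tori\<close>

text \<open>The type \<open>'n\<close> is the index set \<open>{1, \<dots>, n}\<close>. The field \<open>base\<close> is the fixed set of simple roots
  of the pair of \<open>\<gg>\<^sub>0\<close> and its Cartan subalgebra \<open>cartan\<close>.\<close>

record ('g, 'n) lie_torus_data =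
  gscale :: "complex \<Rightarrow> 'g \<Rightarrow> 'g"
  gbr :: "'g \<Rightarrow> 'g \<Rightarrow> 'g"
  form :: "'g \<Rightarrow> 'g \<Rightarrow> complex"
  sig :: "'n \<Rightarrow> 'g \<Rightarrow> 'g"
  ordr :: "'n \<Rightarrow> nat"
  xi :: "'n \<Rightarrow> complex"
  cartan :: "'g set"
  base :: "('g \<Rightarrow> complex) set"

definition gg :: "('g, 'n::finite) lie_torus_data \<Rightarrow> 'g lie_alg" where
  "gg T = \<lparr>elems = UNIV, smul = gscale T, brk = gbr T\<rparr>"

definition lie_automorphism :: "('g::ab_group_add, 'n::finite) lie_torus_data \<Rightarrow> ('g \<Rightarrow> 'g) \<Rightarrow> bool" where
  "lie_automorphism T f \<longleftrightarrow> bij f \<and> Vector_Spaces.linear (gscale T) (gscale T) f \<and>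
     (\<forall>x y. f (gbr T x y) = gbr T (f x) (f y))"

definition Gam :: "('g, 'n::finite) lie_torus_data \<Rightarrow> (int ^ 'n) set" where
  "Gam T = {k. \<forall>i. int (ordr T i) dvd k $ i}"

definition gk :: "('g, 'n::finite) lie_torus_data \<Rightarrow> int ^ 'n \<Rightarrow> 'g set" where
  "gk T k = {x. \<forall>i. sig T i x = gscale T (xi T i powi (k $ i)) x}"

definition gk_weight :: "('g, 'n::finite) lie_torus_data \<Rightarrow> int ^ 'n \<Rightarrow> ('g \<Rightarrow> complex) \<Rightarrow> 'g set" where
  "gk_weight T k \<alpha> = {x \<in> gk T k. \<forall>h\<in>cartan T. gbr T h x = gscale T (\<alpha> h) x}"

definition g0 :: "('g, 'n::finite) lie_torus_data \<Rightarrow> 'g lie_alg" where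
  "g0 T = \<lparr>elems = gk T 0, smul = gscale T, brk = gbr T\<rparr>"

definition hdual :: "('g::ab_group_add, 'n::finite) lie_torus_data \<Rightarrow> ('g \<Rightarrow> complex) set" where
  "hdual T = dual_space (gscale T) (cartan T)"

definition roots0 :: "('g::ab_group_add, 'n::finite) lie_torus_data \<Rightarrow> ('g \<Rightarrow> complex) set" where
  "roots0 T = {\<alpha> \<in> hdual T. \<alpha> \<noteq> 0 \<and> gk_weight T 0 \<alpha> \<noteq> {0}}"

definition roots_en :: "('g::ab_group_add, 'n::finite) lie_torus_data \<Rightarrow> ('g \<Rightarrow> complex) set" where
  "roots_en T = enlarged_roots (roots0 T)"

definition roots_en_pos :: "('g::ab_group_add, 'n::finite) lie_torus_data \<Rightarrow> ('g \<Rightarrow> complex) set" where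
  "roots_en_pos T = roots_en T \<inter> nat_cone (base T)"

definition adjoint_on :: "('g::ab_group_add, 'n::finite) lie_torus_data \<Rightarrow> 'g set \<Rightarrow> ('g, 'g) lie_mod" where
  "adjoint_on T W = module_on W (gscale T) (gbr T)"

definition invariant_form :: "('g::ab_group_add, 'n::finite) lie_torus_data \<Rightarrow> bool" where
  "invariant_form T \<longleftrightarrow>
     (\<forall>x y z. form T (x + y) z = form T x z + form T y z) \<and>
     (\<forall>c x y. form T (gscale T c x) y = c * form T x y) \<and>
     (\<forall>x y. form T x y = form T y x) \<and>
     (\<forall>x. (\<forall>y. form T x y = 0) \<longrightarrow> x = 0) \<and>
     (\<forall>x y z. form T (gbr T x y) z = form T x (gbr T y z)) \<and>
     (\<forall>f. lie_automorphism T f \<longrightarrow> (\<forall>x y. form T (f x) (f y) = form T x y))"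

definition lie_torus :: "('g::ab_group_add, 'n::finite) lie_torus_data \<Rightarrow> bool" where
  "lie_torus T \<longleftrightarrow>
     simple_lie_algebra (gg T) \<and> fd_subspace (gscale T) UNIV \<and> invariant_form T \<and>
     (\<forall>i. lie_automorphism T (sig T i)) \<and>
     (\<forall>i j. sig T i \<circ> sig T j = sig T j \<circ> sig T i) \<and>
     (\<forall>i. ordr T i > 0 \<and> sig T i ^^ ordr T i = id \<and>
        (\<forall>j. 0 < j \<and> j < ordr T i \<longrightarrow> sig T i ^^ j \<noteq> id)) \<and>
     (\<forall>i. xi T i ^ ordr T i = 1 \<and> (\<forall>j. 0 < j \<and> j < ordr T i \<longrightarrow> xi T i ^ j \<noteq> 1)) \<and>
     simple_lie_algebra (g0 T) \<and> cartan_subalgebra (g0 T) (cartan T) \<and>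
     simple_roots (roots0 T) (base T) \<and>
     (\<forall>k. k \<notin> Gam T \<and> gk T k \<noteq> {0} \<longrightarrow>
        (\<exists>U W. lie_submodule (g0 T) (adjoint_on T (gk T k)) U \<and>
               lie_submodule (g0 T) (adjoint_on T (gk T k)) W \<and>
               U \<inter> W = {0} \<and> gk T k = {u + w |u w. u \<in> U \<and> w \<in> W} \<and>
               (\<forall>x\<in>gk T 0. \<forall>u\<in>U. gbr T x u = 0) \<and>
               (W = {0} \<or>
                 irreducible_module (g0 T) (adjoint_on T W) \<and> vector_space.dim (gscale T) W > 1 \<and>
                 (\<forall>\<alpha>\<in>hdual T. W \<inter> gk_weight T k \<alpha> \<noteq> {0} \<longrightarrow> \<alpha> \<in> insert 0 (roots_en T))))) \<and>
     card (generate (BijGroup UNIV) (range (sig T))) = (\<Prod>i\<in>UNIV. ordr T i)"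

section \<open>The multiloop algebra \<open>LT\<close>\<close>

text \<open>\<open>\<Sum>\<^sub>k x\<^sub>k \<otimes> t\<^sup>k\<close> is the finitely supported function \<open>k \<mapsto> x\<^sub>k\<close>; in particular \<open>x(k)\<close> is
  \<open>Poly_Mapping.single k x\<close>.\<close>

type_synonym ('g, 'n) loop = "(int ^ 'n) \<Rightarrow>\<^sub>0 'g"

definition lscale ::
  "('g::ab_group_add, 'n::finite) lie_torus_data \<Rightarrow> complex \<Rightarrow> ('g, 'n) loop \<Rightarrow> ('g, 'n) loop" where
  "lscale T c u = Poly_Mapping.map (gscale T c) u"

definition lbr ::
  "('g::ab_group_add, 'n::finite) lie_torus_data \<Rightarrow> ('g, 'n) loop \<Rightarrow> ('g, 'n) loop \<Rightarrow> ('g, 'n) loop" where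
  "lbr T u v = (\<Sum>k\<in>Poly_Mapping.keys u. \<Sum>l\<in>Poly_Mapping.keys v.
     Poly_Mapping.single (k + l) (gbr T (Poly_Mapping.lookup u k) (Poly_Mapping.lookup v l)))"

definition LT :: "('g::ab_group_add, 'n::finite) lie_torus_data \<Rightarrow> ('g, 'n) loop lie_alg" where
  "LT T = \<lparr>elems = {u. \<forall>k. Poly_Mapping.lookup u k \<in> gk T k}, smul = lscale T, brk = lbr T\<rparr>"

definition LT_zero :: "('g::ab_group_add, 'n::finite) lie_torus_data \<Rightarrow> ('g, 'n) loop set" where
  "LT_zero T = {u. \<forall>k. Poly_Mapping.lookup u k \<in> gk_weight T k 0}"

definition LT_plus :: "('g::ab_group_add, 'n::finite) lie_torus_data \<Rightarrow> ('g, 'n) loop set" where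
  "LT_plus T = module.span (lscale T)
     {Poly_Mapping.single k x |k x \<alpha>. \<alpha> \<in> roots_en_pos T \<and> x \<in> gk_weight T k \<alpha>}"

section \<open>The central part\<close>

text \<open>The free space on the symbols \<open>t\<^sup>k K\<^sub>i\<close> (\<open>k \<in> \<int>\<^sup>n\<close>) is \<open>int ^ 'n \<Rightarrow>\<^sub>0 complex ^ 'n\<close>, with
  \<open>t\<^sup>k K\<^sub>i\<close> the \<open>i\<close>-th unit vector at \<open>k\<close>. We divide by the relations for all \<open>k\<close>; as these are
  homogeneous, the span of the \<open>t\<^sup>k K\<^sub>i\<close> with \<open>k \<in> \<Gamma>\<close> in the quotient is \<open>\<Z>(m)\<close>.\<close>

definition pscale :: "complex \<Rightarrow> ((int ^ 'n::finite) \<Rightarrow>\<^sub>0 (complex ^ 'n)) \<Rightarrow> ((int ^ 'n) \<Rightarrow>\<^sub>0 (complex ^ 'n))" where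
  "pscale c p = Poly_Mapping.map (\<lambda>x. c *s x) p"

definition central_relations :: "((int ^ 'n::finite) \<Rightarrow>\<^sub>0 (complex ^ 'n)) set" where
  "central_relations =
     module.span pscale (range (\<lambda>k. Poly_Mapping.single k (\<chi> i. of_int (k $ i))))"

definition pdeg ::
  "complex ^ 'n::finite \<Rightarrow> ((int ^ 'n) \<Rightarrow>\<^sub>0 (complex ^ 'n)) \<Rightarrow> ((int ^ 'n) \<Rightarrow>\<^sub>0 (complex ^ 'n))" where
  "pdeg d p = Poly_Mapping.mapp (\<lambda>k x. (\<Sum>i\<in>UNIV. d $ i * of_int (k $ i)) *s x) p"

lemma lookup_pscale: "Poly_Mapping.lookup (pscale c p) k = c *s Poly_Mapping.lookup p k"
  unfolding pscale_def by transfer (auto simp: when_def)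

lemma lookup_pdeg:
  "Poly_Mapping.lookup (pdeg d p) k =
     (\<Sum>i\<in>UNIV. d $ i * of_int (k $ i)) *s Poly_Mapping.lookup p k"
  unfolding pdeg_def by (auto simp: lookup_mapp when_def in_keys_iff)

interpretation pscale: vector_space pscale
  by unfold_locales
    (auto intro!: poly_mapping_eqI simp: lookup_pscale lookup_add vector_add_ldistrib
      vector_sadd_rdistrib vector_smult_assoc)

lemma pdeg_add: "pdeg d (p + q) = pdeg d p + pdeg d q"
  by (rule poly_mapping_eqI) (simp add: lookup_pdeg lookup_add vector_add_ldistrib)

lemma pdeg_diff: "pdeg d (p - q) = pdeg d p - pdeg d q"
  by (rule poly_mapping_eqI) (simp add: lookup_pdeg lookup_minus vector_ssub_ldistrib)

lemma pdeg_pscale: "pdeg d (pscale c p) = pscale c (pdeg d p)"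
  by (rule poly_mapping_eqI) (simp add: lookup_pdeg lookup_pscale vector_smult_assoc mult.commute)

lemma pdeg_zero: "pdeg d 0 = 0"
  by (rule poly_mapping_eqI) (simp add: lookup_pdeg)

lemma pdeg_single:
  "pdeg d (Poly_Mapping.single k x) =
     pscale (\<Sum>i\<in>UNIV. d $ i * of_int (k $ i)) (Poly_Mapping.single k x)"
  by (rule poly_mapping_eqI) (auto simp: lookup_pdeg lookup_pscale lookup_single when_def)

lemma central_relations_zero: "0 \<in> central_relations"
  unfolding central_relations_def by (rule pscale.span_zero)

lemma central_relations_add:
  "p \<in> central_relations \<Longrightarrow> q \<in> central_relations \<Longrightarrow> p + q \<in> central_relations"
  unfolding central_relations_def by (rule pscale.span_add)

lemma central_relations_neg: "p \<in> central_relations \<Longrightarrow> - p \<in> central_relations"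
  unfolding central_relations_def by (rule pscale.span_neg)

lemma central_relations_scale: "p \<in> central_relations \<Longrightarrow> pscale c p \<in> central_relations"
  unfolding central_relations_def by (rule pscale.span_scale)

lemma pdeg_central_relations:
  assumes "p \<in> central_relations"
  shows "pdeg d p \<in> central_relations"
  using assms unfolding central_relations_def
proof (induction rule: pscale.span_induct_alt)
  case base
  then show ?case
    by (simp add: pdeg_zero pscale.span_zero)
next
  case (step c x y)
  have "pdeg d x = pscale a x" if "x = Poly_Mapping.single k y" "a = (\<Sum>i\<in>UNIV. d $ i * of_int (k $ i))"
    for a k y using that by (simp add: pdeg_single)
  with step(1) obtain a where "pdeg d x = pscale a x"
    by blast
  with step pscale.span_base[OF step(1)] show ?case
    by (simp add: pdeg_add pdeg_pscale pscale.span_add pscale.span_scale del: pscale.scale_scale)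
qed

quotient_type (overloaded) 'n central =
  "(int ^ 'n::finite) \<Rightarrow>\<^sub>0 (complex ^ 'n)" / "\<lambda>p q. p - q \<in> central_relations"
proof (rule equivpI)
  show "reflp (\<lambda>p q :: (int ^ 'n) \<Rightarrow>\<^sub>0 (complex ^ 'n). p - q \<in> central_relations)"
    by (rule reflpI) (simp add: central_relations_zero)
  show "symp (\<lambda>p q :: (int ^ 'n) \<Rightarrow>\<^sub>0 (complex ^ 'n). p - q \<in> central_relations)"
  proof (rule sympI)
    fix p q
    assume "p - q \<in> central_relations"
    from central_relations_neg[OF this] show "q - p \<in> central_relations" by simp
  qed
  show "transp (\<lambda>p q :: (int ^ 'n) \<Rightarrow>\<^sub>0 (complex ^ 'n). p - q \<in> central_relations)"
  proof (rule transpI)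
    fix p q r
    assume "p - q \<in> central_relations" "q - r \<in> central_relations"
    from central_relations_add[OF this] show "p - r \<in> central_relations" by simp
  qed
qed

instantiation central :: (finite) ab_group_add
begin

lift_definition zero_central :: "'a central" is 0 .

lift_definition plus_central :: "'a central \<Rightarrow> 'a central \<Rightarrow> 'a central" is "(+)"
  by (simp add: add_diff_add central_relations_add)

lift_definition uminus_central :: "'a central \<Rightarrow> 'a central" is uminus
  using central_relations_neg by fastforce

definition minus_central :: "'a central \<Rightarrow> 'a central \<Rightarrow> 'a central" where
  "minus_central p q = p + - q"

instance
proof
  fix p q r :: "'a central"
  show "p + q + r = p + (q + r)"
    by transfer (simp add: add.assoc central_relations_zero)
  show "p + q = q + p"
    by transfer (simp add: add.commute central_relations_zero)
  show "0 + p = p"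
    by transfer (simp add: central_relations_zero)
  show "- p + p = 0"
    by transfer (simp add: central_relations_zero)
  show "p - q = p + - q"
    by (rule minus_central_def)
qed

end

lift_definition cscale :: "complex \<Rightarrow> ('n::finite) central \<Rightarrow> 'n central" is pscale
  by (simp add: central_relations_scale flip: pscale.scale_right_diff_distrib)

lift_definition cdeg :: "complex ^ 'n \<Rightarrow> ('n::finite) central \<Rightarrow> 'n central" is pdeg
  by (simp add: pdeg_central_relations flip: pdeg_diff)

lift_definition tK :: "int ^ 'n \<Rightarrow> 'n \<Rightarrow> ('n::finite) central"
  is "\<lambda>k i. Poly_Mapping.single k (axis i 1)" .

definition central_m :: "('g, 'n::finite) lie_torus_data \<Rightarrow> 'n central set" where
  "central_m T = module.span cscale {tK k i |k i. k \<in> Gam T}"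

section \<open>The graded Lie torus\<close>

text \<open>The element \<open>(u, c, d)\<close> stands for \<open>u + c + \<Sum>\<^sub>i d\<^sub>i d\<^sub>i\<close> with \<open>u \<in> LT\<close>, \<open>c \<in> \<Z>(m)\<close> and the coordinate
  vector \<open>d\<close> of an element of \<open>D\<close>.\<close>

type_synonym ('g, 'n) glt = "('g, 'n) loop \<times> 'n central \<times> (complex ^ 'n)"

definition ldeg ::
  "('g::ab_group_add, 'n::finite) lie_torus_data \<Rightarrow> complex ^ 'n \<Rightarrow> ('g, 'n) loop \<Rightarrow> ('g, 'n) loop" where
  "ldeg T d u = Poly_Mapping.mapp (\<lambda>k. gscale T (\<Sum>i\<in>UNIV. d $ i * of_int (k $ i))) u"

definition cocycle ::
  "('g::ab_group_add, 'n::finite) lie_torus_data \<Rightarrow> ('g, 'n) loop \<Rightarrow> ('g, 'n) loop \<Rightarrow> 'n central" where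
  "cocycle T u v = (\<Sum>k\<in>Poly_Mapping.keys u. \<Sum>l\<in>Poly_Mapping.keys v.
     cscale (form T (Poly_Mapping.lookup u k) (Poly_Mapping.lookup v l))
       (\<Sum>i\<in>UNIV. cscale (of_int (k $ i)) (tK (k + l) i)))"

definition gltscale ::
  "('g::ab_group_add, 'n::finite) lie_torus_data \<Rightarrow> complex \<Rightarrow> ('g, 'n) glt \<Rightarrow> ('g, 'n) glt" where
  "gltscale T a = (\<lambda>(u, c, d). (lscale T a u, cscale a c, a *s d))"

definition gltbr ::
  "('g::ab_group_add, 'n::finite) lie_torus_data \<Rightarrow> ('g, 'n) glt \<Rightarrow> ('g, 'n) glt \<Rightarrow> ('g, 'n) glt" where
  "gltbr T = (\<lambda>(u, c, d) (u', c', d').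
     (lbr T u u' + ldeg T d u' - ldeg T d' u, cocycle T u u' + cdeg d c' - cdeg d' c, 0))"

definition GLT :: "('g::ab_group_add, 'n::finite) lie_torus_data \<Rightarrow> ('g, 'n) glt lie_alg" where
  "GLT T = \<lparr>elems = {(u, c, d). u \<in> elems (LT T) \<and> c \<in> central_m T},
            smul = gltscale T, brk = gltbr T\<rparr>"

definition loop_elt :: "('g::zero, 'n::finite) loop \<Rightarrow> ('g, 'n) glt" where
  "loop_elt u = (u, 0, 0)"

definition K_elt :: "'n::finite \<Rightarrow> ('g::zero, 'n) glt" where
  "K_elt i = (0, tK 0 i, 0)"

definition d_elt :: "'n::finite \<Rightarrow> ('g::zero, 'n) glt" where
  "d_elt i = (0, 0, axis i 1)"

definition h_tilde :: "('g::ab_group_add, 'n::finite) lie_torus_data \<Rightarrow> ('g, 'n) glt set" where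
  "h_tilde T = {(Poly_Mapping.single 0 h, c, d) |h c d.
     h \<in> cartan T \<and> c \<in> module.span cscale (range (tK 0))}"

section \<open>Integrable modules and highest central operators\<close>

text \<open>Every vector is, in a unique way, a finite sum of elements of the spaces \<open>V\<^sub>\<mu>\<close>,
  \<open>\<mu> \<in> I\<close>.\<close>

definition direct_sum_decomposition :: "'i set \<Rightarrow> ('i \<Rightarrow> ('v::ab_group_add) set) \<Rightarrow> bool" where
  "direct_sum_decomposition I V \<longleftrightarrow>
     (\<forall>v. \<exists>!c. finite {\<mu>. c \<mu> \<noteq> 0} \<and> (\<forall>\<mu>\<in>I. c \<mu> \<in> V \<mu>) \<and> (\<forall>\<mu>. \<mu> \<notin> I \<longrightarrow> c \<mu> = 0) \<and>
            v = (\<Sum>\<mu> | c \<mu> \<noteq> 0. c \<mu>))"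

definition weight_space ::
  "('g::ab_group_add, 'n::finite) lie_torus_data \<Rightarrow> (complex \<Rightarrow> 'v \<Rightarrow> 'v) \<Rightarrow>
   (('g, 'n) glt \<Rightarrow> 'v \<Rightarrow> 'v) \<Rightarrow> (('g, 'n) glt \<Rightarrow> complex) \<Rightarrow> ('v::ab_group_add) set" where
  "weight_space T sV \<rho> \<mu> = {v. \<forall>H\<in>h_tilde T. \<rho> H v = sV (\<mu> H) v}"

definition integrable_module ::
  "('g::ab_group_add, 'n::finite) lie_torus_data \<Rightarrow> (complex \<Rightarrow> 'v \<Rightarrow> 'v) \<Rightarrow>
   (('g, 'n) glt \<Rightarrow> 'v \<Rightarrow> ('v::ab_group_add)) \<Rightarrow> bool" where
  "integrable_module T sV \<rho> \<longleftrightarrow>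
     lie_module (GLT T) (module_on UNIV sV \<rho>) \<and>
     direct_sum_decomposition (dual_space (gltscale T) (h_tilde T)) (weight_space T sV \<rho>) \<and>
     (\<forall>\<mu>\<in>dual_space (gltscale T) (h_tilde T). fd_subspace sV (weight_space T sV \<rho> \<mu>)) \<and>
     (\<forall>k. \<forall>\<alpha>\<in>hdual T. \<alpha> \<noteq> 0 \<longrightarrow> (\<forall>x\<in>gk_weight T k \<alpha>. \<forall>v.
        \<exists>N. (\<rho> (loop_elt (Poly_Mapping.single k x)) ^^ N) v = 0))"

definition V_plus ::
  "('g::ab_group_add, 'n::finite) lie_torus_data \<Rightarrow> (('g, 'n) glt \<Rightarrow> 'v \<Rightarrow> 'v) \<Rightarrow>
   ('v::ab_group_add) set" where
  "V_plus T \<rho> = {v. \<forall>u\<in>LT_plus T. \<rho> (loop_elt u) v = 0}"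

text \<open>Only the values of \<open>z\<close> on \<open>V\<^sub>+\<close> matter.\<close>

definition highest_central_operator ::
  "('g::ab_group_add, 'n::finite) lie_torus_data \<Rightarrow> (complex \<Rightarrow> 'v \<Rightarrow> 'v) \<Rightarrow>
   (('g, 'n) glt \<Rightarrow> 'v \<Rightarrow> 'v) \<Rightarrow> int ^ 'n \<Rightarrow> ('v \<Rightarrow> ('v::ab_group_add)) \<Rightarrow> bool" where
  "highest_central_operator T sV \<rho> r z \<longleftrightarrow>
     (\<forall>v\<in>V_plus T \<rho>. z v \<in> V_plus T \<rho>) \<and>
     (\<forall>v\<in>V_plus T \<rho>. \<forall>w\<in>V_plus T \<rho>. z (v + w) = z v + z w) \<and>
     (\<forall>c. \<forall>v\<in>V_plus T \<rho>. z (sV c v) = sV c (z v)) \<and>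
     (\<forall>u\<in>LT_zero T. \<forall>v\<in>V_plus T \<rho>. z (\<rho> (loop_elt u) v) = \<rho> (loop_elt u) (z v)) \<and>
     (\<forall>i. \<forall>v\<in>V_plus T \<rho>. \<rho> (d_elt i) (z v) - z (\<rho> (d_elt i) v) = sV (of_int (r $ i)) (z v))"

definition degree_lattice ::
  "('g::ab_group_add, 'n::finite) lie_torus_data \<Rightarrow> (('g, 'n) glt \<Rightarrow> 'v \<Rightarrow> ('v::ab_group_add)) \<Rightarrow>
   (int ^ 'n) set" where
  "degree_lattice T \<rho> =
     group_closure {r \<in> Gam T. \<exists>h\<in>cartan T. \<exists>v\<in>V_plus T \<rho>.
       \<rho> (loop_elt (Poly_Mapping.single r h)) v \<noteq> 0}"

definition W_plus ::
  "('g::ab_group_add, 'n::finite) lie_torus_data \<Rightarrow> (complex \<Rightarrow> 'v \<Rightarrow> 'v) \<Rightarrow>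
   (('g, 'n) glt \<Rightarrow> 'v \<Rightarrow> 'v) \<Rightarrow> ('n \<Rightarrow> 'v \<Rightarrow> 'v) \<Rightarrow> ('v::ab_group_add) set" where
  "W_plus T sV \<rho> z = module.span sV {z i v - v |i v. v \<in> V_plus T \<rho>}"

text \<open>The space \<open>V\<close> with the action of the subspace \<open>LT\<close> of \<open>GLT\<close>. It is a module over the Lie
  algebra \<open>LT\<close>, whose bracket has no central term, when \<open>\<Z>(m)\<close> acts trivially.\<close>

definition LT_module ::
  "(complex \<Rightarrow> 'v \<Rightarrow> 'v) \<Rightarrow> (('g::ab_group_add, 'n::finite) glt \<Rightarrow> 'v \<Rightarrow> ('v::ab_group_add)) \<Rightarrow>
   (('g, 'n) loop, 'v) lie_mod" where
  "LT_module sV \<rho> = module_on UNIV sV (\<lambda>u. \<rho> (loop_elt u))"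

definition V_prime ::
  "('g::ab_group_add, 'n::finite) lie_torus_data \<Rightarrow> (complex \<Rightarrow> 'v \<Rightarrow> 'v) \<Rightarrow>
   (('g, 'n) glt \<Rightarrow> 'v \<Rightarrow> 'v) \<Rightarrow> ('n \<Rightarrow> 'v \<Rightarrow> 'v) \<Rightarrow> ('v::ab_group_add) set" where
  "V_prime T sV \<rho> z = envelope_span (LT T) (LT_module sV \<rho>) (W_plus T sV \<rho> z)"

end

(* The lowering operators (those of weight - \<alpha> with \<alpha> positive) generate V from V_+ and V' from W_+,
   because commuting a raising or weight-zero operator past them only produces operators of the same kinds.
   Hence V' meets the highest weight space in W_+ and is proper.

   An operator z_i on V_+ extends to V: the submodule of V \<oplus> V generated by its graph (with the action of D
   shifted on the second summand) is a graph, since V is irreducible. By Schur's lemma the extensions Z_i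
   are bijective, and V' is spanned by the vectors Z_i v - v. As Z_i shifts the degree by l_i f_i, each weight
   space of V/V' for the Cartan subalgebra is finite-dimensional. A non-zero central element would be
   invertible on the finite-dimensional space V_+/W_+ and satisfy a Heisenberg relation there, which is
   impossible in characteristic zero; so the center acts trivially.

   For a root vector x the Laurent polynomials q such that x \<otimes> q maps V_+ into V' form a space of finite
   codimension, and it contains an ideal of finite codimension. So modulo V' a finite number of homogeneous,
   locally nilpotent lowering operators spans the action of all of them on V. Applying these operators one
   after the other, in the order of decreasing depth, to V_+/W_+ gives finite-dimensional spaces at
   each step and V/V' in the end. *)

theory Submission
  imports Defs "HOL-Computational_Algebra.Fundamental_Theorem_Algebra"
begin

section \<open>Subspaces of finite codimension\<close>

text \<open>Irreducibility concerns LT together with D, but V' is stable under LT only: its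
  generators z_i v - v mix degrees. So irreducibility is applied to sums of weight spaces, to spaces
  generated from V_+, and to graphs, kernels and images of homogeneous operators, never to V'
  itself. The hypotheses make only the K_i act by zero, so until the other t^r K_i are dealt with
  each commutator carries a central term. Such a term is itself a commutator of two operators of
  weight zero, h(k) and t(r - k) with [h, t] = 0 and (h|t) non-zero; therefore V_+, W_+ and the z_i
  are compatible with the center before it is known to vanish. The Laurent polynomials that send
  x(k) V_+ into V' form a priori only a subspace; the ideal comes from brackets with h \<otimes> p,
  which multiply by p. To pass from V_+ to V one commutes with lowering operators. Brackets of root
  vectors can fall into weight zero, so the ideal of LT generated by the root spaces is treated as a
  whole.\<close>

text \<open>Finite dimension of \<open>X\<close> modulo \<open>N\<close> is expressed by \<open>X \<subseteq> span (B \<union> N)\<close> with finite \<open>B\<close>, so that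
  no quotient spaces are needed.\<close>

locale complex_vector_space = vector_space scale
  for scale :: "complex \<Rightarrow> 'b::ab_group_add \<Rightarrow> 'b"

text \<open>Induction on B: the part of X that f maps into the span without b has codimension at
  most one in X, and any vector outside it serves as the missing spanning vector.\<close>

lemma (in complex_vector_space) finite_codim_vimage:
  assumes V: "vector_space sV" and fin: "finite B" and X: "subspace X"
    and add: "\<And>x y. x \<in> X \<Longrightarrow> y \<in> X \<Longrightarrow> f (x + y) = f x + f y"
    and sc: "\<And>c x. x \<in> X \<Longrightarrow> f (scale c x) = sV c (f x)"
    and N: "module.subspace sV N"
    and sub: "f ` X \<subseteq> module.span sV (B \<union> N)"
  shows "\<exists>C. finite C \<and> C \<subseteq> X \<and> X \<subseteq> span (C \<union> {x \<in> X. f x \<in> N})"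
  using fin X add sc sub
proof (induction B arbitrary: X rule: finite_induct)
  interpret V: vector_space sV by (rule V)
  {
    case empty
    then have "{x \<in> X. f x \<in> N} = X"
      using V.span_eq_iff[THEN iffD2, OF N] by (auto simp: image_subset_iff)
    then show ?case
      using span_superset[of X] by (intro exI[of _ "{}"]) simp
  next
    case (insert b B)
    define X0 where "X0 = {x \<in> X. f x \<in> V.span (B \<union> N)}"
    have f0: "f 0 = 0"
      using insert.prems(3)[OF subspace_0[OF insert.prems(1)], of 0] by simp
    have X0: "subspace X0"
      unfolding X0_def subspace_def
      using subspace_0[OF insert.prems(1)] subspace_add[OF insert.prems(1)]
        subspace_scale[OF insert.prems(1)] V.span_zero
      by (auto simp: f0 insert.prems(2,3) V.span_add V.span_scale)
    obtain C where C: "finite C" "C \<subseteq> X0" "X0 \<subseteq> span (C \<union> {x \<in> X0. f x \<in> N})"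
    proof -
      have "\<exists>C. finite C \<and> C \<subseteq> X0 \<and> X0 \<subseteq> span (C \<union> {x \<in> X0. f x \<in> N})"
        by (rule insert.IH[OF X0]) (use insert.prems(2,3) in \<open>auto simp: X0_def\<close>)
      then show ?thesis using that by blast
    qed
    have mono: "span (C \<union> {x \<in> X0. f x \<in> N}) \<subseteq> span (insert x (C \<union> {x \<in> X. f x \<in> N}))" for x
      by (rule span_mono) (auto simp: X0_def)
    show ?case
    proof (cases "X \<subseteq> X0")
      case True
      then have "X = X0" by (auto simp: X0_def)
      with C show ?thesis by blast
    next
      case False
      then obtain x0 where x0: "x0 \<in> X" "x0 \<notin> X0" by blast
      have rep: "\<exists>c. f x - sV c b \<in> V.span (B \<union> N)" if "x \<in> X" for x
        using that insert.prems(4) by (auto simp: V.span_breakdown_eq image_subset_iff)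
      obtain c0 where c0: "f x0 - sV c0 b \<in> V.span (B \<union> N)" using rep[OF x0(1)] by blast
      have "c0 \<noteq> 0"
        using c0 x0 by (auto simp: X0_def)
      have "X \<subseteq> span (insert x0 C \<union> {x \<in> X. f x \<in> N})"
      proof
        fix x assume x: "x \<in> X"
        obtain c where c: "f x - sV c b \<in> V.span (B \<union> N)" using rep[OF x] by blast
        \<comment> \<open>This multiple of x0 cancels the b-coefficient of f x.\<close>
        define y where "y = x + scale (- (c / c0)) x0"
        have "f y = f x - sV (c / c0) (f x0)"
          unfolding y_def using x x0(1) insert.prems
          by (simp add: subspace_scale del: scale_minus_left)
        also have "\<dots> = (f x - sV c b) - sV (c / c0) (f x0 - sV c0 b)"
          using \<open>c0 \<noteq> 0\<close> by (simp add: V.scale_right_diff_distrib)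
        also have "\<dots> \<in> V.span (B \<union> N)"
          by (rule V.span_diff[OF c V.span_scale[OF c0]])
        finally have "y \<in> X0"
          unfolding X0_def y_def using x x0(1) insert.prems(1) by (auto intro: subspace_diff subspace_scale)
        then have "y \<in> span (insert x0 (C \<union> {x \<in> X. f x \<in> N}))"
          using C(3) mono by blast
        moreover have "x = y + scale (c / c0) x0"
          by (simp add: y_def)
        moreover have "x0 \<in> span (insert x0 (C \<union> {x \<in> X. f x \<in> N}))"
          by (simp add: span_base)
        ultimately show "x \<in> span (insert x0 C \<union> {x \<in> X. f x \<in> N})"
          by (simp add: span_add span_scale)
      qed
      then show ?thesis
        using C(1,2) x0(1) by (intro exI[of _ "insert x0 C"]) (auto simp: X0_def)
    qed
  }
qed

text \<open>The given B may lie outside X; the case of the identity map replaces it by vectors of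
  X.\<close>

lemma (in complex_vector_space) finite_codim_subset:
  assumes "finite B" "subspace X" "subspace N" "X \<subseteq> span (B \<union> N)"
  shows "\<exists>C. finite C \<and> C \<subseteq> X \<and> X \<subseteq> span (C \<union> (X \<inter> N))"
  using finite_codim_vimage[OF vector_space_axioms assms(1,2), of id N] assms
  by (simp add: Int_def)

lemma (in complex_vector_space) span_absorb:
  assumes "X \<subseteq> span (B \<union> Y)" "Y \<subseteq> span Z"
  shows "X \<subseteq> span (B \<union> Z)"
proof -
  have "B \<union> Y \<subseteq> span (B \<union> Z)"
    using assms(2) span_mono[of Z "B \<union> Z"] span_superset[of "B \<union> Z"] by blast
  then show ?thesis
    using assms(1) span_minimal subspace_span by blast
qed

definition (in complex_vector_space) finite_codim :: "'b set \<Rightarrow> bool" where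
  "finite_codim N \<longleftrightarrow> subspace N \<and> (\<exists>B. finite B \<and> span (B \<union> N) = UNIV)"

text \<open>M / (M \<inter> N) embeds into the quotient by N, so finitely many vectors span M modulo
  M \<inter> N; they are added to a finite complement of M.\<close>

lemma (in complex_vector_space) finite_codim_Int:
  assumes "finite_codim M" "finite_codim N"
  shows "finite_codim (M \<inter> N)"
proof -
  obtain B C where B: "finite B" "span (B \<union> M) = UNIV" and C: "finite C" "span (C \<union> N) = UNIV"
    and sub: "subspace M" "subspace N"
    using assms by (auto simp: finite_codim_def)
  obtain D where D: "finite D" "M \<subseteq> span (D \<union> (M \<inter> N))"
    using finite_codim_subset[OF C(1) sub] C(2) by auto
  have "UNIV \<subseteq> span (B \<union> (D \<union> (M \<inter> N)))"
    by (rule span_absorb[OF _ D(2)]) (simp add: B(2))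
  then have "span ((B \<union> D) \<union> (M \<inter> N)) = UNIV"
    by (simp add: Un_assoc top.extremum_unique)
  then show ?thesis
    using B(1) D(1) subspace_inter[OF sub] unfolding finite_codim_def
    by (intro conjI exI[of _ "B \<union> D"]) auto
qed

lemma (in complex_vector_space) finite_codim_INT:
  assumes "finite I" "\<And>i. i \<in> I \<Longrightarrow> finite_codim (N i)"
  shows "finite_codim (\<Inter>i\<in>I. N i)"
  using assms
proof (induction rule: finite_induct)
  case empty
  then show ?case by (auto simp: finite_codim_def intro: exI[of _ "{}"])
next
  case (insert i I)
  then show ?case by (simp add: finite_codim_Int)
qed

text \<open>Each of the finitely many vectors of B is a combination of finitely many elements of G.
  This exchanges arbitrary spanning vectors for preferred ones, such as weight vectors or
  monomials.\<close>

lemma (in complex_vector_space) finite_subset_spanning: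
  assumes B: "finite B" "X \<subseteq> span (B \<union> N)" and G: "B \<subseteq> span G"
  shows "\<exists>G'\<subseteq>G. finite G' \<and> X \<subseteq> span (G' \<union> N)"
proof -
  have "\<exists>S\<subseteq>G. finite S \<and> b \<in> span S" if b: "b \<in> B" for b
  proof -
    obtain t r where t: "finite t" "t \<subseteq> G" "b = (\<Sum>a\<in>t. scale (r a) a)"
      using b G unfolding span_explicit by blast
    then have "b \<in> span t"
      unfolding t(3) by (intro span_sum span_scale span_base)
    with t show ?thesis by blast
  qed
  then obtain S where S: "\<And>b. b \<in> B \<Longrightarrow> S b \<subseteq> G \<and> finite (S b) \<and> b \<in> span (S b)" by metis
  have "B \<subseteq> span (\<Union>b\<in>B. S b)"
    using S span_mono[of "S _" "\<Union>b\<in>B. S b"] by blast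
  then have "X \<subseteq> span (N \<union> (\<Union>b\<in>B. S b))"
    by (rule span_absorb[rotated]) (simp add: B(2) Un_commute)
  then show ?thesis
    using S B(1) by (intro exI[of _ "\<Union>b\<in>B. S b"]) (auto simp: Un_commute)
qed

lemma (in complex_vector_space) finite_codim_spanning:
  assumes N: "finite_codim N" and G: "span G = UNIV"
  shows "\<exists>G'\<subseteq>G. finite G' \<and> span (G' \<union> N) = UNIV"
proof -
  obtain B where B: "finite B" "span (B \<union> N) = UNIV"
    using N by (auto simp: finite_codim_def)
  have "UNIV \<subseteq> span (B \<union> N)" "B \<subseteq> span G"
    using B(2) G by simp_all
  from finite_subset_spanning[OF B(1) this]
  obtain G' where "G' \<subseteq> G" "finite G'" "UNIV \<subseteq> span (G' \<union> N)" by blast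
  then show ?thesis by (intro exI[of _ G']) (simp add: top.extremum_unique)
qed

lemma (in complex_vector_space) finite_codim_linear_vimage:
  assumes V: "vector_space sV" and lin: "Vector_Spaces.linear scale sV f"
    and B: "finite B" and N: "module.subspace sV N" and sub: "range f \<subseteq> module.span sV (B \<union> N)"
  shows "finite_codim {x. f x \<in> N}"
proof -
  interpret V: vector_space sV by (rule V)
  interpret f: Vector_Spaces.linear scale sV f by (rule lin)
  have "subspace {x. f x \<in> N}"
    using N by (auto simp: subspace_def V.subspace_def f.add f.scale)
  moreover have "\<exists>C. finite C \<and> C \<subseteq> UNIV \<and> UNIV \<subseteq> span (C \<union> {x \<in> UNIV. f x \<in> N})"
    by (rule finite_codim_vimage[OF V B subspace_UNIV _ _ N]) (use sub in \<open>auto simp: f.add f.scale\<close>)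
  ultimately show ?thesis
    unfolding finite_codim_def by auto
qed

section \<open>Polynomials in a linear operator\<close>

context complex_vector_space
begin

definition poly_op :: "('b \<Rightarrow> 'b) \<Rightarrow> complex poly \<Rightarrow> 'b \<Rightarrow> 'b" where
  "poly_op f p v = (\<Sum>i\<le>degree p. scale (coeff p i) ((f ^^ i) v))"

lemma poly_op_bound:
  assumes "degree p \<le> n"
  shows "poly_op f p v = (\<Sum>i\<le>n. scale (coeff p i) ((f ^^ i) v))"
  unfolding poly_op_def
  by (rule sum.mono_neutral_left) (use assms in \<open>auto simp: coeff_eq_0\<close>)

lemma poly_op_add: "poly_op f (p + q) v = poly_op f p v + poly_op f q v"
  using poly_op_bound[of p "max (degree p) (degree q)" f v]
    poly_op_bound[of q "max (degree p) (degree q)" f v]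
    poly_op_bound[of "p + q" "max (degree p) (degree q)" f v]
  by (simp add: degree_add_le_max sum.distrib scale_left_distrib)

lemma poly_op_smult: "poly_op f (smult c p) v = scale c (poly_op f p v)"
  using poly_op_bound[of "smult c p" "degree p" f v]
  by (simp add: poly_op_def degree_smult_le scale_sum_right)

lemma poly_op_0 [simp]: "poly_op f 0 v = 0"
  by (simp add: poly_op_def)

lemma poly_op_const [simp]: "poly_op f [:c:] v = scale c v"
  by (simp add: poly_op_def)

lemma operator_zero:
  assumes "subspace X" "\<And>c v. v \<in> X \<Longrightarrow> f (scale c v) = scale c (f v)"
  shows "f 0 = 0"
  using assms(2)[OF subspace_0[OF assms(1)], of 0] by simp

lemma operator_diff:
  assumes X: "subspace X" and add: "\<And>v w. v \<in> X \<Longrightarrow> w \<in> X \<Longrightarrow> f (v + w) = f v + f w"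
    and sc: "\<And>c v. v \<in> X \<Longrightarrow> f (scale c v) = scale c (f v)" and vw: "v \<in> X" "w \<in> X"
  shows "f (v - w) = f v - f w"
  using add[of v "scale (-1) w"] sc[of w "-1"] vw subspace_scale[OF X, of w "-1"] by simp

lemma operator_sum:
  assumes X: "subspace X" and add: "\<And>v w. v \<in> X \<Longrightarrow> w \<in> X \<Longrightarrow> f (v + w) = f v + f w"
    and sc: "\<And>c v. v \<in> X \<Longrightarrow> f (scale c v) = scale c (f v)"
    and g: "\<And>i. i \<in> I \<Longrightarrow> g i \<in> X"
  shows "f (\<Sum>i\<in>I. g i) = (\<Sum>i\<in>I. f (g i))"
  using g
proof (induction I rule: infinite_finite_induct)
  case (insert i I)
  then show ?case by (simp add: add subspace_sum[OF X])
qed (use operator_zero[OF X] sc in auto)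

text \<open>Horner's rule; later inductions on polynomials use this recursion instead of the
  defining sum.\<close>

lemma poly_op_pCons:
  assumes X: "subspace X" and add: "\<And>v w. v \<in> X \<Longrightarrow> w \<in> X \<Longrightarrow> f (v + w) = f v + f w"
    and sc: "\<And>c v. v \<in> X \<Longrightarrow> f (scale c v) = scale c (f v)"
    and fX: "\<And>v. v \<in> X \<Longrightarrow> f v \<in> X" and v: "v \<in> X"
  shows "poly_op f (pCons c p) v = scale c v + f (poly_op f p v)"
proof -
  have pow: "(f ^^ i) v \<in> X" for i
    by (induction i) (auto simp: v fX)
  have "poly_op f (pCons c p) v = (\<Sum>i\<le>Suc (degree p). scale (coeff (pCons c p) i) ((f ^^ i) v))"
    by (rule poly_op_bound) (simp add: degree_pCons_le)
  also have "\<dots> = scale c v + (\<Sum>i\<le>degree p. scale (coeff p i) (f ((f ^^ i) v)))"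
    by (subst sum.atMost_Suc_shift) simp
  also have "(\<Sum>i\<le>degree p. scale (coeff p i) (f ((f ^^ i) v))) = f (poly_op f p v)"
    unfolding poly_op_def
    by (subst operator_sum[OF X add sc]) (auto simp: sc pow X subspace_scale)
  finally show ?thesis .
qed

lemma poly_op_in:
  assumes X: "subspace X" and fX: "\<And>v. v \<in> X \<Longrightarrow> f v \<in> X" and v: "v \<in> X"
  shows "poly_op f p v \<in> X"
proof -
  have pow: "(f ^^ i) v \<in> X" for i
    by (induction i) (auto simp: v fX)
  then show ?thesis
    unfolding poly_op_def using X by (auto intro: subspace_sum subspace_scale)
qed

text \<open>The polynomials have infinite dimension and X is finite-dimensional modulo N, so p
  \<mapsto> p(f) v has a non-zero kernel modulo N.\<close>

lemma annihilating_poly_exists: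
  assumes X: "subspace X" and N: "subspace N" and B: "finite B" "X \<subseteq> span (B \<union> N)"
    and fX: "\<And>v. v \<in> X \<Longrightarrow> f v \<in> X" and v: "v \<in> X"
  shows "\<exists>p. p \<noteq> 0 \<and> poly_op f p v \<in> N"
proof (rule ccontr)
  assume no: "\<not> ?thesis"
  interpret P: complex_vector_space "smult :: complex \<Rightarrow> complex poly \<Rightarrow> complex poly"
    by unfold_locales (auto simp: smult_add_left smult_add_right)
  have "\<exists>C. finite C \<and> C \<subseteq> UNIV \<and>
      UNIV \<subseteq> P.span (C \<union> {p \<in> UNIV. poly_op f p v \<in> N})"
    by (rule P.finite_codim_vimage[OF vector_space_axioms B(1) P.subspace_UNIV _ _ N])
       (use B(2) poly_op_in[OF X fX v] in \<open>auto simp: poly_op_add poly_op_smult\<close>)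
  moreover have "{p \<in> UNIV. poly_op f p v \<in> N} = {0}"
    using no N subspace_0 by auto
  ultimately obtain C where C: "finite C" "UNIV = P.span (C \<union> {0})"
    by (metis top.extremum_uniqueI)
  \<comment> \<open>A finite spanning set would bound all degrees by n, which the monomial of degree
    n + 1 contradicts.\<close>
  define n where "n = Max (degree ` C)"
  have n: "degree p \<le> n" if "p \<in> C" for p
    unfolding n_def using C(1) that by simp
  have "P.subspace {p. degree p \<le> n}"
    by (auto simp: P.subspace_def degree_add_le intro: order_trans[OF degree_smult_le])
  then have "P.span (C \<union> {0}) \<subseteq> {p. degree p \<le> n}"
    using n by (intro P.span_minimal) auto
  moreover have "monom (1::complex) (Suc n) \<in> P.span (C \<union> {0})"
    using C(2) by blast
  moreover have "degree (monom (1::complex) (Suc n)) = Suc n"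
    by (simp add: degree_monom_eq)
  ultimately show False
    by auto
qed

text \<open>Split a linear factor off an annihilating polynomial of v: either the cofactor q still
  annihilates v modulo N and has smaller degree, or q(f) v is the eigenvector.\<close>

lemma eigenvector_mod_exists:
  assumes X: "subspace X" and N: "subspace N" and B: "finite B" "X \<subseteq> span (B \<union> N)"
    and add: "\<And>v w. v \<in> X \<Longrightarrow> w \<in> X \<Longrightarrow> f (v + w) = f v + f w"
    and sc: "\<And>c v. v \<in> X \<Longrightarrow> f (scale c v) = scale c (f v)"
    and fX: "\<And>v. v \<in> X \<Longrightarrow> f v \<in> X" and XN: "\<not> X \<subseteq> N"
  shows "\<exists>v\<in>X - N. \<exists>c. f v - scale c v \<in> N"
proof -
  have "\<exists>v\<in>X - N. \<exists>c. f v - scale c v \<in> N"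
    if "v \<in> X - N" "p \<noteq> 0" "poly_op f p v \<in> N" for p v
    using that
  proof (induction "degree p" arbitrary: p)
    case 0
    then obtain c where c: "p = [:c:]" "c \<noteq> 0" by (metis degree_eq_zeroE pCons_0_0)
    then have "scale (inverse c) (scale c v) \<in> N"
      using 0 N subspace_scale by fastforce
    with c 0 show ?case by simp
  next
    case (Suc n)
    have "\<not> constant (poly p)"
      using Suc(2) by (simp add: constant_degree)
    then obtain c where "poly p c = 0"
      using fundamental_theorem_of_algebra by blast
    then obtain q where q: "p = [:- c, 1:] * q"
      by (metis dvdE poly_eq_0_iff_dvd)
    with Suc.prems have q0: "q \<noteq> 0" by auto
    have dq: "degree q = n"
      using Suc(2) q q0 degree_mult_eq[of "[:-c, 1:]" q] by simp
    have v: "v \<in> X" using Suc.prems by blast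
    let ?w = "poly_op f q v"
    have w: "?w \<in> X" by (rule poly_op_in[OF X fX v])
    have "poly_op f p v = poly_op f (smult (- c) q + pCons 0 q) v"
      by (simp add: q)
    also have "\<dots> = f ?w - scale c ?w"
      by (simp add: poly_op_add poly_op_smult poly_op_pCons[OF X add sc fX v] del: smult_minus_left)
    finally have eq: "f ?w - scale c ?w \<in> N" using Suc.prems(3) by simp
    show ?case
    proof (cases "?w \<in> N")
      case True
      with Suc.hyps(1)[of q] dq Suc.prems q0 show ?thesis by blast
    next
      case False
      with w eq show ?thesis by blast
    qed
  qed
  moreover obtain v where v: "v \<in> X" "v \<notin> N" using XN by blast
  moreover have "\<exists>p. p \<noteq> 0 \<and> poly_op f p v \<in> N"
    by (rule annihilating_poly_exists[OF X N B fX v(1)])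
  ultimately show ?thesis by (metis DiffI)
qed

text \<open>A Heisenberg relation has no finite-dimensional representation with invertible central element:
  if \<open>v\<close> is an eigenvector of \<open>b\<close>, then \<open>b - \<beta>\<close> maps \<open>p(a) v\<close> to \<open>- c p'(a) v\<close>, so no
  polynomial \<open>p\<close> of minimal degree with \<open>p(a) v = 0\<close> exists.\<close>

lemma no_finite_dim_heisenberg:
  assumes X: "subspace X" and N: "subspace N" and B: "finite B" "X \<subseteq> span (B \<union> N)"
    and lin: "\<And>f v w. f \<in> {a, b, c} \<Longrightarrow> v \<in> X \<Longrightarrow> w \<in> X \<Longrightarrow> f (v + w) = f v + f w"
      "\<And>f e v. f \<in> {a, b, c} \<Longrightarrow> v \<in> X \<Longrightarrow> f (scale e v) = scale e (f v)"
    and stable: "\<And>f v. f \<in> {a, b, c} \<Longrightarrow> v \<in> X \<Longrightarrow> f v \<in> X"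
      "\<And>f v. f \<in> {a, b, c} \<Longrightarrow> v \<in> X \<Longrightarrow> v \<in> N \<Longrightarrow> f v \<in> N"
    and comm: "\<And>v. v \<in> X \<Longrightarrow> a (b v) - b (a v) = c v" "\<And>v. v \<in> X \<Longrightarrow> c (a v) = a (c v)"
    and inj: "\<And>v. v \<in> X \<Longrightarrow> c v \<in> N \<Longrightarrow> v \<in> N"
  shows "X \<subseteq> N"
proof (rule ccontr)
  assume XN: "\<not> X \<subseteq> N"
  obtain v \<beta> where v: "v \<in> X" "v \<notin> N" and ev: "b v - scale \<beta> v \<in> N"
    using eigenvector_mod_exists[OF X N B, of b] lin stable XN by (metis DiffE insertCI)
  have aX: "\<And>v. v \<in> X \<Longrightarrow> a v \<in> X" using stable by blast
  have aadd: "a (v + w) = a v + a w" if "v \<in> X" "w \<in> X" for v w using lin(1)[of a] that by blast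
  have asc: "a (scale e v) = scale e (a v)" if "v \<in> X" for e v using lin(2)[of a] that by blast
  have aop: "poly_op a (pCons e p) v = scale e v + a (poly_op a p v)" for e p
    by (rule poly_op_pCons[OF X aadd asc aX v(1)])
  have inX: "poly_op a p v \<in> X" for p
    by (rule poly_op_in[OF X aX v(1)])
  have key: "b (poly_op a p v) - scale \<beta> (poly_op a p v) + c (poly_op a (pderiv p) v) \<in> N" for p
  proof (induction p)
    case 0
    have "b 0 = 0" "c 0 = 0"
      using operator_zero[OF X] lin(2) by auto
    then show ?case by (simp add: subspace_0[OF N])
  next
    case (pCons e p)
    let ?p = "poly_op a p v" and ?q = "poly_op a (pderiv p) v"
    have ba: "b (a ?p) = a (b ?p) - c ?p"
      using comm(1)[OF inX[of p]] by (metis add_diff_cancel_left' diff_diff_eq2)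
    \<comment> \<open>This w lies in N by the induction hypothesis. Solving for b ?p and applying a
      leaves the error a w, which is in N again.\<close>
    define w where "w = b ?p - scale \<beta> ?p + c ?q"
    have w: "w \<in> N" "w \<in> X"
      unfolding w_def using pCons.IH inX stable(1) X
      by (auto intro!: subspace_add subspace_diff subspace_scale)
    have cq: "c ?q \<in> X" "scale \<beta> ?p \<in> X" "a ?p \<in> X" "c ?p \<in> X" "b ?p \<in> X"
      using inX stable(1) X by (auto intro: subspace_scale)
    have "w + (scale \<beta> ?p - c ?q) = b ?p"
      by (simp add: w_def)
    then have "a (b ?p) = a w + a (scale \<beta> ?p - c ?q)"
      using aadd[OF w(2) subspace_diff[OF X cq(2,1)]] by metis
    also have "a (scale \<beta> ?p - c ?q) = scale \<beta> (a ?p) - a (c ?q)"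
      using operator_diff[OF X aadd asc cq(2,1)] asc[OF inX] by simp
    finally have aw: "a (b ?p) = a w + (scale \<beta> (a ?p) - a (c ?q))" .
    have "b (poly_op a (pCons e p) v) = scale e (b v) + b (a ?p)"
      using lin(1)[of b "scale e v" "a ?p"] lin(2)[of b v e] v cq(3) subspace_scale[OF X]
      by (simp add: aop)
    moreover have "c (poly_op a (pderiv (pCons e p)) v) = c ?p + a (c ?q)"
      using lin(1)[of c ?p "a ?q"] inX aX comm(2)[OF inX]
      by (simp add: pderiv_pCons poly_op_add aop)
    ultimately have "b (poly_op a (pCons e p) v) - scale \<beta> (poly_op a (pCons e p) v)
        + c (poly_op a (pderiv (pCons e p)) v) = scale e (b v - scale \<beta> v) + a w"
      by (simp add: aop ba aw algebra_simps)
    moreover have "scale e (b v - scale \<beta> v) + a w \<in> N"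
      using ev w stable(2) N by (auto intro!: subspace_add subspace_scale)
    ultimately show ?case by simp
  qed
  define ann where "ann p \<longleftrightarrow> p \<noteq> 0 \<and> poly_op a p v \<in> N" for p
  have "\<exists>p. ann p"
    unfolding ann_def by (rule annihilating_poly_exists[OF X N B aX v(1)])
  then obtain p where "is_arg_min degree ann p"
    using ex_has_least_nat[of ann] by (metis is_arg_min_linorder)
  then have p: "p \<noteq> 0" "poly_op a p v \<in> N" and min: "ann q \<Longrightarrow> degree p \<le> degree q" for q
    by (auto simp: is_arg_min_linorder ann_def)
  have "degree p \<noteq> 0"
  proof
    assume "degree p = 0"
    then obtain e where e: "p = [:e:]" "e \<noteq> 0" using p(1) by (metis degree_eq_zeroE pCons_0_0)
    then have "scale (inverse e) (scale e v) \<in> N"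
      using p(2) N subspace_scale by fastforce
    with e v show False by simp
  qed
  then have p': "pderiv p \<noteq> 0" "degree (pderiv p) < degree p"
    by (auto simp: pderiv_eq_0_iff degree_pderiv)
  have "b (poly_op a p v) - scale \<beta> (poly_op a p v) \<in> N"
    using p(2) stable(2) inX N by (auto intro!: subspace_diff subspace_scale)
  from subspace_diff[OF N key[of p] this] have "c (poly_op a (pderiv p) v) \<in> N"
    by simp
  then have "poly_op a (pderiv p) v \<in> N"
    using inj inX by blast
  with p' show False
    using min[of "pderiv p"] by (simp add: ann_def)
qed

end

section \<open>Joint eigenspaces and spaces generated by operators\<close>

context complex_vector_space
begin

definition joint_eigenspace :: "('h \<Rightarrow> 'b \<Rightarrow> 'b) \<Rightarrow> 'h set \<Rightarrow> ('h \<Rightarrow> complex) \<Rightarrow> 'b set" where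
  "joint_eigenspace A H \<mu> = {v. \<forall>h\<in>H. A h v = scale (\<mu> h) v}"

text \<open>Applying A h - \<nu>0(h) removes one term and rescales the others. As all functionals
  vanish off H, two different ones are separated by some h in H.\<close>

lemma joint_eigenvectors_independent:
  assumes lin: "\<And>h. h \<in> H \<Longrightarrow> Vector_Spaces.linear scale scale (A h)"
    and fin: "finite F" and F: "\<And>\<nu> h. \<nu> \<in> F \<Longrightarrow> h \<notin> H \<Longrightarrow> \<nu> h = 0"
    and u: "\<And>\<nu>. \<nu> \<in> F \<Longrightarrow> u \<nu> \<in> joint_eigenspace A H \<nu>" and sum: "(\<Sum>\<nu>\<in>F. u \<nu>) = 0"
  shows "\<forall>\<nu>\<in>F. u \<nu> = 0"
  using fin F u sum
proof (induction F arbitrary: u rule: finite_induct)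
  case empty
  then show ?case by simp
next
  case (insert \<nu>0 F)
  have "u \<nu> = 0" if \<nu>: "\<nu> \<in> F" for \<nu>
  proof -
    have "\<nu> \<noteq> \<nu>0" using \<nu> insert.hyps by auto
    then obtain h where h: "\<nu> h \<noteq> \<nu>0 h" by blast
    then have "h \<in> H"
      using insert.prems(1)[of \<nu> h] insert.prems(1)[of \<nu>0 h] \<nu> by fastforce
    interpret A: Vector_Spaces.linear scale scale "A h" by (rule lin[OF \<open>h \<in> H\<close>])
    let ?u = "\<lambda>\<nu>. scale (\<nu> h - \<nu>0 h) (u \<nu>)"
    have Au: "A h (u \<nu>) = scale (\<nu> h) (u \<nu>)" if "\<nu> \<in> insert \<nu>0 F" for \<nu>
      using insert.prems(2)[OF that] \<open>h \<in> H\<close> by (simp add: joint_eigenspace_def)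
    have "(\<Sum>\<nu>\<in>F. ?u \<nu>) = (\<Sum>\<nu>\<in>insert \<nu>0 F. ?u \<nu>)"
      using insert.hyps by simp
    also have "\<dots> = A h (\<Sum>\<nu>\<in>insert \<nu>0 F. u \<nu>) - scale (\<nu>0 h) (\<Sum>\<nu>\<in>insert \<nu>0 F. u \<nu>)"
      unfolding A.sum scale_sum_right sum_subtractf[symmetric]
      by (intro sum.cong refl) (simp only: Au scale_left_diff_distrib)
    also have "\<dots> = 0" using insert.prems(3) by simp
    finally have "(\<Sum>\<nu>\<in>F. ?u \<nu>) = 0" .
    moreover have "?u \<nu> \<in> joint_eigenspace A H \<nu>" if \<nu>: "\<nu> \<in> F" for \<nu>
      unfolding joint_eigenspace_def
    proof (intro CollectI ballI)
      fix g assume g: "g \<in> H"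
      interpret g: Vector_Spaces.linear scale scale "A g" by (rule lin[OF g])
      have "A g (u \<nu>) = scale (\<nu> g) (u \<nu>)"
        using insert.prems(2)[of \<nu>] \<nu> g by (simp add: joint_eigenspace_def)
      then show "A g (?u \<nu>) = scale (\<nu> g) (?u \<nu>)"
        unfolding g.scale by (simp add: mult.commute)
    qed
    ultimately have "?u \<nu> = 0"
      using insert.IH[of ?u] insert.prems(1) \<nu> by blast
    then show ?thesis using h by simp
  qed
  moreover from this have "u \<nu>0 = 0"
    using insert.prems(3) insert.hyps by simp
  ultimately show ?case by blast
qed

lemma subspace_joint_eigenspace:
  assumes lin: "\<And>h. h \<in> H \<Longrightarrow> Vector_Spaces.linear scale scale (A h)"
  shows "subspace (joint_eigenspace A H \<mu>)"
proof -
  have "A h 0 = 0" "A h (v + w) = A h v + A h w" "A h (scale c v) = scale c (A h v)"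
    if "h \<in> H" for h v w c
  proof -
    interpret A: Vector_Spaces.linear scale scale "A h" by (rule lin[OF that])
    show "A h 0 = 0" "A h (v + w) = A h v + A h w" "A h (scale c v) = scale c (A h v)"
      by (simp_all add: A.zero A.add A.scale)
  qed
  then show ?thesis
    unfolding subspace_def joint_eigenspace_def by (simp add: scale_right_distrib mult.commute)
qed

lemma joint_eigenspace_decomposition:
  fixes A :: "'h \<Rightarrow> 'b \<Rightarrow> 'b"
  assumes S: "\<And>s. s \<in> S \<Longrightarrow> \<exists>\<nu>. s \<in> joint_eigenspace A H \<nu>" and v: "v \<in> span S"
  obtains F u where "finite F" "\<And>\<nu> h. \<nu> \<in> F \<Longrightarrow> h \<notin> H \<Longrightarrow> \<nu> h = 0"
    "\<And>\<nu>. \<nu> \<in> F \<Longrightarrow> u \<nu> \<in> span (S \<inter> joint_eigenspace A H \<nu>)" "v = (\<Sum>\<nu>\<in>F. u \<nu>)"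
proof -
  obtain t r where t: "finite t" "t \<subseteq> S" and v_eq: "v = (\<Sum>s\<in>t. scale (r s) s)"
    using v unfolding span_explicit by blast
  obtain w where w: "\<And>s. s \<in> S \<Longrightarrow> s \<in> joint_eigenspace A H (w s)"
    using S by metis
  \<comment> \<open>Functionals that agree on H have the same eigenspace; extension by zero picks
    one of them, as the independence lemma requires.\<close>
  define res where "res s = (\<lambda>h. if h \<in> H then w s h else 0)" for s
  have res: "s \<in> joint_eigenspace A H (res s)" if "s \<in> t" for s
    using w[of s] t that by (auto simp: joint_eigenspace_def res_def)
  show thesis
  proof (rule that[of "res ` t" "\<lambda>\<nu>. \<Sum>s | s \<in> t \<and> res s = \<nu>. scale (r s) s"])
    show "v = (\<Sum>\<nu>\<in>res ` t. \<Sum>s | s \<in> t \<and> res s = \<nu>. scale (r s) s)"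
      unfolding v_eq by (rule sum.group[symmetric]) (use t in auto)
    fix \<nu> assume "\<nu> \<in> res ` t"
    show "(\<Sum>s | s \<in> t \<and> res s = \<nu>. scale (r s) s) \<in> span (S \<inter> joint_eigenspace A H \<nu>)"
      by (intro span_sum span_scale span_base) (use t res in auto)
  qed (use t in \<open>auto simp: res_def\<close>)
qed

text \<open>Subtract v from its own component at \<mu>: the components now sum to zero, so by
  independence every one vanishes and v equals that component.\<close>

lemma joint_eigenspace_component:
  fixes A :: "'h \<Rightarrow> 'b \<Rightarrow> 'b"
  assumes lin: "\<And>h. h \<in> H \<Longrightarrow> Vector_Spaces.linear scale scale (A h)"
    and S: "\<And>s. s \<in> S \<Longrightarrow> \<exists>\<nu>. s \<in> joint_eigenspace A H \<nu>"
    and v: "v \<in> span S" "v \<in> joint_eigenspace A H \<mu>"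
  shows "v \<in> span (S \<inter> joint_eigenspace A H \<mu>)"
proof -
  obtain F u where F: "finite F" "\<And>\<nu> h. \<nu> \<in> F \<Longrightarrow> h \<notin> H \<Longrightarrow> \<nu> h = 0"
    "\<And>\<nu>. \<nu> \<in> F \<Longrightarrow> u \<nu> \<in> span (S \<inter> joint_eigenspace A H \<nu>)" "v = (\<Sum>\<nu>\<in>F. u \<nu>)"
    using joint_eigenspace_decomposition[OF S v(1)] by metis
  define \<mu>' where "\<mu>' = (\<lambda>h. if h \<in> H then \<mu> h else 0)"
  have \<mu>': "joint_eigenspace A H \<mu>' = joint_eigenspace A H \<mu>"
    by (simp add: joint_eigenspace_def \<mu>'_def)
  have sub: "subspace (joint_eigenspace A H \<nu>)" for \<nu>
    using lin by (rule subspace_joint_eigenspace)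
  define u' where "u' \<nu> = (if \<nu> \<in> F then u \<nu> else 0)" for \<nu>
  define d where "d \<nu> = u' \<nu> - (if \<nu> = \<mu>' then v else 0)" for \<nu>
  have u': "u' \<nu> \<in> span (S \<inter> joint_eigenspace A H \<nu>)" for \<nu>
    using F(3) by (simp add: u'_def span_zero)
  have "(\<Sum>\<nu>\<in>insert \<mu>' F. u' \<nu>) = v"
    unfolding F(4) by (rule sum.mono_neutral_cong_right) (use F(1) in \<open>auto simp: u'_def\<close>)
  then have "(\<Sum>\<nu>\<in>insert \<mu>' F. d \<nu>) = 0"
    using F(1) by (simp add: d_def sum_subtractf)
  moreover have "u' \<nu> \<in> joint_eigenspace A H \<nu>" for \<nu>
    using u' span_minimal[OF _ sub] by blast
  then have "d \<nu> \<in> joint_eigenspace A H \<nu>" for \<nu>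
    unfolding d_def using v(2) \<mu>' subspace_0[OF sub] by (intro subspace_diff[OF sub]) auto
  ultimately have "\<forall>\<nu>\<in>insert \<mu>' F. d \<nu> = 0"
    by (intro joint_eigenvectors_independent[where A = A and H = H and u = d, OF lin])
       (use F(1,2) in \<open>auto simp: \<mu>'_def\<close>)
  then have "v = u' \<mu>'"
    by (simp add: d_def)
  then show ?thesis
    using u'[of \<mu>'] \<mu>' by simp
qed

text \<open>Simultaneous diagonalization, one operator at a time: the A h-components of a joint
  eigenvector of H are again eigenvectors for H, because the operators of H preserve the eigenspaces
  of A h.\<close>

lemma joint_eigenspace_spanning:
  fixes A :: "'h \<Rightarrow> 'b \<Rightarrow> 'b"
  assumes lin: "\<And>h. h \<in> H \<Longrightarrow> Vector_Spaces.linear scale scale (A h)"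
    and X: "subspace X" "\<And>h x. h \<in> H \<Longrightarrow> x \<in> X \<Longrightarrow> A h x \<in> X"
    and comm: "\<And>g h x. g \<in> H \<Longrightarrow> h \<in> H \<Longrightarrow> x \<in> X \<Longrightarrow> A g (A h x) = A h (A g x)"
    and diag: "\<And>h. h \<in> H \<Longrightarrow> X \<subseteq> span {x \<in> X. \<exists>c. A h x = scale c x}"
    and fin: "finite H"
  shows "X \<subseteq> span {x \<in> X. \<exists>\<nu>. x \<in> joint_eigenspace A H \<nu>}"
  using fin lin X(2) comm diag
proof (induction H rule: finite_induct)
  case empty
  then show ?case by (auto simp: joint_eigenspace_def span_base)
next
  case (insert h H)
  let ?S = "{x \<in> X. \<exists>c. A h x = scale c x}"
  let ?J = "{x \<in> X. \<exists>\<nu>. x \<in> joint_eigenspace A (insert h H) \<nu>}"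
  have "x \<in> span ?J" if x: "x \<in> X" "x \<in> joint_eigenspace A H \<nu>" for x \<nu>
  proof -
    have xS: "x \<in> span ?S"
      using insert.prems(4)[of h] x by blast
    have evS: "\<exists>\<mu>. s \<in> joint_eigenspace A {h} \<mu>" if s: "s \<in> ?S" for s
    proof -
      obtain c where "A h s = scale c s" using s by blast
      then show ?thesis by (intro exI[of _ "\<lambda>_. c"]) (simp add: joint_eigenspace_def)
    qed
    obtain F u where F: "finite F" "\<And>\<mu> g. \<mu> \<in> F \<Longrightarrow> g \<notin> {h} \<Longrightarrow> \<mu> g = 0"
      and u: "\<And>\<mu>. \<mu> \<in> F \<Longrightarrow> u \<mu> \<in> span (?S \<inter> joint_eigenspace A {h} \<mu>)" and x_eq: "x = (\<Sum>\<mu>\<in>F. u \<mu>)"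
      by (rule joint_eigenspace_decomposition[of ?S A "{h}" x, OF evS xS]) blast+
    have lin_h: "Vector_Spaces.linear scale scale (A g)" if "g \<in> {h}" for g
      using insert.prems(1) that by simp
    have subE: "subspace (joint_eigenspace A {h} \<mu>)" for \<mu>
      using lin_h by (rule subspace_joint_eigenspace)
    have uX: "u \<mu> \<in> X" "u \<mu> \<in> joint_eigenspace A {h} \<mu>" if \<mu>: "\<mu> \<in> F" for \<mu>
    proof -
      have "?S \<inter> joint_eigenspace A {h} \<mu> \<subseteq> X \<inter> joint_eigenspace A {h} \<mu>" by blast
      from span_minimal[OF this subspace_inter[OF X(1) subE]]
      show "u \<mu> \<in> X" "u \<mu> \<in> joint_eigenspace A {h} \<mu>" using u[OF \<mu>] by auto
    qed
    have "u \<mu> \<in> ?J" if \<mu>: "\<mu> \<in> F" for \<mu>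
    proof -
      have "A g (u \<mu>) = scale (\<nu> g) (u \<mu>)" if g: "g \<in> H" for g
      proof -
        interpret g: Vector_Spaces.linear scale scale "A g" by (rule insert.prems(1)) (use g in simp)
        interpret h: Vector_Spaces.linear scale scale "A h" by (rule insert.prems(1)) simp
        let ?d = "\<lambda>\<mu>. A g (u \<mu>) - scale (\<nu> g) (u \<mu>)"
        have "(\<Sum>\<mu>\<in>F. ?d \<mu>) = A g x - scale (\<nu> g) x"
          by (simp add: x_eq g.sum scale_sum_right sum_subtractf)
        also have "\<dots> = 0" using x(2) g by (simp add: joint_eigenspace_def)
        finally have sum0: "(\<Sum>\<mu>\<in>F. ?d \<mu>) = 0" .
        have "?d \<mu> \<in> joint_eigenspace A {h} \<mu>" if \<mu>: "\<mu> \<in> F" for \<mu>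
        proof -
          have "A h (u \<mu>) = scale (\<mu> h) (u \<mu>)"
            using uX(2)[OF \<mu>] by (simp add: joint_eigenspace_def)
          moreover have "A h (A g (u \<mu>)) = A g (A h (u \<mu>))"
            using insert.prems(3)[of h g "u \<mu>"] g uX(1)[OF \<mu>] by simp
          ultimately show ?thesis
            by (simp add: joint_eigenspace_def h.diff h.scale g.scale scale_right_diff_distrib mult.commute)
        qed
        then have "\<forall>\<mu>\<in>F. ?d \<mu> = 0"
          using F(1,2) sum0
          by (intro joint_eigenvectors_independent[where A = A and H = "{h}" and u = ?d, OF lin_h])
        then show ?thesis using \<mu> by simp
      qed
      then have "u \<mu> \<in> joint_eigenspace A (insert h H) (\<nu>(h := \<mu> h))"
        using uX(2)[OF \<mu>] insert.hyps by (auto simp: joint_eigenspace_def)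
      then show ?thesis using uX(1)[OF \<mu>] by blast
    qed
    then show ?thesis
      unfolding x_eq by (intro span_sum span_base)
  qed
  then have "span {x \<in> X. \<exists>\<nu>. x \<in> joint_eigenspace A H \<nu>} \<subseteq> span ?J"
    by (intro span_minimal subspace_span) auto
  moreover have "X \<subseteq> span {x \<in> X. \<exists>\<nu>. x \<in> joint_eigenspace A H \<nu>}"
    by (rule insert.IH) (use insert.prems in auto)
  ultimately show ?case by blast
qed

text \<open>No diagonalizability is assumed here. The joint eigenspace found so far is stable under
  the next commuting operator, which has an eigenvector in it because the dimension is
  finite.\<close>

lemma joint_eigenvector_exists:
  fixes A :: "'h \<Rightarrow> 'b \<Rightarrow> 'b"
  assumes lin: "\<And>h. h \<in> H \<Longrightarrow> Vector_Spaces.linear scale scale (A h)"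
    and X: "subspace X" "\<And>h x. h \<in> H \<Longrightarrow> x \<in> X \<Longrightarrow> A h x \<in> X" "X \<noteq> {0}"
    and comm: "\<And>g h x. g \<in> H \<Longrightarrow> h \<in> H \<Longrightarrow> x \<in> X \<Longrightarrow> A g (A h x) = A h (A g x)"
    and B: "finite B" "X \<subseteq> span B" and fin: "finite H"
  shows "\<exists>x\<in>X. \<exists>\<nu>. x \<noteq> 0 \<and> x \<in> joint_eigenspace A H \<nu>"
  using fin lin X(2) comm
proof (induction H rule: finite_induct)
  case empty
  then show ?case using X(1,3) subspace_0 by (auto simp: joint_eigenspace_def)
next
  case (insert h H)
  have "\<exists>x\<in>X. \<exists>\<nu>. x \<noteq> 0 \<and> x \<in> joint_eigenspace A H \<nu>"
    by (rule insert.IH) (use insert.prems in auto)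
  then obtain x \<nu> where x: "x \<in> X" "x \<noteq> 0" "x \<in> joint_eigenspace A H \<nu>" by blast
  have linH: "Vector_Spaces.linear scale scale (A g)" if "g \<in> H" for g
    using insert.prems(1) that by simp
  interpret h: Vector_Spaces.linear scale scale "A h" by (rule insert.prems(1)) simp
  define Y where "Y = X \<inter> joint_eigenspace A H \<nu>"
  have Y: "subspace Y"
    unfolding Y_def using X(1) subspace_joint_eigenspace[where A = A and H = H, OF linH] by (rule subspace_inter)
  have "A h y \<in> Y" if y: "y \<in> Y" for y
  proof -
    have "A g (A h y) = scale (\<nu> g) (A h y)" if g: "g \<in> H" for g
    proof -
      have "A g (A h y) = A h (A g y)"
        using insert.prems(3)[of g h y] g y by (simp add: Y_def)
      also have "A g y = scale (\<nu> g) y"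
        using y g by (simp add: Y_def joint_eigenspace_def)
      finally show ?thesis by (simp add: h.scale)
    qed
    then show ?thesis
      using y insert.prems(2)[of h y] by (simp add: Y_def joint_eigenspace_def)
  qed
  moreover have "Y \<subseteq> span (B \<union> {0})"
    using B(2) span_mono[of B "B \<union> {0}"] unfolding Y_def by blast
  moreover have "\<not> Y \<subseteq> {0}"
    using x by (auto simp: Y_def)
  ultimately have "\<exists>y\<in>Y - {0}. \<exists>c. A h y - scale c y \<in> {0}"
    by (intro eigenvector_mod_exists[OF Y subspace_single_0 B(1)]) (auto simp: h.add h.scale)
  then obtain y c where y: "y \<in> Y" "y \<noteq> 0" "A h y = scale c y" by auto
  then have "y \<in> joint_eigenspace A (insert h H) (\<nu>(h := c))"
    using insert.hyps by (auto simp: Y_def joint_eigenspace_def)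
  with y show ?case by (auto simp: Y_def)
qed

section \<open>Spaces generated by a set of operators\<close>

inductive_set op_span :: "('b \<Rightarrow> 'b) set \<Rightarrow> 'b set \<Rightarrow> 'b set"
  for M :: "('b \<Rightarrow> 'b) set" and N :: "'b set" where
  zero: "0 \<in> op_span M N"
| base: "v \<in> N \<Longrightarrow> v \<in> op_span M N"
| add: "v \<in> op_span M N \<Longrightarrow> w \<in> op_span M N \<Longrightarrow> v + w \<in> op_span M N"
| scale: "v \<in> op_span M N \<Longrightarrow> scale c v \<in> op_span M N"
| op: "y \<in> M \<Longrightarrow> v \<in> op_span M N \<Longrightarrow> y v \<in> op_span M N"

lemma subspace_op_span: "subspace (op_span M N)"
  by (auto simp: subspace_def intro: op_span.intros)

lemma op_span_least:
  assumes "subspace Y" "N \<subseteq> Y" "\<And>y v. y \<in> M \<Longrightarrow> v \<in> Y \<Longrightarrow> y v \<in> Y"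
  shows "op_span M N \<subseteq> Y"
proof
  fix v assume "v \<in> op_span M N"
  then show "v \<in> Y"
    by induction (use assms in \<open>auto intro: subspace_0 subspace_add subspace_scale\<close>)
qed

text \<open>Move x to the right past y. The commutator is a combination of operators of M and R
  applied to v, for which the claim is known; hence the induction keeps x arbitrary in R.\<close>

lemma op_span_stable:
  assumes lin: "\<And>x. x \<in> R \<Longrightarrow> Vector_Spaces.linear scale scale x"
    and comm: "\<And>x y v. x \<in> R \<Longrightarrow> y \<in> M \<Longrightarrow> x (y v) - y (x v) \<in> span {u v |u. u \<in> M \<union> R}"
    and N: "\<And>x v. x \<in> R \<Longrightarrow> v \<in> N \<Longrightarrow> x v \<in> op_span M N"
    and v: "v \<in> op_span M N" and x: "x \<in> R"
  shows "x v \<in> op_span M N"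
  using v x
proof (induction arbitrary: x)
  case zero
  interpret x: Vector_Spaces.linear scale scale x by (rule lin[OF zero])
  show ?case by (simp add: x.zero op_span.zero)
next
  case (add v w)
  interpret x: Vector_Spaces.linear scale scale x by (rule lin[OF add.prems])
  show ?case unfolding x.add using add.IH add.prems by (intro op_span.add)
next
  case (scale v c)
  interpret x: Vector_Spaces.linear scale scale x by (rule lin[OF scale.prems])
  show ?case unfolding x.scale using scale.IH scale.prems by (intro op_span.scale)
next
  case (op y v)
  have "span {u v |u. u \<in> M \<union> R} \<subseteq> op_span M N"
    by (rule span_minimal[OF _ subspace_op_span]) (use op in \<open>auto intro: op_span.op\<close>)
  then have "x (y v) - y (x v) \<in> op_span M N"
    using comm op by blast
  moreover have "y (x v) \<in> op_span M N"
    using op by (auto intro: op_span.op)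
  ultimately show ?case
    using op_span.add by fastforce
qed (use N in auto)

text \<open>Add one operator at a time. If X1 is stable under the earlier operators, so is the span
  of all y^a X1: moving an earlier operator past the last one, y, only produces earlier operators
  and N. Local nilpotency keeps the dimension modulo N finite.\<close>

lemma nilpotent_extension:
  assumes "subspace X" "subspace N" "N \<subseteq> X" "finite B" "X \<subseteq> span (B \<union> N)"
    and lin: "\<And>y. y \<in> set ys \<Longrightarrow> Vector_Spaces.linear scale scale y"
    and yN: "\<And>y v. y \<in> set ys \<Longrightarrow> v \<in> N \<Longrightarrow> y v \<in> N"
    and nil: "\<And>y v. y \<in> set ys \<Longrightarrow> \<exists>k. (y ^^ k) v = 0"
    and comm: "\<And>i j v. j < i \<Longrightarrow> i < length ys \<Longrightarrow>
        (ys ! i) ((ys ! j) v) - (ys ! j) ((ys ! i) v) \<in> span ({(ys ! k) v |k. k < i} \<union> N)"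
  shows "\<exists>X' B'. subspace X' \<and> X \<subseteq> X' \<and> finite B' \<and> X' \<subseteq> span (B' \<union> N) \<and>
    (\<forall>y\<in>set ys. \<forall>v\<in>X'. y v \<in> X')"
  using lin yN nil comm
proof (induction ys rule: rev_induct)
  case Nil
  then show ?case using assms(1-5) by auto
next
  case (snoc y ys)
  have comm': "(ys ! i) ((ys ! j) v) - (ys ! j) ((ys ! i) v) \<in> span ({(ys ! k) v |k. k < i} \<union> N)"
    if "j < i" "i < length ys" for i j v
  proof -
    have "{((ys @ [y]) ! k) v |k. k < i} = {(ys ! k) v |k. k < i}"
      using that by (force simp: nth_append)
    then show ?thesis
      using snoc.prems(4)[of j i v] that by (simp add: nth_append)
  qed
  have "\<exists>X' B'. subspace X' \<and> X \<subseteq> X' \<and> finite B' \<and> X' \<subseteq> span (B' \<union> N) \<and>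
    (\<forall>y\<in>set ys. \<forall>v\<in>X'. y v \<in> X')"
    by (rule snoc.IH) (use snoc.prems(1-3) comm' in auto)
  then obtain X1 B1 where X1: "subspace X1" "X \<subseteq> X1" "finite B1" "X1 \<subseteq> span (B1 \<union> N)"
    and st: "\<And>y v. y \<in> set ys \<Longrightarrow> v \<in> X1 \<Longrightarrow> y v \<in> X1" by blast
  interpret y: Vector_Spaces.linear scale scale y by (rule snoc.prems(1)) simp
  have linpow: "Vector_Spaces.linear scale scale (y ^^ a)" for a
  proof (induction a)
    case 0
    show ?case by (simp add: Vector_Spaces.linear_iff vector_space_axioms)
  next
    case (Suc a)
    then show ?case using Vector_Spaces.linear_compose[OF Suc y.linear_axioms] by (simp add: comp_def)
  qed
  define X2 where "X2 = span (\<Union>a. (y ^^ a) ` X1)"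
  have X1X2: "X1 \<subseteq> X2"
    unfolding X2_def by (rule subset_trans[OF _ span_superset]) (auto intro!: exI[of _ 0] UN_I[of 0])
  have lin_st: "f v \<in> X2" if f: "Vector_Spaces.linear scale scale f"
      and gen: "\<And>a x. x \<in> X1 \<Longrightarrow> f ((y ^^ a) x) \<in> X2" and v: "v \<in> X2" for f v
  proof -
    interpret f: Vector_Spaces.linear scale scale f by (rule f)
    show ?thesis
      using v unfolding X2_def
    proof (induction rule: span_induct_alt)
      case (step c x z)
      then show ?case
        using gen unfolding X2_def f.add f.scale by (auto intro!: span_add span_scale)
    qed (simp add: f.zero span_zero)
  qed
  have yX2: "y v \<in> X2" if "v \<in> X2" for v
  proof (rule lin_st[OF y.linear_axioms _ that])
    fix a x assume "x \<in> X1"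
    then have "(y ^^ Suc a) x \<in> (\<Union>a. (y ^^ a) ` X1)" by blast
    then show "y ((y ^^ a) x) \<in> X2" unfolding X2_def by (simp add: span_base)
  qed
  \<comment> \<open>All earlier operators are treated in one induction, since the commutator of y
    with one of them may involve the others.\<close>
  have gen: "\<forall>j<length ys. (ys ! j) ((y ^^ a) x) \<in> X2" if x: "x \<in> X1" for a x
  proof (induction a)
    case 0
    then show ?case using st[OF _ x] X1X2 by auto
  next
    case (Suc a)
    let ?w = "(y ^^ a) x"
    show ?case
    proof (intro allI impI)
      fix j assume j: "j < length ys"
      have "y ((ys ! j) ?w) - (ys ! j) (y ?w) \<in> span ({((ys @ [y]) ! k) ?w |k. k < length ys} \<union> N)"
        using snoc.prems(4)[of j "length ys" ?w] j by (simp add: nth_append)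
      also have "\<dots> \<subseteq> X2"
        unfolding X2_def
      proof (rule span_minimal[OF _ subspace_span], fold X2_def)
        show "{((ys @ [y]) ! k) ?w |k. k < length ys} \<union> N \<subseteq> X2"
          using Suc.IH X1X2 X1(2) assms(3) by (auto simp: nth_append)
      qed
      finally have c: "y ((ys ! j) ?w) - (ys ! j) (y ?w) \<in> X2" .
      have "y ((ys ! j) ?w) \<in> X2"
        using Suc.IH j yX2 by blast
      from span_diff[OF this[unfolded X2_def] c[unfolded X2_def], folded X2_def]
      show "(ys ! j) ((y ^^ Suc a) x) \<in> X2" by simp
    qed
  qed
  have st2: "u v \<in> X2" if "u \<in> set (ys @ [y])" "v \<in> X2" for u v
  proof (cases "u \<in> set ys")
    case True
    then obtain j where "j < length ys" "u = ys ! j" by (metis in_set_conv_nth)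
    then show ?thesis
      using lin_st[of u v] snoc.prems(1)[of u] gen that by auto
  next
    case False
    then show ?thesis using that yX2 by simp
  qed
  obtain K where K: "\<And>b. (y ^^ K b) b = 0"
    using snoc.prems(3)[of y] by (metis in_set_conv_decomp)
  \<comment> \<open>Nilpotency is only local, so the exponent K b depends on the spanning vector b;
    there are finitely many of these, and N absorbs its own images.\<close>
  define B2 where "B2 = (\<Union>b\<in>B1. (\<lambda>a. (y ^^ a) b) ` {..<K b})"
  have powN: "(y ^^ a) v \<in> N" if "v \<in> N" for a v
    using that by (induction a) (auto intro: snoc.prems(2))
  have "(y ^^ a) x \<in> span (B2 \<union> N)" if x: "x \<in> X1" for a x
  proof -
    interpret p: Vector_Spaces.linear scale scale "y ^^ a" by (rule linpow)
    have "(y ^^ a) b \<in> span (B2 \<union> N)" if b: "b \<in> B1" for b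
    proof (cases "a < K b")
      case True
      then show ?thesis using b by (intro span_base) (auto simp: B2_def)
    next
      case False
      then obtain d where "a = d + K b" by (metis add.commute le_iff_add not_less)
      moreover have "(y ^^ d) 0 = 0"
        by (induction d) (auto simp: y.zero)
      ultimately show ?thesis using K[of b] by (simp add: funpow_add span_zero)
    qed
    then have "(y ^^ a) ` (B1 \<union> N) \<subseteq> span (B2 \<union> N)"
      using powN span_superset[of "B2 \<union> N"] by auto
    then have "(y ^^ a) ` span (B1 \<union> N) \<subseteq> span (B2 \<union> N)"
      unfolding p.span_image[symmetric] by (rule span_minimal[OF _ subspace_span])
    then show ?thesis using X1(4) x by blast
  qed
  then have "X2 \<subseteq> span (B2 \<union> N)"
    unfolding X2_def by (intro span_minimal subspace_span) auto
  moreover have "finite B2" using X1(3) by (simp add: B2_def)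
  moreover have "subspace X2" by (simp add: X2_def)
  ultimately show ?case
    using st2 X1X2 X1(2) by (intro exI[of _ X2] exI[of _ B2]) blast
qed

end

lemma finite_vec_box:
  assumes "\<And>i. finite (S i)"
  shows "finite {k :: 'a ^ 'n::finite. \<forall>i. k $ i \<in> S i}"
proof -
  have "{k :: 'a ^ 'n. \<forall>i. k $ i \<in> S i} \<subseteq> vec_lambda ` (PiE UNIV S)"
  proof
    fix k :: "'a ^ 'n" assume "k \<in> {k. \<forall>i. k $ i \<in> S i}"
    then have "vec_nth k \<in> PiE UNIV S" by auto
    then have "vec_lambda (vec_nth k) \<in> vec_lambda ` (PiE UNIV S)" by (rule imageI)
    then show "k \<in> vec_lambda ` (PiE UNIV S)" by simp
  qed
  moreover have "finite (PiE (UNIV :: 'n set) S)" by (intro finite_PiE assms) simp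
  ultimately show ?thesis using finite_subset by blast
qed

lemma vector_space_fscale: "vector_space fscale"
  by unfold_locales (auto simp: fscale_def fun_eq_iff algebra_simps)

section \<open>Weights of the Lie torus\<close>

locale lie_torus_setting =
  fixes T :: "('g::ab_group_add, 'n::finite) lie_torus_data"
  assumes torus: "lie_torus T"
begin

abbreviation "bracket \<equiv> gbr T"

lemma gg_algebra: "lie_algebra (gg T)"
  using torus unfolding lie_torus_def simple_lie_algebra_def by blast

sublocale g: complex_vector_space "gscale T"
  using gg_algebra unfolding lie_algebra_def complex_vector_space_def gg_def by simp

lemma bracket_linear:
  "bracket (x + y) z = bracket x z + bracket y z" "bracket z (x + y) = bracket z x + bracket z y"
  "bracket (gscale T c x) y = gscale T c (bracket x y)" "bracket x (gscale T c y) = gscale T c (bracket x y)"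
  using gg_algebra unfolding lie_algebra_def gg_def by simp_all

lemma linear_bracket_left: "Vector_Spaces.linear (gscale T) (gscale T) (bracket x)"
  by (simp add: Vector_Spaces.linear_iff g.vector_space_axioms bracket_linear)

lemma bracket_zero [simp]: "bracket 0 y = 0" "bracket x 0 = 0"
  using bracket_linear(3)[of 0 0 y] bracket_linear(4)[of x 0 0] by simp_all

lemma bracket_self: "bracket x x = 0"
  using gg_algebra unfolding lie_algebra_def gg_def by simp

lemma bracket_anticomm: "bracket x y = - bracket y x"
  using bracket_self[of "x + y"] bracket_self[of x] bracket_self[of y]
  by (simp add: bracket_linear eq_neg_iff_add_eq_0 add.commute)

lemma bracket_minus [simp]: "bracket (- x) y = - bracket x y" "bracket x (- y) = - bracket x y"
  using bracket_linear(3)[of "-1" x y] bracket_linear(4)[of x "-1" y] by simp_all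

lemma jacobi: "bracket x (bracket y z) = bracket (bracket x y) z + bracket y (bracket x z)"
proof -
  have "bracket x (bracket y z) + bracket y (bracket z x) + bracket z (bracket x y) = 0"
    using gg_algebra unfolding lie_algebra_def gg_def by simp
  then show ?thesis
    using bracket_anticomm[of z x] bracket_anticomm[of z "bracket x y"]
    by (simp add: algebra_simps eq_neg_iff_add_eq_0)
qed

lemma finite_spanning: "\<exists>B. finite B \<and> g.span B = UNIV"
  using torus unfolding lie_torus_def fd_subspace_def by metis

lemma linear_sig: "Vector_Spaces.linear (gscale T) (gscale T) (sig T i)"
  and sig_bracket: "sig T i (bracket x y) = bracket (sig T i x) (sig T i y)"
  and sig_automorphism: "lie_automorphism T (sig T i)"
  and sig_commute: "sig T i (sig T j x) = sig T j (sig T i x)"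
  using torus unfolding lie_torus_def lie_automorphism_def by (auto simp: fun_eq_iff)

lemma ordr_pos: "ordr T i > 0" and sig_ordr: "sig T i ^^ ordr T i = id"
  and xi_ordr: "xi T i ^ ordr T i = 1"
  using torus unfolding lie_torus_def by auto

lemma xi_nonzero: "xi T i \<noteq> 0"
  using xi_ordr[of i] ordr_pos[of i] by (metis power_0_left not_gr_zero zero_neq_one)

lemma xi_powi_add: "xi T i powi (a + b) = xi T i powi a * xi T i powi b"
  by (simp add: power_int_add xi_nonzero)

lemma xi_powi_dvd: "int (ordr T i) dvd a \<Longrightarrow> xi T i powi a = 1"
  by (auto simp: power_int_mult xi_ordr elim!: dvdE)

lemma subspace_gk: "g.subspace (gk T k)"
proof -
  have "sig T i 0 = 0" "sig T i (x + y) = sig T i x + sig T i y"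
    "sig T i (gscale T c x) = gscale T c (sig T i x)" for i x y c
  proof -
    interpret s: Vector_Spaces.linear "gscale T" "gscale T" "sig T i" by (rule linear_sig)
    show "sig T i 0 = 0" "sig T i (x + y) = sig T i x + sig T i y"
      "sig T i (gscale T c x) = gscale T c (sig T i x)"
      by (simp_all add: s.zero s.add s.scale)
  qed
  then show ?thesis
    unfolding g.subspace_def gk_def by (simp add: g.scale_right_distrib mult.commute)
qed

lemma gk_bracket: "x \<in> gk T k \<Longrightarrow> y \<in> gk T l \<Longrightarrow> bracket x y \<in> gk T (k + l)"
  by (simp add: gk_def sig_bracket bracket_linear xi_powi_add mult.commute)

lemma gk_add_Gam: "r \<in> Gam T \<Longrightarrow> gk T (k + r) = gk T k"
  by (simp add: gk_def Gam_def xi_powi_add xi_powi_dvd)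

lemma gk_Gam: "r \<in> Gam T \<Longrightarrow> gk T r = gk T 0"
  using gk_add_Gam[of r 0] by simp

lemma gk_weight_add_Gam: "r \<in> Gam T \<Longrightarrow> gk_weight T (k + r) \<alpha> = gk_weight T k \<alpha>"
  by (simp add: gk_weight_def gk_add_Gam)

lemma gk_weight_Gam: "r \<in> Gam T \<Longrightarrow> gk_weight T r \<alpha> = gk_weight T 0 \<alpha>"
  using gk_weight_add_Gam[of r 0] by simp

lemma gk_weight_eq: "gk_weight T k \<alpha> = gk T k \<inter> g.joint_eigenspace bracket (cartan T) \<alpha>"
  by (auto simp: gk_weight_def g.joint_eigenspace_def)

lemma subspace_gk_weight: "g.subspace (gk_weight T k \<alpha>)"
  unfolding gk_weight_eq
  by (intro g.subspace_inter subspace_gk g.subspace_joint_eigenspace linear_bracket_left)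

lemma gk_weight_bracket:
  assumes "x \<in> gk_weight T k \<alpha>" "y \<in> gk_weight T l \<beta>"
  shows "bracket x y \<in> gk_weight T (k + l) (\<alpha> + \<beta>)"
  using assms by (auto simp: gk_weight_def gk_bracket jacobi[of _ x y] bracket_linear g.scale_left_distrib)

lemma cartan_algebra: "cartan_subalgebra (g0 T) (cartan T)"
  and g0_simple: "simple_lie_algebra (g0 T)"
  and base_simple: "simple_roots (roots0 T) (base T)"
  using torus unfolding lie_torus_def by blast+

lemma gk_decomposition:
  "\<forall>k. k \<notin> Gam T \<and> gk T k \<noteq> {0} \<longrightarrow>
     (\<exists>U W. lie_submodule (g0 T) (adjoint_on T (gk T k)) U \<and>
            lie_submodule (g0 T) (adjoint_on T (gk T k)) W \<and>
            U \<inter> W = {0} \<and> gk T k = {u + w |u w. u \<in> U \<and> w \<in> W} \<and>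
            (\<forall>x\<in>gk T 0. \<forall>u\<in>U. gbr T x u = 0) \<and>
            (W = {0} \<or>
              irreducible_module (g0 T) (adjoint_on T W) \<and> vector_space.dim (gscale T) W > 1 \<and>
              (\<forall>\<alpha>\<in>hdual T. W \<inter> gk_weight T k \<alpha> \<noteq> {0} \<longrightarrow> \<alpha> \<in> insert 0 (roots_en T))))"
  using torus unfolding lie_torus_def by (elim conjE) assumption

lemma cartan_toral: "cartan T \<subseteq> gk T 0" "g.subspace (cartan T)"
  "h \<in> cartan T \<Longrightarrow> h' \<in> cartan T \<Longrightarrow> bracket h h' = 0"
  "h \<in> cartan T \<Longrightarrow> gk T 0 = g.span {x \<in> gk T 0. \<exists>c. bracket h x = gscale T c x}"
  using cartan_algebra unfolding cartan_subalgebra_def toral_subalgebra_def g0_def by auto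

lemma cartan_weight_zero: "h \<in> cartan T \<Longrightarrow> h \<in> gk_weight T 0 0"
  using cartan_toral by (auto simp: gk_weight_def)

lemma cartan_commute: "h \<in> cartan T \<Longrightarrow> h' \<in> cartan T \<Longrightarrow> bracket h (bracket h' x) = bracket h' (bracket h x)"
  by (subst jacobi) (simp add: cartan_toral(3))

lemma cartan_gk: "h \<in> cartan T \<Longrightarrow> x \<in> gk T k \<Longrightarrow> bracket h x \<in> gk T k"
  using gk_bracket[of h 0 x k] cartan_toral(1) by auto

text \<open>Simultaneous diagonalization above is for finitely many operators; a finite spanning set
  of the Cartan subalgebra provides them.\<close>

lemma cartan_basis: "\<exists>F. finite F \<and> F \<subseteq> cartan T \<and> cartan T \<subseteq> g.span F"
proof -
  obtain B where B: "finite B" "g.span B = UNIV" using finite_spanning by blast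
  have "g.span (B \<union> {0}) = UNIV"
    using B(2) g.span_mono[of B "B \<union> {0}"] by auto
  then obtain F where F: "finite F" "F \<subseteq> cartan T" "cartan T \<subseteq> g.span (F \<union> (cartan T \<inter> {0}))"
    using g.finite_codim_subset[OF B(1) cartan_toral(2) g.subspace_single_0] by auto
  have "cartan T \<inter> {0} = {0}" using g.subspace_0[OF cartan_toral(2)] by auto
  with F show ?thesis by auto
qed

lemma hdual_linear:
  "\<alpha> \<in> hdual T \<Longrightarrow> h \<in> cartan T \<Longrightarrow> h' \<in> cartan T \<Longrightarrow> \<alpha> (h + h') = \<alpha> h + \<alpha> h'"
  "\<alpha> \<in> hdual T \<Longrightarrow> h \<in> cartan T \<Longrightarrow> \<alpha> (gscale T c h) = c * \<alpha> h"
  "\<alpha> \<in> hdual T \<Longrightarrow> h \<notin> cartan T \<Longrightarrow> \<alpha> h = 0"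
  by (auto simp: hdual_def dual_space_def)

lemma hdual_zero: "0 \<in> hdual T"
  and hdual_add: "\<alpha> \<in> hdual T \<Longrightarrow> \<beta> \<in> hdual T \<Longrightarrow> \<alpha> + \<beta> \<in> hdual T"
  and hdual_neg: "\<alpha> \<in> hdual T \<Longrightarrow> - \<alpha> \<in> hdual T"
  by (auto simp: hdual_def dual_space_def algebra_simps)

lemma hdual_eqI:
  "\<alpha> \<in> hdual T \<Longrightarrow> \<beta> \<in> hdual T \<Longrightarrow> (\<And>h. h \<in> cartan T \<Longrightarrow> \<alpha> h = \<beta> h) \<Longrightarrow> \<alpha> = \<beta>"
  by (rule ext) (metis hdual_linear(3))

text \<open>Being an eigenvector passes from F to its span by linearity of the bracket. Since x is
  non-zero the eigenvalue is unique, and so it depends linearly on h.\<close>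

lemma hdual_of_eigenvector:
  assumes F: "F \<subseteq> cartan T" "cartan T \<subseteq> g.span F"
    and x: "x \<noteq> 0" "x \<in> g.joint_eigenspace bracket F \<nu>"
  shows "\<exists>\<alpha>\<in>hdual T. x \<in> g.joint_eigenspace bracket (cartan T) \<alpha>"
proof -
  have "\<exists>c. bracket h x = gscale T c x" if "h \<in> g.span F" for h
    using that
  proof (induction rule: g.span_induct_alt)
    case base
    show ?case by (intro exI[of _ 0]) simp
  next
    case (step c h g)
    then obtain e where "bracket g x = gscale T e x" by blast
    moreover have "bracket h x = gscale T (\<nu> h) x"
      using step(1) x(2) by (simp add: g.joint_eigenspace_def)
    ultimately show ?case
      by (intro exI[of _ "c * \<nu> h + e"]) (simp add: bracket_linear g.scale_left_distrib)
  qed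
  then obtain a where a: "\<And>h. h \<in> cartan T \<Longrightarrow> bracket h x = gscale T (a h) x"
    using F(2) by (metis subsetD)
  define \<alpha> where "\<alpha> h = (if h \<in> cartan T then a h else 0)" for h
  have "\<alpha> \<in> hdual T"
    unfolding hdual_def dual_space_def
  proof (intro CollectI conjI ballI allI impI)
    fix h h' assume h: "h \<in> cartan T" "h' \<in> cartan T"
    then have s: "h + h' \<in> cartan T" using cartan_toral(2) g.subspace_add by blast
    have "gscale T (a (h + h')) x = gscale T (a h + a h') x"
      using a[OF s] a[OF h(1)] a[OF h(2)] by (simp add: bracket_linear g.scale_left_distrib)
    then show "\<alpha> (h + h') = \<alpha> h + \<alpha> h'"
      using x(1) h s by (simp add: \<alpha>_def)
  next
    fix c h assume h: "h \<in> cartan T"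
    then have s: "gscale T c h \<in> cartan T" using cartan_toral(2) g.subspace_scale by blast
    have "gscale T (a (gscale T c h)) x = gscale T (c * a h) x"
      using a[OF s] a[OF h] by (metis bracket_linear(3) g.scale_scale)
    then have "a (gscale T c h) = c * a h"
      by (rule g.scale_right_imp_eq[OF x(1)])
    then show "\<alpha> (gscale T c h) = c * \<alpha> h"
      using h s by (simp add: \<alpha>_def)
  qed (simp add: \<alpha>_def)
  moreover have "x \<in> g.joint_eigenspace bracket (cartan T) \<alpha>"
    using a by (simp add: g.joint_eigenspace_def \<alpha>_def)
  ultimately show ?thesis by blast
qed

text \<open>A toral subalgebra acts by commuting diagonalizable maps, and simultaneous eigenvectors
  for a spanning set F are weight vectors.\<close>

lemma gk_zero_spanned: "gk T 0 \<subseteq> g.span (\<Union>\<alpha>\<in>hdual T. gk_weight T 0 \<alpha>)"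
proof -
  obtain F where F: "finite F" "F \<subseteq> cartan T" "cartan T \<subseteq> g.span F" using cartan_basis by blast
  have "gk T 0 \<subseteq> g.span {x \<in> gk T 0. \<exists>\<nu>. x \<in> g.joint_eigenspace bracket F \<nu>}"
    by (rule g.joint_eigenspace_spanning[where A = bracket and H = F, OF linear_bracket_left subspace_gk _ _ _ F(1)])
       (use F(2) cartan_gk cartan_commute cartan_toral(4) in blast)+
  also have "\<dots> \<subseteq> g.span (\<Union>\<alpha>\<in>hdual T. gk_weight T 0 \<alpha>)"
  proof (intro g.span_minimal g.subspace_span subsetI)
    fix x assume x: "x \<in> {x \<in> gk T 0. \<exists>\<nu>. x \<in> g.joint_eigenspace bracket F \<nu>}"
    show "x \<in> g.span (\<Union>\<alpha>\<in>hdual T. gk_weight T 0 \<alpha>)"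
    proof (cases "x = 0")
      case False
      with x hdual_of_eigenvector[OF F(2,3), of x] show ?thesis
        by (intro g.span_base) (auto simp: gk_weight_eq)
    qed (simp add: g.span_zero)
  qed
  finally show ?thesis .
qed

lemma roots0_enlarged: "roots0 T \<subseteq> roots_en T"
  by (auto simp: roots_en_def enlarged_roots_def)

text \<open>For k in \<Gamma> the space is the fixed-point algebra. Otherwise the Lie torus axiom
  applies: U has weight zero, and the weight vectors in W span a submodule, which is non-zero
  because a joint eigenvector exists and hence is all of W by irreducibility.\<close>

lemma gk_weight_span: "gk T k \<subseteq> g.span (\<Union>\<alpha>\<in>hdual T. gk_weight T k \<alpha>)"
  and gk_weight_root: "\<alpha> \<in> hdual T \<Longrightarrow> x \<in> gk_weight T k \<alpha> \<Longrightarrow> x \<noteq> 0 \<Longrightarrow> \<alpha> \<in> insert 0 (roots_en T)"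
proof -
  let ?thm = "gk T k \<subseteq> g.span (\<Union>\<alpha>\<in>hdual T. gk_weight T k \<alpha>) \<and>
    (\<forall>\<alpha>\<in>hdual T. \<forall>x\<in>gk_weight T k \<alpha>. x \<noteq> 0 \<longrightarrow> \<alpha> \<in> insert 0 (roots_en T))"
  have ?thm
  proof (cases "k \<in> Gam T")
    case True
    then show ?thesis
      using gk_zero_spanned roots0_enlarged gk_Gam[OF True] gk_weight_Gam[OF True]
      by (auto simp: roots0_def)
  next
    case k: False
    show ?thesis
    proof (cases "gk T k = {0}")
      case True
      then show ?thesis by (auto simp: g.span_zero gk_weight_def)
    next
      case False
      obtain U W where UW: "lie_submodule (g0 T) (adjoint_on T (gk T k)) U \<and>
            lie_submodule (g0 T) (adjoint_on T (gk T k)) W \<and>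
            U \<inter> W = {0} \<and> gk T k = {u + w |u w. u \<in> U \<and> w \<in> W} \<and>
            (\<forall>x\<in>gk T 0. \<forall>u\<in>U. gbr T x u = 0) \<and>
            (W = {0} \<or>
              irreducible_module (g0 T) (adjoint_on T W) \<and> vector_space.dim (gscale T) W > 1 \<and>
              (\<forall>\<alpha>\<in>hdual T. W \<inter> gk_weight T k \<alpha> \<noteq> {0} \<longrightarrow> \<alpha> \<in> insert 0 (roots_en T)))"
        using gk_decomposition[rule_format, OF conjI[OF k False]] by (elim exE)
      note U = UW[THEN conjunct1] and W = UW[THEN conjunct2, THEN conjunct1]
        and dec = UW[THEN conjunct2, THEN conjunct2, THEN conjunct2, THEN conjunct1]
        and Utriv = UW[THEN conjunct2, THEN conjunct2, THEN conjunct2, THEN conjunct2, THEN conjunct1]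
        and Wirr = UW[THEN conjunct2, THEN conjunct2, THEN conjunct2, THEN conjunct2, THEN conjunct2]
      have Uk: "U \<subseteq> gk T k" and Wk: "W \<subseteq> gk T k"
        using U W by (auto simp: lie_submodule_def adjoint_on_def module_on_def)
      have Wsub: "g.subspace W" and Wact: "\<And>x w. x \<in> gk T 0 \<Longrightarrow> w \<in> W \<Longrightarrow> bracket x w \<in> W"
        using W by (auto simp: lie_submodule_def adjoint_on_def module_on_def g.subspace_def g0_def)
      have U0: "U \<subseteq> gk_weight T k 0"
        using Uk Utriv cartan_toral(1) by (auto simp: gk_weight_def)
      let ?S = "\<Union>\<alpha>\<in>hdual T. W \<inter> gk_weight T k \<alpha>"
      have WS: "W \<subseteq> g.span ?S"
      proof (cases "W = {0}")
        case True
        then show ?thesis by (simp add: g.span_zero)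
      next
        case W0: False
        then have irr: "irreducible_module (g0 T) (adjoint_on T W)" using Wirr by blast
        have sub: "lie_submodule (g0 T) (adjoint_on T W) (g.span ?S)"
          unfolding lie_submodule_def
        proof (intro conjI)
          show "lie_module (g0 T) (adjoint_on T W)"
            using irr by (simp add: irreducible_module_def)
          show "g.span ?S \<subseteq> vecs (adjoint_on T W)"
            using g.span_minimal[OF _ Wsub, of ?S] by (auto simp: adjoint_on_def module_on_def)
          have "bracket x s \<in> g.span ?S" if x: "x \<in> gk T 0" and s: "s \<in> W \<inter> gk_weight T k \<beta>" "\<beta> \<in> hdual T" for x s \<beta>
          proof -
            have "bracket y s \<in> g.span ?S" if "y \<in> gk_weight T 0 \<alpha>" "\<alpha> \<in> hdual T" for y \<alpha>
            proof -
              have "bracket y s \<in> W \<inter> gk_weight T k (\<alpha> + \<beta>)"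
                using gk_weight_bracket[of y 0 \<alpha> s k \<beta>] that s Wact[of y s] by (auto simp: gk_weight_def)
              then show ?thesis
                using hdual_add[OF that(2) s(2)] by (intro g.span_base) blast
            qed
            then have "(\<Union>\<alpha>\<in>hdual T. gk_weight T 0 \<alpha>) \<subseteq> {y. bracket y s \<in> g.span ?S}"
              by blast
            moreover have "g.subspace {y. bracket y s \<in> g.span ?S}"
              by (auto simp: g.subspace_def bracket_linear g.span_zero g.span_add g.span_scale)
            ultimately have "g.span (\<Union>\<alpha>\<in>hdual T. gk_weight T 0 \<alpha>) \<subseteq> {y. bracket y s \<in> g.span ?S}"
              by (rule g.span_minimal)
            then show ?thesis using x gk_zero_spanned by blast
          qed
          then have "?S \<subseteq> {v. bracket x v \<in> g.span ?S}" if "x \<in> gk T 0" for x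
            using that by blast
          moreover have "g.subspace {v. bracket x v \<in> g.span ?S}" for x
            by (auto simp: g.subspace_def bracket_linear g.span_zero g.span_add g.span_scale)
          ultimately have "g.span ?S \<subseteq> {v. bracket x v \<in> g.span ?S}" if "x \<in> gk T 0" for x
            using that g.span_minimal by metis
          then show "\<forall>x\<in>elems (g0 T). \<forall>v\<in>g.span ?S. act (adjoint_on T W) x v \<in> g.span ?S"
            by (auto simp: adjoint_on_def module_on_def g0_def)
        qed (auto simp: adjoint_on_def module_on_def g.span_zero g.span_add g.span_scale)
        have "g.span ?S \<noteq> {0}"
        proof -
          obtain F where F: "finite F" "F \<subseteq> cartan T" "cartan T \<subseteq> g.span F" using cartan_basis by blast
          obtain B where B: "finite B" "g.span B = UNIV" using finite_spanning by blast
          have st: "bracket h x \<in> W" if "h \<in> F" "x \<in> W" for h x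
            using that F(2) Wact cartan_toral(1) by blast
          have cm: "bracket g (bracket h x) = bracket h (bracket g x)" if "g \<in> F" "h \<in> F" "x \<in> W" for g h x
            using that F(2) cartan_commute by blast
          have "\<exists>x\<in>W. \<exists>\<nu>. x \<noteq> 0 \<and> x \<in> g.joint_eigenspace bracket F \<nu>"
            by (rule g.joint_eigenvector_exists[where A = bracket and H = F,
                  OF linear_bracket_left Wsub st W0 cm B(1) _ F(1)]) (simp_all add: B(2))
          then obtain x \<nu> where x: "x \<in> W" "x \<noteq> 0" "x \<in> g.joint_eigenspace bracket F \<nu>" by blast
          then obtain \<alpha> where "\<alpha> \<in> hdual T" "x \<in> g.joint_eigenspace bracket (cartan T) \<alpha>"
            using hdual_of_eigenvector[OF F(2,3)] by blast
          then have "x \<in> ?S" using x(1) Wk by (auto simp: gk_weight_eq)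
          then have "x \<in> g.span ?S" by (rule g.span_base)
          then show ?thesis using x(2) by blast
        qed
        then show ?thesis
          using irr sub unfolding irreducible_module_def by (auto simp: adjoint_on_def module_on_def)
      qed
      have span: "gk T k \<subseteq> g.span (U \<union> ?S)"
      proof
        fix x assume "x \<in> gk T k"
        then obtain u w where "x = u + w" "u \<in> U" "w \<in> W" using dec by blast
        moreover have "w \<in> g.span (U \<union> ?S)"
          using WS \<open>w \<in> W\<close> g.span_mono[of ?S "U \<union> ?S"] by blast
        ultimately show "x \<in> g.span (U \<union> ?S)"
          by (simp add: g.span_add g.span_base)
      qed
      have "U \<union> ?S \<subseteq> (\<Union>\<alpha>\<in>hdual T. gk_weight T k \<alpha>)"
        using U0 hdual_zero by blast
      then have 1: "gk T k \<subseteq> g.span (\<Union>\<alpha>\<in>hdual T. gk_weight T k \<alpha>)"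
        using span g.span_mono by blast
      have 2: "\<alpha> \<in> insert 0 (roots_en T)" if \<alpha>: "\<alpha> \<in> hdual T" and x: "x \<in> gk_weight T k \<alpha>" "x \<noteq> 0" for \<alpha> x
      proof -
        have ev: "\<exists>\<nu>. s \<in> g.joint_eigenspace bracket (cartan T) \<nu>" if "s \<in> U \<union> ?S" for s
          using that U0 by (auto simp: gk_weight_eq)
        have "x \<in> g.span ((U \<union> ?S) \<inter> g.joint_eigenspace bracket (cartan T) \<alpha>)"
          by (rule g.joint_eigenspace_component[where A = bracket, OF linear_bracket_left ev])
             (use x span in \<open>auto simp: gk_weight_eq\<close>)
        \<comment> \<open>A weight vector x need not lie in U or in W, but some non-zero generator
          of the same weight does; in U this forces \<alpha> = 0, in W the axiom restricts
          \<alpha>.\<close>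
        then have "\<not> (U \<union> ?S) \<inter> g.joint_eigenspace bracket (cartan T) \<alpha> \<subseteq> {0}"
          using g.span_mono[of _ "{0}"] x(2) by auto
        then obtain s where s: "s \<in> U \<union> ?S" "s \<noteq> 0" "s \<in> g.joint_eigenspace bracket (cartan T) \<alpha>"
          by blast
        show ?thesis
        proof (cases "s \<in> U")
          case True
          have "\<alpha> h = 0" if h: "h \<in> cartan T" for h
          proof -
            have "gscale T (\<alpha> h) s = bracket h s"
              using s(3) h by (simp add: g.joint_eigenspace_def)
            also have "\<dots> = 0" using Utriv True h cartan_toral(1) by blast
            finally show ?thesis using s(2) by simp
          qed
          then have "\<alpha> = 0" using hdual_eqI[OF \<alpha> hdual_zero] by simp
          then show ?thesis by simp
        next
          case False
          then have "s \<in> W \<inter> gk_weight T k \<alpha>" using s Wk by (auto simp: gk_weight_eq)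
          then have "W \<inter> gk_weight T k \<alpha> \<noteq> {0}" "W \<noteq> {0}" using s(2) by auto
          then show ?thesis using Wirr \<alpha> by blast
        qed
      qed
      from 1 2 show ?thesis by blast
    qed
  qed
  then show "gk T k \<subseteq> g.span (\<Union>\<alpha>\<in>hdual T. gk_weight T k \<alpha>)"
    "\<alpha> \<in> hdual T \<Longrightarrow> x \<in> gk_weight T k \<alpha> \<Longrightarrow> x \<noteq> 0 \<Longrightarrow> \<alpha> \<in> insert 0 (roots_en T)"
    by blast+
qed

section \<open>Height and positivity of weights\<close>

definition height :: "('g \<Rightarrow> complex) \<Rightarrow> complex" where
  "height = (SOME \<phi>. Vector_Spaces.linear fscale (*) \<phi> \<and> (\<forall>\<alpha>\<in>base T. \<phi> \<alpha> = 1))"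

text \<open>Linear independence of the simple roots allows a linear extension to all functionals, so
  the height is also defined for weights of V and their differences.\<close>

lemma linear_height: "Vector_Spaces.linear fscale (*) height"
  and height_base: "\<alpha> \<in> base T \<Longrightarrow> height \<alpha> = 1"
proof -
  interpret F: vector_space "fscale :: complex \<Rightarrow> ('g \<Rightarrow> complex) \<Rightarrow> _" by (rule vector_space_fscale)
  interpret P: vector_space_pair "fscale :: complex \<Rightarrow> ('g \<Rightarrow> complex) \<Rightarrow> _" "(*) :: complex \<Rightarrow> complex \<Rightarrow> complex"
    by unfold_locales (auto simp: algebra_simps)
  have "\<not> F.dependent (base T)"
    using base_simple by (simp add: simple_roots_def)
  from P.linear_independent_extend[OF this, of "\<lambda>_. 1"]
  have "\<exists>\<phi>. Vector_Spaces.linear fscale (*) \<phi> \<and> (\<forall>\<alpha>\<in>base T. \<phi> \<alpha> = (1::complex))" by blast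
  from someI_ex[OF this, folded height_def]
  show "Vector_Spaces.linear fscale (*) height" "\<alpha> \<in> base T \<Longrightarrow> height \<alpha> = 1" by blast+
qed

lemma height_add [simp]: "height (\<alpha> + \<beta>) = height \<alpha> + height \<beta>"
  and height_neg [simp]: "height (- \<alpha>) = - height \<alpha>"
  and height_zero [simp]: "height 0 = 0"
  and height_scale [simp]: "height (fscale c \<alpha>) = c * height \<alpha>"
  and height_sum: "height (\<Sum>i\<in>I. \<gamma> i) = (\<Sum>i\<in>I. height (\<gamma> i))"
proof -
  interpret h: Vector_Spaces.linear "fscale :: complex \<Rightarrow> ('g \<Rightarrow> complex) \<Rightarrow> _" "(*)" height
    by (rule linear_height)
  show "height (\<alpha> + \<beta>) = height \<alpha> + height \<beta>" "height (- \<alpha>) = - height \<alpha>"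
    "height 0 = 0" "height (fscale c \<alpha>) = c * height \<alpha>"
    "height (\<Sum>i\<in>I. \<gamma> i) = (\<Sum>i\<in>I. height (\<gamma> i))"
    by (rule h.add h.neg h.zero h.scale h.sum)+
qed

text \<open>Positivity refers to the height alone and not to the root system: it is thus closed
  under addition and applies to differences such as \<open>lam - \<nu>\<close>, which need not be
  roots.\<close>

definition positive :: "('g \<Rightarrow> complex) \<Rightarrow> bool" where
  "positive \<alpha> \<longleftrightarrow> (\<exists>n::nat. n > 0 \<and> height \<alpha> = of_nat n)"

lemma positive_add: "positive \<alpha> \<Longrightarrow> positive \<beta> \<Longrightarrow> positive (\<alpha> + \<beta>)"
  unfolding positive_def by (metis height_add of_nat_add trans_less_add1)

lemma not_positive_zero [simp]: "\<not> positive 0"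
  by (auto simp: positive_def)

lemma positive_asym: "positive \<alpha> \<Longrightarrow> \<not> positive (- \<alpha>)"
  using positive_add[of \<alpha> "- \<alpha>"] by auto

lemma base_finite: "finite (base T)"
  and roots0_cases: "\<alpha> \<in> roots0 T \<Longrightarrow> \<alpha> \<in> nat_cone (base T) \<or> - \<alpha> \<in> nat_cone (base T)"
  using base_simple by (auto simp: simple_roots_def)

lemma nat_cone_positive:
  assumes "\<alpha> \<in> nat_cone (base T)" "\<alpha> \<noteq> 0"
  shows "positive \<alpha>"
proof -
  obtain c :: "('g \<Rightarrow> complex) \<Rightarrow> nat" where \<alpha>: "\<alpha> = (\<Sum>\<beta>\<in>base T. fscale (of_nat (c \<beta>)) \<beta>)"
    using assms(1) by (auto simp: nat_cone_def)
  have "height \<alpha> = of_nat (\<Sum>\<beta>\<in>base T. c \<beta>)"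
    by (simp add: \<alpha> height_sum height_base)
  moreover have "(\<Sum>\<beta>\<in>base T. c \<beta>) > 0"
  proof (rule ccontr)
    assume "\<not> ?thesis"
    then have "c \<beta> = 0" if "\<beta> \<in> base T" for \<beta>
      using that base_finite by simp
    then have "\<alpha> = 0"
      unfolding \<alpha> by (intro sum.neutral ballI) (simp add: fscale_def fun_eq_iff)
    with assms(2) show False by simp
  qed
  ultimately show ?thesis unfolding positive_def by blast
qed

lemma nat_cone_double: "\<alpha> \<in> nat_cone P \<Longrightarrow> fscale 2 \<alpha> \<in> nat_cone P"
  for P :: "('g \<Rightarrow> complex) set"
proof -
  interpret F: vector_space "fscale :: complex \<Rightarrow> ('g \<Rightarrow> complex) \<Rightarrow> _" by (rule vector_space_fscale)
  assume "\<alpha> \<in> nat_cone P"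
  then obtain c :: "('g \<Rightarrow> complex) \<Rightarrow> nat" where \<alpha>: "\<alpha> = (\<Sum>\<beta>\<in>P. fscale (of_nat (c \<beta>)) \<beta>)"
    by (auto simp: nat_cone_def)
  have "fscale 2 \<alpha> = (\<Sum>\<beta>\<in>P. fscale (of_nat (2 * c \<beta>)) \<beta>)"
    unfolding \<alpha> by (simp add: F.scale_sum_right)
  then show ?thesis unfolding nat_cone_def by (intro CollectI exI[of _ "\<lambda>\<beta>. 2 * c \<beta>"]) simp
qed

text \<open>An enlarged root is a root or twice a short root, and the short roots of a frame are
  roots. Doubling stays in the dual space and respects the positive and the negative cone.\<close>

lemma roots_en_cases:
  assumes "\<alpha> \<in> roots_en T"
  shows "\<alpha> \<in> hdual T" "\<alpha> \<noteq> 0" "\<alpha> \<in> nat_cone (base T) \<or> - \<alpha> \<in> nat_cone (base T)"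
proof -
  have R: "\<beta> \<in> hdual T \<and> \<beta> \<noteq> 0 \<and> (\<beta> \<in> nat_cone (base T) \<or> - \<beta> \<in> nat_cone (base T))"
    if "\<beta> \<in> roots0 T" for \<beta>
    using that roots0_cases by (auto simp: roots0_def)
  have short: "type_B_short_roots (roots0 T) \<subseteq> roots0 T"
  proof
    fix \<beta> assume "\<beta> \<in> type_B_short_roots (roots0 T)"
    then obtain E where E: "B_frame (roots0 T) E" "\<beta> \<in> E \<or> - \<beta> \<in> E"
      by (auto simp: type_B_short_roots_def)
    have "roots0 T = (\<Union>\<epsilon>\<in>E. {\<epsilon>, - \<epsilon>}) \<union>
         (\<Union>\<epsilon>\<in>E. \<Union>\<delta>\<in>E - {\<epsilon>}. {\<epsilon> + \<delta>, \<epsilon> - \<delta>, - \<epsilon> + \<delta>, - \<epsilon> - \<delta>})"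
      using E(1) unfolding B_frame_def by (elim conjE)
    then have sub: "(\<Union>\<epsilon>\<in>E. {\<epsilon>, - \<epsilon>}) \<subseteq> roots0 T"
      by (rule ssubst) (rule Un_upper1)
    from E(2) have "\<exists>\<epsilon>\<in>E. \<beta> \<in> {\<epsilon>, - \<epsilon>}"
    proof
      assume "- \<beta> \<in> E"
      then show ?thesis by (rule bexI[rotated]) simp
    qed blast
    then have "\<beta> \<in> (\<Union>\<epsilon>\<in>E. {\<epsilon>, - \<epsilon>})" by (simp only: UN_iff)
    with sub show "\<beta> \<in> roots0 T" by (rule subsetD)
  qed
  have dbl: "fscale 2 \<beta> \<in> hdual T \<and> fscale 2 \<beta> \<noteq> 0 \<and>
      (fscale 2 \<beta> \<in> nat_cone (base T) \<or> - fscale 2 \<beta> \<in> nat_cone (base T))" if "\<beta> \<in> roots0 T" for \<beta>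
  proof -
    have "- fscale 2 \<beta> = fscale 2 (- \<beta>)" by (simp add: fscale_def fun_eq_iff)
    moreover have "fscale 2 \<beta> \<in> hdual T"
      using R[OF that] by (auto simp: fscale_def hdual_def dual_space_def algebra_simps)
    moreover have "fscale 2 \<beta> \<noteq> 0"
      using R[OF that] by (auto simp: fscale_def fun_eq_iff)
    ultimately show ?thesis using R[OF that] nat_cone_double by metis
  qed
  have "\<alpha> \<in> roots0 T \<or> (\<exists>\<beta>\<in>roots0 T. \<alpha> = fscale 2 \<beta>)"
    using assms short by (auto simp: roots_en_def enlarged_roots_def split: if_splits)
  then have *: "\<alpha> \<in> hdual T \<and> \<alpha> \<noteq> 0 \<and> (\<alpha> \<in> nat_cone (base T) \<or> - \<alpha> \<in> nat_cone (base T))"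
    by (elim disjE bexE) (simp_all only: R dbl simp_thms)
  show "\<alpha> \<in> hdual T" "\<alpha> \<noteq> 0" "\<alpha> \<in> nat_cone (base T) \<or> - \<alpha> \<in> nat_cone (base T)"
    by (rule *[THEN conjunct1] *[THEN conjunct2, THEN conjunct1] *[THEN conjunct2, THEN conjunct2])+
qed

text \<open>A non-zero element of the negative cone has negative height, so the sign of the height
  decides in which cone an enlarged root lies.\<close>

lemma roots_en_pos_iff: "\<alpha> \<in> roots_en_pos T \<longleftrightarrow> \<alpha> \<in> roots_en T \<and> positive \<alpha>"
proof -
  have "\<alpha> \<in> nat_cone (base T)" if "\<alpha> \<in> roots_en T" "positive \<alpha>"
    using roots_en_cases[OF that(1)] nat_cone_positive[of "- \<alpha>"] positive_asym[OF that(2)] by auto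
  then show ?thesis
    using roots_en_cases nat_cone_positive by (auto simp: roots_en_pos_def)
qed

lemma weight_trichotomy:
  assumes "\<alpha> \<in> hdual T" "x \<in> gk_weight T k \<alpha>" "x \<noteq> 0"
  shows "\<alpha> = 0 \<or> positive \<alpha> \<or> positive (- \<alpha>)"
proof (cases "\<alpha> = 0")
  case False
  then have "\<alpha> \<in> roots_en T" using gk_weight_root[OF assms] by simp
  then show ?thesis
    using roots_en_cases[of \<alpha>] nat_cone_positive[of \<alpha>] nat_cone_positive[of "- \<alpha>"] by auto
qed simp

lemma LT_plus_alt:
  "LT_plus T = module.span (lscale T)
     {Poly_Mapping.single k x |k x \<alpha>. \<alpha> \<in> roots_en T \<and> positive \<alpha> \<and> x \<in> gk_weight T k \<alpha>}"
  unfolding LT_plus_def roots_en_pos_iff by (simp add: conj_assoc)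

section \<open>Orthogonality and a non-isotropic commuting pair\<close>

lemma form_facts:
  "form T (x + y) z = form T x z + form T y z" "form T (gscale T c x) y = c * form T x y"
  "form T x y = form T y x" "form T (bracket x y) z = form T x (bracket y z)"
  "(\<And>y. form T x y = 0) \<Longrightarrow> x = 0" "form T (sig T i x) (sig T i y) = form T x y"
proof -
  have "invariant_form T" using torus unfolding lie_torus_def by (elim conjE)
  note inv = this[unfolded invariant_form_def]
  show "form T (x + y) z = form T x z + form T y z"
    by (rule inv[THEN conjunct1, rule_format])
  show "form T (gscale T c x) y = c * form T x y"
    by (rule inv[THEN conjunct2, THEN conjunct1, rule_format])
  show "form T x y = form T y x"
    by (rule inv[THEN conjunct2, THEN conjunct2, THEN conjunct1, rule_format])
  show "(\<And>y. form T x y = 0) \<Longrightarrow> x = 0"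
    using inv[THEN conjunct2, THEN conjunct2, THEN conjunct2, THEN conjunct1] by blast
  show "form T (bracket x y) z = form T x (bracket y z)"
    by (rule inv[THEN conjunct2, THEN conjunct2, THEN conjunct2, THEN conjunct2, THEN conjunct1, rule_format])
  show "form T (sig T i x) (sig T i y) = form T x y"
    by (rule inv[THEN conjunct2, THEN conjunct2, THEN conjunct2, THEN conjunct2, THEN conjunct2,
          rule_format, OF sig_automorphism])
qed

lemma form_right: "form T x (y + z) = form T x y + form T x z" "form T x (gscale T c y) = c * form T x y"
  by (metis form_facts(1,3)) (metis form_facts(2,3))

lemma form_zero [simp]: "form T 0 y = 0" "form T x 0 = 0"
  using form_facts(2)[of 0 0 y] form_right(2)[of x 0 0] by simp_all

lemma form_sum: "form T x (\<Sum>i\<in>I. y i) = (\<Sum>i\<in>I. form T x (y i))"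
  by (induction I rule: infinite_finite_induct) (auto simp: form_right)

text \<open>Invariance compares ([x, h]|y) with (x|[h, y]) and gives (\<alpha> + \<beta>)(h) (x|y) =
  0.\<close>

lemma form_weight:
  assumes "x \<in> gk_weight T k \<alpha>" "y \<in> gk_weight T l \<beta>" "\<alpha> \<in> hdual T" "\<beta> \<in> hdual T" "\<alpha> + \<beta> \<noteq> 0"
  shows "form T x y = 0"
proof -
  obtain h where h: "h \<in> cartan T" "(\<alpha> + \<beta>) h \<noteq> 0"
    using hdual_eqI[OF hdual_add[OF assms(3,4)] hdual_zero] assms(5) by (metis zero_fun_apply)
  have "bracket x h = gscale T (- \<alpha> h) x"
    using assms(1) h(1) bracket_anticomm[of x h] by (simp add: gk_weight_def)
  then have "- \<alpha> h * form T x y = form T x (bracket h y)"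
    using form_facts(4)[of x h y] form_facts(2)[of "- \<alpha> h" x y] by simp
  also have "\<dots> = \<beta> h * form T x y"
    using assms(2) h(1) by (simp add: gk_weight_def form_right)
  finally have "(\<alpha> + \<beta>) h * form T x y = 0" by (simp add: algebra_simps add_eq_0_iff)
  with h(2) show ?thesis by simp
qed

text \<open>Average y over the cyclic groups generated by the automorphisms, one after the other. As
  x is fixed and the form invariant, each average only multiplies (x|y) by a positive order;
  commutativity preserves the invariance already reached.\<close>

lemma form_nondegenerate_gk_zero:
  assumes x: "x \<in> gk T 0" "x \<noteq> 0"
  shows "\<exists>y\<in>gk T 0. form T x y \<noteq> 0"
proof -
  have "\<exists>y. form T x y \<noteq> 0 \<and> (\<forall>i\<in>I. sig T i y = y)" if "finite I" for I :: "'n set"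
    using that
  proof induction
    case empty
    then show ?case using form_facts(5)[of x] x(2) by blast
  next
    case (insert i I)
    then obtain y where y: "form T x y \<noteq> 0" "\<forall>j\<in>I. sig T j y = y" by blast
    interpret s: Vector_Spaces.linear "gscale T" "gscale T" "sig T j" for j by (rule linear_sig)
    define y' where "y' = (\<Sum>j<ordr T i. (sig T i ^^ j) y)"
    have xfix: "sig T j x = x" for j using x(1) by (simp add: gk_def)
    have "form T x ((sig T i ^^ j) y) = form T x y" for j
      by (induction j) (use form_facts(6)[of i x] xfix in auto)
    then have "form T x y' = of_nat (ordr T i) * form T x y"
      by (simp add: y'_def form_sum)
    then have "form T x y' \<noteq> 0" using y(1) ordr_pos[of i] by simp
    moreover have "sig T i y' = y'"
    proof -
      have "sig T i y' + y = (\<Sum>j<Suc (ordr T i). (sig T i ^^ j) y)"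
        by (subst sum.lessThan_Suc_shift) (simp add: y'_def s.sum add.commute)
      also have "\<dots> = y' + y"
        by (simp add: y'_def sig_ordr)
      finally show ?thesis by simp
    qed
    moreover have "sig T j y' = y'" if j: "j \<in> I" for j
    proof -
      have "sig T j ((sig T i ^^ a) y) = (sig T i ^^ a) y" for a
        by (induction a) (use y(2) j sig_commute[of j i] in auto)
      then show ?thesis by (simp add: y'_def s.sum)
    qed
    ultimately show ?case by blast
  qed
  from this[of UNIV] show ?thesis by (auto simp: gk_def)
qed

lemma g0_ideal: "lie_ideal (g0 T) I \<Longrightarrow> I = {0} \<or> I = gk T 0"
  and g0_nonabelian: "\<exists>x\<in>gk T 0. \<exists>y\<in>gk T 0. bracket x y \<noteq> 0"
  using g0_simple unfolding simple_lie_algebra_def g0_def by simp_all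

text \<open>Without a root all of the fixed-point algebra would have weight zero and commute with h.
  Then the line of h would be a non-zero ideal, hence everything, and the simple algebra would be
  abelian.\<close>

lemma root_exists:
  assumes "h \<in> cartan T" "h \<noteq> 0"
  shows "\<exists>\<alpha>\<in>hdual T. \<exists>x\<in>gk_weight T 0 \<alpha>. \<alpha> \<noteq> 0 \<and> x \<noteq> 0"
proof (rule ccontr)
  assume "\<not> ?thesis"
  then have "(\<Union>\<alpha>\<in>hdual T. gk_weight T 0 \<alpha>) \<subseteq> gk_weight T 0 0"
    using g.subspace_0[OF subspace_gk_weight] by fastforce
  then have "gk T 0 \<subseteq> gk_weight T 0 0"
    using gk_weight_span[of 0] g.span_minimal[OF _ subspace_gk_weight] by blast
  then have comm: "bracket x h = 0" if "x \<in> gk T 0" for x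
    using that assms(1) bracket_anticomm[of x h] by (auto simp: gk_weight_def)
  have "lie_ideal (g0 T) (g.span {h})"
    unfolding lie_ideal_def
  proof (intro conjI ballI)
    show "g.span {h} \<subseteq> elems (g0 T)"
      using g.span_minimal[OF _ subspace_gk, of "{h}" 0] assms(1) cartan_toral(1) by (auto simp: g0_def)
    fix x y assume "x \<in> elems (g0 T)" "y \<in> g.span {h}"
    then show "brk (g0 T) x y \<in> g.span {h}"
      using comm by (auto simp: g0_def g.span_singleton bracket_linear intro!: exI[of _ 0])
  qed (simp add: g0_def)
  moreover have "g.span {h} \<noteq> {0}" using assms(2) g.span_base[of h "{h}"] by auto
  ultimately have "gk T 0 = g.span {h}" using g0_ideal by blast
  then show False
    using g0_nonabelian bracket_self[of h] by (auto simp: g.span_singleton bracket_linear)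
qed

text \<open>For a root \<open>\<alpha>\<close> and \<open>x \<in> \<gg>\<^sub>0(\<alpha>)\<close>, \<open>y \<in> \<gg>\<^sub>0(- \<alpha>)\<close> with \<open>(x|y) \<noteq> 0\<close>, invariance gives
  \<open>(h|[x, y]) = \<alpha>(h) (x|y)\<close>; so one can take \<open>t = [x, y]\<close>.\<close>

lemma nonisotropic_pair_exists:
  assumes "h0 \<in> cartan T" "h0 \<noteq> 0"
  shows "\<exists>h\<in>cartan T. \<exists>t\<in>gk_weight T 0 0. bracket h t = 0 \<and> form T h t \<noteq> 0"
proof -
  obtain \<alpha> x where \<alpha>: "\<alpha> \<in> hdual T" "\<alpha> \<noteq> 0" and x: "x \<in> gk_weight T 0 \<alpha>" "x \<noteq> 0"
    using root_exists[OF assms] by blast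
  then obtain y where y: "y \<in> gk T 0" "form T x y \<noteq> 0"
    using form_nondegenerate_gk_zero by (auto simp: gk_weight_def)
  have "\<exists>\<beta>\<in>hdual T. \<exists>w\<in>gk_weight T 0 \<beta>. form T x w \<noteq> 0"
  proof (rule ccontr)
    assume "\<not> ?thesis"
    then have "(\<Union>\<beta>\<in>hdual T. gk_weight T 0 \<beta>) \<subseteq> {w. form T x w = 0}" by blast
    moreover have "g.subspace {w. form T x w = 0}"
      by (auto simp: g.subspace_def form_right)
    ultimately show False
      using g.span_minimal gk_weight_span[of 0] y by blast
  qed
  then obtain \<beta> w where w: "\<beta> \<in> hdual T" "w \<in> gk_weight T 0 \<beta>" "form T x w \<noteq> 0" by blast
  then have \<beta>: "\<alpha> + \<beta> = 0" using form_weight[OF x(1) w(2) \<alpha>(1) w(1)] by blast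
  obtain h where h: "h \<in> cartan T" "\<alpha> h \<noteq> 0"
    using hdual_eqI[OF \<alpha>(1) hdual_zero] \<alpha>(2) by (metis zero_fun_apply)
  have t: "bracket x w \<in> gk_weight T 0 0"
    using gk_weight_bracket[OF x(1) w(2)] \<beta> by simp
  have "form T h (bracket x w) = form T (bracket h x) w"
    by (simp add: form_facts(4))
  also have "\<dots> = \<alpha> h * form T x w"
    using x(1) h(1) by (simp add: gk_weight_def form_facts(2))
  finally have "form T h (bracket x w) \<noteq> 0" using h(2) w(3) by simp
  moreover have "bracket h (bracket x w) = 0"
    using t h(1) by (simp add: gk_weight_def)
  ultimately show ?thesis using h(1) t by blast
qed

text \<open>Replace a finite spanning set by weight vectors; the component lemma then shows that
  each weight space is spanned by the members of its own weight.\<close>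

lemma finite_weight_basis:
  "\<exists>B. finite B \<and> (\<forall>b\<in>B. \<exists>\<alpha>\<in>hdual T. b \<in> gk_weight T k \<alpha>) \<and>
     (\<forall>\<alpha>. gk_weight T k \<alpha> \<subseteq> g.span (B \<inter> gk_weight T k \<alpha>))"
proof -
  obtain C where C: "finite C" "g.span C = UNIV" using finite_spanning by blast
  have "gk T k \<subseteq> g.span (C \<union> {0})"
    using C(2) g.span_mono[of C "C \<union> {0}"] by auto
  from g.finite_codim_subset[OF C(1) subspace_gk g.subspace_single_0 this]
  obtain D where D: "finite D" "D \<subseteq> gk T k" "gk T k \<subseteq> g.span (D \<union> (gk T k \<inter> {0}))" by blast
  have "D \<subseteq> g.span (\<Union>\<alpha>\<in>hdual T. gk_weight T k \<alpha>)"
    using D(2) gk_weight_span by blast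
  from g.finite_subset_spanning[OF D(1,3) this]
  obtain B where B: "B \<subseteq> (\<Union>\<alpha>\<in>hdual T. gk_weight T k \<alpha>)" "finite B" "gk T k \<subseteq> g.span (B \<union> (gk T k \<inter> {0}))"
    by blast
  have "gk T k \<inter> {0} = {0}" using g.subspace_0[OF subspace_gk] by auto
  with B(3) have span: "gk T k \<subseteq> g.span B" by simp
  have "x \<in> g.span (B \<inter> gk_weight T k \<alpha>)" if x: "x \<in> gk_weight T k \<alpha>" for \<alpha> x
  proof -
    have ev: "\<exists>\<nu>. s \<in> g.joint_eigenspace bracket (cartan T) \<nu>" if "s \<in> B" for s
      using that B(1) by (auto simp: gk_weight_eq)
    have "x \<in> g.span (B \<inter> g.joint_eigenspace bracket (cartan T) \<alpha>)"
      by (rule g.joint_eigenspace_component[where A = bracket, OF linear_bracket_left ev])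
         (use x span in \<open>auto simp: gk_weight_eq\<close>)
    moreover have "B \<subseteq> gk T k" using B(1) by (auto simp: gk_weight_def)
    ultimately show ?thesis by (simp add: gk_weight_eq Int_assoc[symmetric] inf.absorb1)
  qed
  then have "gk_weight T k \<alpha> \<subseteq> g.span (B \<inter> gk_weight T k \<alpha>)" for \<alpha>
    by (rule subsetI)
  moreover have "\<exists>\<alpha>\<in>hdual T. b \<in> gk_weight T k \<alpha>" if "b \<in> B" for b
    using B(1) that by blast
  ultimately show ?thesis using B(2) by (intro exI[of _ B]) simp
qed

end

section \<open>The central part and the graded Lie torus\<close>

lemma vector_space_cscale: "vector_space (cscale :: complex \<Rightarrow> 'n::finite central \<Rightarrow> 'n central)"
proof
  fix a b :: complex and x y :: "'n central"
  show "cscale a (x + y) = cscale a x + cscale a y"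
    by transfer (simp add: pscale.scale_right_distrib central_relations_zero)
  show "cscale (a + b) x = cscale a x + cscale b x"
    by transfer (simp add: pscale.scale_left_distrib central_relations_zero)
  show "cscale a (cscale b x) = cscale (a * b) x"
    by transfer (simp add: central_relations_zero)
  show "cscale 1 x = x"
    by transfer (simp add: central_relations_zero)
qed

interpretation central: vector_space cscale
  by (rule vector_space_cscale)

lemma pdeg_zero_left: "pdeg 0 p = 0"
  by (rule poly_mapping_eqI) (simp add: lookup_pdeg)

lemma cdeg_zero [simp]: "cdeg 0 c = 0" "cdeg d 0 = 0"
  by (transfer, simp add: pdeg_zero pdeg_zero_left central_relations_zero)+

lemma cdeg_tK: "cdeg d (tK k i) = cscale (\<Sum>j\<in>UNIV. d $ j * of_int (k $ j)) (tK k i)"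
  by transfer (simp add: pdeg_single central_relations_zero)

lemma lookup_lscale:
  assumes "vector_space (gscale T)"
  shows "Poly_Mapping.lookup (lscale T c u) k = gscale T c (Poly_Mapping.lookup u k)"
proof -
  interpret vector_space "gscale T" by (rule assms)
  show ?thesis unfolding lscale_def by (transfer fixing: T) (auto simp: when_def)
qed

lemma lookup_ldeg:
  assumes "vector_space (gscale T)"
  shows "Poly_Mapping.lookup (ldeg T d u) k =
    gscale T (\<Sum>i\<in>UNIV. d $ i * of_int (k $ i)) (Poly_Mapping.lookup u k)"
proof -
  interpret vector_space "gscale T" by (rule assms)
  show ?thesis unfolding ldeg_def by (auto simp: lookup_mapp when_def in_keys_iff)
qed

lemma poly_mapping_sum_single: "u = (\<Sum>k\<in>Poly_Mapping.keys u. Poly_Mapping.single k (Poly_Mapping.lookup u k))"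
  by (rule poly_mapping_eqI) (auto simp: lookup_sum lookup_single when_def in_keys_iff)

lemma cocycle_zero [simp]: "cocycle T 0 u = 0" "cocycle T u 0 = 0"
  by (simp_all add: cocycle_def)

lemma lbr_zero [simp]: "lbr T 0 u = 0" "lbr T u 0 = 0"
  by (simp_all add: lbr_def)

context lie_torus_setting
begin

lemma ldeg_zero [simp]: "ldeg T 0 u = 0" "ldeg T d 0 = 0"
  by (rule poly_mapping_eqI, simp add: lookup_ldeg[OF g.vector_space_axioms])+

lemma ldeg_single: "ldeg T d (Poly_Mapping.single k x) =
    lscale T (\<Sum>i\<in>UNIV. d $ i * of_int (k $ i)) (Poly_Mapping.single k x)"
  by (rule poly_mapping_eqI)
     (auto simp: lookup_ldeg[OF g.vector_space_axioms] lookup_lscale[OF g.vector_space_axioms] lookup_single when_def)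

lemma lscale_single: "lscale T c (Poly_Mapping.single k x) = Poly_Mapping.single k (gscale T c x)"
  by (rule poly_mapping_eqI) (auto simp: lookup_lscale[OF g.vector_space_axioms] lookup_single when_def)

lemma lscale_zero [simp]: "lscale T c 0 = 0"
  by (rule poly_mapping_eqI) (simp add: lookup_lscale[OF g.vector_space_axioms])

lemma vector_space_lscale: "vector_space (lscale T)"
  by unfold_locales
     (rule poly_mapping_eqI, simp add: lookup_lscale[OF g.vector_space_axioms] lookup_add
        g.scale_right_distrib g.scale_left_distrib)+

lemma lbr_single:
  "lbr T (Poly_Mapping.single k x) (Poly_Mapping.single l y) = Poly_Mapping.single (k + l) (bracket x y)"
  by (cases "x = 0"; cases "y = 0") (simp_all add: lbr_def)

lemma cocycle_single:
  "cocycle T (Poly_Mapping.single k x) (Poly_Mapping.single l y) =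
     cscale (form T x y) (\<Sum>i\<in>UNIV. cscale (of_int (k $ i)) (tK (k + l) i))"
  by (cases "x = 0"; cases "y = 0") (simp_all add: cocycle_def)

lemma single_in_LT: "x \<in> gk T k \<Longrightarrow> Poly_Mapping.single k x \<in> elems (LT T)"
  using g.subspace_0[OF subspace_gk] by (auto simp: LT_def lookup_single when_def)

lemma gk_weight_gk: "x \<in> gk_weight T k \<alpha> \<Longrightarrow> x \<in> gk T k"
  by (simp add: gk_weight_def)

end

section \<open>The operators of an integrable module\<close>

locale integrable_setting = lie_torus_setting T
  for T :: "('g::ab_group_add, 'n::finite) lie_torus_data" +
  fixes sV :: "complex \<Rightarrow> 'v \<Rightarrow> 'v::ab_group_add"
    and \<rho> :: "('g, 'n) glt \<Rightarrow> 'v \<Rightarrow> 'v"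
    and lam :: "'g \<Rightarrow> complex"
    and f :: "'n \<Rightarrow> int ^ 'n"
    and l :: "'n \<Rightarrow> int"
    and z :: "'n \<Rightarrow> 'v \<Rightarrow> 'v"
  assumes irred: "irreducible_module (GLT T) (module_on UNIV sV \<rho>)"
    and integ: "integrable_module T sV \<rho>"
    and K_trivial: "\<forall>i v. \<rho> (K_elt i) v = 0"
    and lam_dual: "lam \<in> hdual T"
    and lam_acts: "\<forall>h\<in>cartan T. \<forall>v\<in>V_plus T \<rho>.
          \<rho> (loop_elt (Poly_Mapping.single 0 h)) v = sV (lam h) v"
    and lam_nonzero: "lam \<noteq> 0"
    and f_basis: "\<forall>k. \<exists>!c. k = (\<Sum>i\<in>UNIV. c i *s f i)"
    and l_nonzero: "\<forall>i. l i \<noteq> 0"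
    and z_hco: "\<forall>i. highest_central_operator T sV \<rho> (l i *s f i) (z i)"
    and z_nonzero: "\<forall>i. \<exists>v\<in>V_plus T \<rho>. z i v \<noteq> 0"
    and W_submodule: "\<forall>u\<in>LT_zero T. \<forall>w\<in>W_plus T sV \<rho> z. \<rho> (loop_elt u) w \<in> W_plus T sV \<rho> z"
    and W_proper: "W_plus T sV \<rho> z \<subset> V_plus T \<rho>"
begin

lemma lie_module_GLT: "lie_module (GLT T) (module_on UNIV sV \<rho>)"
  using irred by (simp add: irreducible_module_def)

sublocale V: complex_vector_space sV
  using lie_module_GLT
  by unfold_locales (simp_all add: lie_module_def module_on_def)

lemma GLT_algebra: "lie_algebra (GLT T)"
  using lie_module_GLT by (simp add: lie_module_def)

lemma GLT_simps: "smul (GLT T) = gltscale T" "brk (GLT T) = gltbr T"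
  by (simp_all add: GLT_def)

lemma rho_add: "x \<in> elems (GLT T) \<Longrightarrow> \<rho> x (v + w) = \<rho> x v + \<rho> x w"
  and rho_scale: "x \<in> elems (GLT T) \<Longrightarrow> \<rho> x (sV c v) = sV c (\<rho> x v)"
  and rho_add_left: "x \<in> elems (GLT T) \<Longrightarrow> y \<in> elems (GLT T) \<Longrightarrow> \<rho> (x + y) v = \<rho> x v + \<rho> y v"
  and rho_scale_left: "x \<in> elems (GLT T) \<Longrightarrow> \<rho> (gltscale T c x) v = sV c (\<rho> x v)"
  and rho_bracket: "x \<in> elems (GLT T) \<Longrightarrow> y \<in> elems (GLT T) \<Longrightarrow>
        \<rho> x (\<rho> y v) = \<rho> (gltbr T x y) v + \<rho> y (\<rho> x v)"
proof -
  note M = lie_module_GLT[unfolded lie_module_def module_on_def lie_mod.simps GLT_simps]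
  have "\<forall>x\<in>elems (GLT T). \<forall>v\<in>UNIV. \<forall>w\<in>UNIV. \<rho> x (v + w) = \<rho> x v + \<rho> x w"
    using M by (elim conjE) assumption
  then show "x \<in> elems (GLT T) \<Longrightarrow> \<rho> x (v + w) = \<rho> x v + \<rho> x w" by blast
  have "\<forall>x\<in>elems (GLT T). \<forall>c. \<forall>v\<in>UNIV. \<rho> x (sV c v) = sV c (\<rho> x v)"
    using M by (elim conjE) assumption
  then show "x \<in> elems (GLT T) \<Longrightarrow> \<rho> x (sV c v) = sV c (\<rho> x v)" by blast
  have "\<forall>x\<in>elems (GLT T). \<forall>y\<in>elems (GLT T). \<forall>v\<in>UNIV. \<rho> (x + y) v = \<rho> x v + \<rho> y v"
    using M by (elim conjE) assumption
  then show "x \<in> elems (GLT T) \<Longrightarrow> y \<in> elems (GLT T) \<Longrightarrow> \<rho> (x + y) v = \<rho> x v + \<rho> y v" by blast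
  have "\<forall>c. \<forall>x\<in>elems (GLT T). \<forall>v\<in>UNIV. \<rho> (gltscale T c x) v = sV c (\<rho> x v)"
    using M by (elim conjE) assumption
  then show "x \<in> elems (GLT T) \<Longrightarrow> \<rho> (gltscale T c x) v = sV c (\<rho> x v)" by blast
  have "\<forall>x\<in>elems (GLT T). \<forall>y\<in>elems (GLT T). \<forall>v\<in>UNIV.
      \<rho> x (\<rho> y v) = \<rho> (gltbr T x y) v + \<rho> y (\<rho> x v)"
    using M by (elim conjE) assumption
  then show "x \<in> elems (GLT T) \<Longrightarrow> y \<in> elems (GLT T) \<Longrightarrow>
        \<rho> x (\<rho> y v) = \<rho> (gltbr T x y) v + \<rho> y (\<rho> x v)" by blast
qed

lemma linear_rho: "x \<in> elems (GLT T) \<Longrightarrow> Vector_Spaces.linear sV sV (\<rho> x)"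
  by (simp add: Vector_Spaces.linear_iff V.vector_space_axioms rho_add rho_scale)

lemma vector_space_gltscale: "vector_space (gltscale T)"
  and subspace_GLT: "module.subspace (gltscale T) (elems (GLT T))"
  and GLT_bracket: "x \<in> elems (GLT T) \<Longrightarrow> y \<in> elems (GLT T) \<Longrightarrow> gltbr T x y \<in> elems (GLT T)"
  using GLT_algebra by (simp_all add: lie_algebra_def GLT_simps)

sublocale glt: vector_space "gltscale T"
  by (rule vector_space_gltscale)

lemma elems_GLT: "(u, c, d) \<in> elems (GLT T) \<longleftrightarrow> u \<in> elems (LT T) \<and> c \<in> central_m T"
  by (simp add: GLT_def)

lemma zero_in: "0 \<in> elems (LT T)" "0 \<in> central_m T"
  using glt.subspace_0[OF subspace_GLT] by (simp_all add: zero_prod_def elems_GLT)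

lemma rho_zero: "\<rho> 0 v = 0"
  using rho_scale_left[of 0 0 v] glt.subspace_0[OF subspace_GLT] by simp

definition R :: "int ^ 'n \<Rightarrow> 'g \<Rightarrow> 'v \<Rightarrow> 'v" where
  "R k x = \<rho> (loop_elt (Poly_Mapping.single k x))"

definition C :: "'n central \<Rightarrow> 'v \<Rightarrow> 'v" where
  "C c = \<rho> (0, c, 0)"

definition D :: "'n \<Rightarrow> 'v \<Rightarrow> 'v" where
  "D i = \<rho> (d_elt i)"

lemma in_GLT:
  "x \<in> gk T k \<Longrightarrow> loop_elt (Poly_Mapping.single k x) \<in> elems (GLT T)"
  "u \<in> elems (LT T) \<Longrightarrow> loop_elt u \<in> elems (GLT T)"
  "c \<in> central_m T \<Longrightarrow> (0, c, 0) \<in> elems (GLT T)"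
  "(0, 0, d) \<in> elems (GLT T)" "d_elt i \<in> elems (GLT T)"
  using single_in_LT zero_in by (auto simp: loop_elt_def elems_GLT d_elt_def)

lemma tK_central_m: "r \<in> Gam T \<Longrightarrow> tK r i \<in> central_m T"
  unfolding central_m_def by (rule central.span_base) blast

lemma linear_R: "x \<in> gk T k \<Longrightarrow> Vector_Spaces.linear sV sV (R k x)"
  and linear_C: "c \<in> central_m T \<Longrightarrow> Vector_Spaces.linear sV sV (C c)"
  and linear_D: "Vector_Spaces.linear sV sV (D i)"
  unfolding R_def C_def D_def by (intro linear_rho in_GLT, assumption)+ (intro linear_rho in_GLT)

lemma R_add: "x \<in> gk T k \<Longrightarrow> y \<in> gk T k \<Longrightarrow> R k (x + y) v = R k x v + R k y v"
  using rho_add_left[OF in_GLT(1) in_GLT(1), of x k y k v] by (simp add: R_def single_add loop_elt_def)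

lemma R_scale: "x \<in> gk T k \<Longrightarrow> R k (gscale T c x) v = sV c (R k x v)"
  using rho_scale_left[OF in_GLT(1), of x k c v] by (simp add: R_def loop_elt_def gltscale_def lscale_single)

lemma R_zero [simp]: "R k 0 v = 0"
  using rho_zero by (simp add: R_def loop_elt_def zero_prod_def)

lemma C_scale: "c \<in> central_m T \<Longrightarrow> C (cscale a c) v = sV a (C c v)"
  using rho_scale_left[OF in_GLT(3), of c a v] by (simp add: C_def gltscale_def)

lemma C_add: "c \<in> central_m T \<Longrightarrow> c' \<in> central_m T \<Longrightarrow> C (c + c') v = C c v + C c' v"
  using rho_add_left[OF in_GLT(3) in_GLT(3), of c c' v] by (simp add: C_def)

lemma C_zero [simp]: "C 0 v = 0"
  using rho_zero by (simp add: C_def zero_prod_def)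

text \<open>The cocycle term is kept because only the elements of degree zero of the center are
  assumed to act by zero; it disappears in \<open>R_commutator\<close>.\<close>

lemma R_R: "x \<in> gk T k \<Longrightarrow> y \<in> gk T m \<Longrightarrow>
    R k x (R m y v) = R (k + m) (bracket x y) v
      + C (cocycle T (Poly_Mapping.single k x) (Poly_Mapping.single m y)) v + R m y (R k x v)"
proof -
  assume x: "x \<in> gk T k" and y: "y \<in> gk T m"
  let ?c = "cocycle T (Poly_Mapping.single k x) (Poly_Mapping.single m y)"
  have br: "gltbr T (loop_elt (Poly_Mapping.single k x)) (loop_elt (Poly_Mapping.single m y))
      = (Poly_Mapping.single (k + m) (bracket x y), ?c, 0)"
    by (simp add: gltbr_def loop_elt_def lbr_single)
  then have c: "?c \<in> central_m T"
    using GLT_bracket[OF in_GLT(1)[OF x] in_GLT(1)[OF y]] by (simp add: elems_GLT)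
  have "\<rho> (Poly_Mapping.single (k + m) (bracket x y), ?c, 0) v = R (k + m) (bracket x y) v + C ?c v"
    using rho_add_left[OF in_GLT(1)[OF gk_bracket[OF x y]] in_GLT(3)[OF c], of v]
    by (simp add: loop_elt_def R_def C_def)
  then show ?thesis
    using rho_bracket[OF in_GLT(1)[OF x] in_GLT(1)[OF y], of v] by (simp add: br R_def)
qed

lemma cocycle_central: "x \<in> gk T k \<Longrightarrow> y \<in> gk T m \<Longrightarrow>
    cocycle T (Poly_Mapping.single k x) (Poly_Mapping.single m y) \<in> central_m T"
  using GLT_bracket[OF in_GLT(1) in_GLT(1), of x k y m] by (simp add: gltbr_def loop_elt_def elems_GLT)

lemma C_R: "c \<in> central_m T \<Longrightarrow> x \<in> gk T k \<Longrightarrow> C c (R k x v) = R k x (C c v)"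
  using rho_bracket[OF in_GLT(3) in_GLT(1), of c x k v] rho_zero[of v]
  by (simp add: C_def R_def gltbr_def loop_elt_def zero_prod_def)

lemma sum_axis: "(\<Sum>j\<in>UNIV. (axis i 1 :: complex ^ 'n) $ j * of_int (k $ j)) = of_int (k $ i)"
  by (simp add: axis_def if_distrib[of "\<lambda>a. a * _"] cong: if_cong)

lemma D_R: "x \<in> gk T k \<Longrightarrow> D i (R k x v) = sV (of_int (k $ i)) (R k x v) + R k x (D i v)"
proof -
  assume x: "x \<in> gk T k"
  have "gltbr T (d_elt i) (loop_elt (Poly_Mapping.single k x)) =
      gltscale T (of_int (k $ i)) (loop_elt (Poly_Mapping.single k x))"
    by (simp add: gltbr_def loop_elt_def d_elt_def gltscale_def ldeg_single sum_axis)
  then show ?thesis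
    using rho_bracket[OF in_GLT(5) in_GLT(1)[OF x], of i v] rho_scale_left[OF in_GLT(1)[OF x]]
    by (simp add: D_def R_def)
qed

lemma D_C: "r \<in> Gam T \<Longrightarrow> D i (C (tK r j) v) = sV (of_int (r $ i)) (C (tK r j) v) + C (tK r j) (D i v)"
proof -
  assume r: "r \<in> Gam T"
  have "gltbr T (d_elt i) (0, tK r j, 0) = gltscale T (of_int (r $ i)) (0, tK r j, 0)"
    by (simp add: gltbr_def d_elt_def gltscale_def cdeg_tK sum_axis)
  then show ?thesis
    using rho_bracket[OF in_GLT(5)[of i] in_GLT(3)[OF tK_central_m[OF r, of j]], of v]
      rho_scale_left[OF in_GLT(3)[OF tK_central_m[OF r]]]
    by (simp add: D_def C_def)
qed

lemma rho_sum:
  assumes "\<And>i. i \<in> I \<Longrightarrow> x i \<in> elems (GLT T)"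
  shows "(\<Sum>i\<in>I. x i) \<in> elems (GLT T)" "\<rho> (\<Sum>i\<in>I. x i) v = (\<Sum>i\<in>I. \<rho> (x i) v)"
proof -
  show "(\<Sum>i\<in>I. x i) \<in> elems (GLT T)"
    by (rule glt.subspace_sum[OF subspace_GLT]) (rule assms)
  show "\<rho> (\<Sum>i\<in>I. x i) v = (\<Sum>i\<in>I. \<rho> (x i) v)"
    using assms
  proof (induction I rule: infinite_finite_induct)
    case (insert i I)
    have "(\<Sum>i\<in>I. x i) \<in> elems (GLT T)"
      by (rule glt.subspace_sum[OF subspace_GLT]) (simp add: insert.prems)
    then show ?case
      using insert rho_add_left[of "x i" "\<Sum>i\<in>I. x i" v] by simp
  qed (simp_all add: rho_zero)
qed

lemma loop_elt_add: "loop_elt (u + w) = loop_elt u + (loop_elt w :: ('g, 'n) glt)"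
  and loop_elt_zero: "loop_elt 0 = (0 :: ('g, 'n) glt)"
  by (simp_all add: loop_elt_def zero_prod_def)

lemma loop_elt_sum: "loop_elt (\<Sum>i\<in>I. u i) = (\<Sum>i\<in>I. loop_elt (u i) :: ('g, 'n) glt)"
  by (induction I rule: infinite_finite_induct) (simp_all add: loop_elt_add loop_elt_zero)

lemma rho_loop:
  assumes "u \<in> elems (LT T)"
  shows "\<rho> (loop_elt u) v = (\<Sum>k\<in>Poly_Mapping.keys u. R k (Poly_Mapping.lookup u k) v)"
proof -
  have "\<rho> (loop_elt (\<Sum>k\<in>Poly_Mapping.keys u. Poly_Mapping.single k (Poly_Mapping.lookup u k))) v =
      (\<Sum>k\<in>Poly_Mapping.keys u. R k (Poly_Mapping.lookup u k) v)"
    unfolding loop_elt_sum R_def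
    by (rule rho_sum(2)) (use assms in \<open>auto simp: LT_def intro: in_GLT\<close>)
  then show ?thesis by (simp add: poly_mapping_sum_single[symmetric])
qed

text \<open>Weight vectors span each graded piece, so stability of subspaces has to be checked on
  weight vectors only.\<close>

lemma R_closed:
  assumes N: "V.subspace N" and x: "x \<in> gk T k"
    and R: "\<And>\<alpha> x. \<alpha> \<in> hdual T \<Longrightarrow> x \<in> gk_weight T k \<alpha> \<Longrightarrow> R k x v \<in> N"
  shows "R k x v \<in> N"
proof -
  have "x \<in> gk T k \<and> R k x v \<in> N" if "x \<in> g.span (\<Union>\<alpha>\<in>hdual T. gk_weight T k \<alpha>)" for x
    using that
  proof (induction rule: g.span_induct_alt)
    case base
    show ?case using V.subspace_0[OF N] g.subspace_0[OF subspace_gk] by simp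
  next
    case (step c x y)
    then obtain \<alpha> where "\<alpha> \<in> hdual T" "x \<in> gk_weight T k \<alpha>" by blast
    then have "R k x v \<in> N" "x \<in> gk T k" using R gk_weight_gk by blast+
    with step show ?case
      using N g.subspace_scale[OF subspace_gk, of x k c] g.subspace_add[OF subspace_gk, of "gscale T c x" k y]
      by (auto simp: R_add R_scale intro: V.subspace_add V.subspace_scale)
  qed
  then show ?thesis using x gk_weight_span by blast
qed

lemma rho_loop_closed:
  assumes N: "V.subspace N" and u: "u \<in> elems (LT T)"
    and R: "\<And>k \<alpha> x. \<alpha> \<in> hdual T \<Longrightarrow> x \<in> gk_weight T k \<alpha> \<Longrightarrow> R k x v \<in> N"
  shows "\<rho> (loop_elt u) v \<in> N"
  unfolding rho_loop[OF u]
proof (rule V.subspace_sum[OF N])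
  fix k
  show "R k (Poly_Mapping.lookup u k) v \<in> N"
  proof (rule R_closed[OF N])
    show "Poly_Mapping.lookup u k \<in> gk T k" using u by (simp add: LT_def)
  qed (rule R)
qed

lemma C_closed:
  assumes N: "V.subspace N" and c: "c \<in> central_m T"
    and tK: "\<And>r i. r \<in> Gam T \<Longrightarrow> C (tK r i) v \<in> N"
  shows "C c v \<in> N"
proof -
  have "c \<in> central_m T \<and> C c v \<in> N" if "c \<in> central.span {tK k i |k i. k \<in> Gam T}" for c
    using that
  proof (induction rule: central.span_induct_alt)
    case base
    show ?case using V.subspace_0[OF N] zero_in(2) by simp
  next
    case (step a x y)
    then obtain r i where x: "x = tK r i" "r \<in> Gam T" by blast
    have c: "cscale a x \<in> central_m T" "y \<in> central_m T"
      using step tK_central_m[OF x(2), of i] unfolding central_m_def x(1) by (auto intro: central.span_scale)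
    then have "cscale a x + y \<in> central_m T"
      unfolding central_m_def by (rule central.span_add)
    with c show ?case
      using step.IH tK[OF x(2), of i] tK_central_m[OF x(2), of i] N
      by (auto simp: C_add C_scale x(1) intro: V.subspace_add V.subspace_scale)
  qed
  then show ?thesis using c unfolding central_m_def by blast
qed

lemma d_decomposition: "(0, 0, d) = (\<Sum>i\<in>UNIV. gltscale T (d $ i) (d_elt i :: ('g, 'n) glt))"
proof -
  have "(\<Sum>i\<in>I. gltscale T (d $ i) (d_elt i :: ('g, 'n) glt)) = (0, 0, \<Sum>i\<in>I. d $ i *s axis i 1)" for I
    by (induction I rule: infinite_finite_induct) (simp_all add: zero_prod_def gltscale_def d_elt_def)
  moreover have "d = (\<Sum>i\<in>UNIV. d $ i *s axis i 1)"
    by (simp add: vec_eq_iff sum_component axis_def if_distrib[of "\<lambda>a. _ * a"] cong: if_cong)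
  ultimately show ?thesis by simp
qed

lemma rho_d: "\<rho> (0, 0, d) v = (\<Sum>i\<in>UNIV. sV (d $ i) (D i v))"
proof -
  have "\<rho> (0, 0, d) v = (\<Sum>i\<in>UNIV. \<rho> (gltscale T (d $ i) (d_elt i)) v)"
    unfolding d_decomposition
    by (rule rho_sum(2)) (use glt.subspace_scale[OF subspace_GLT] in_GLT(5) in blast)
  then show ?thesis by (simp add: rho_scale_left in_GLT D_def)
qed

lemma rho_decomposition:
  assumes "(u, c, d) \<in> elems (GLT T)"
  shows "\<rho> (u, c, d) v = \<rho> (loop_elt u) v + C c v + \<rho> (0, 0, d) v"
proof -
  have "loop_elt u + (0, c, 0) \<in> elems (GLT T)"
    using assms by (simp add: loop_elt_def elems_GLT)
  then show ?thesis
    using rho_add_left[of "loop_elt u + (0, c, 0)" "(0, 0, d)" v] rho_add_left[of "loop_elt u" "(0, c, 0)" v]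
      in_GLT(2,3,4) assms
    by (simp add: loop_elt_def elems_GLT C_def)
qed

section \<open>Irreducibility tested on weight vectors and degree operators\<close>

lemma irreducible_with_center:
  assumes N: "V.subspace N"
    and R: "\<And>k \<alpha> x v. \<alpha> \<in> hdual T \<Longrightarrow> x \<in> gk_weight T k \<alpha> \<Longrightarrow> v \<in> N \<Longrightarrow> R k x v \<in> N"
    and C: "\<And>r i v. r \<in> Gam T \<Longrightarrow> v \<in> N \<Longrightarrow> C (tK r i) v \<in> N"
    and D: "\<And>i v. v \<in> N \<Longrightarrow> D i v \<in> N"
  shows "N = {0} \<or> N = UNIV"
proof -
  have "\<rho> x v \<in> N" if x: "x \<in> elems (GLT T)" and v: "v \<in> N" for x v
  proof -
    obtain u c d where ucd: "x = (u, c, d)" by (cases x)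
    have uc: "u \<in> elems (LT T)" "c \<in> central_m T" using x by (simp_all add: ucd elems_GLT)
    have "\<rho> (loop_elt u) v \<in> N"
      by (rule rho_loop_closed[OF N uc(1)]) (rule R[OF _ _ v])
    moreover have "C c v \<in> N"
      by (rule C_closed[OF N uc(2)]) (rule C[OF _ v])
    moreover have "\<rho> (0, 0, d) v \<in> N"
      unfolding rho_d by (intro V.subspace_sum[OF N] V.subspace_scale[OF N] D v)
    ultimately show ?thesis
      using rho_decomposition x N by (auto simp: ucd intro: V.subspace_add)
  qed
  then have "lie_submodule (GLT T) (module_on UNIV sV \<rho>) N"
    using lie_module_GLT N by (simp add: lie_submodule_def module_on_def V.subspace_def)
  then show ?thesis
    using irred by (auto simp: irreducible_module_def module_on_def)
qed

text \<open>The degree k = m_i e_i singles out one symbol: \<Sum>_j k_j t^r K_j is then m_i t^r K_i,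
  so the cocycle of h(k) and t(r - k) is a non-zero multiple of t^r K_i.\<close>

definition central_pair :: "'g \<Rightarrow> 'g \<Rightarrow> ('n \<Rightarrow> complex) \<Rightarrow> bool" where
  "central_pair h t a \<longleftrightarrow> h \<in> cartan T \<and> t \<in> gk_weight T 0 0 \<and> (\<forall>i. a i \<noteq> 0) \<and>
    (\<forall>r\<in>Gam T. \<forall>i v.
       R (axis i (int (ordr T i))) h (R (r - axis i (int (ordr T i))) t v)
       - R (r - axis i (int (ordr T i))) t (R (axis i (int (ordr T i))) h v) = sV (a i) (C (tK r i) v))"

lemma Gam_axis: "axis i (int (ordr T i)) \<in> Gam T"
  and Gam_diff: "r \<in> Gam T \<Longrightarrow> s \<in> Gam T \<Longrightarrow> r - s \<in> Gam T"
  by (auto simp: Gam_def axis_def)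

text \<open>By the choice of \<open>h\<close> and \<open>t\<close> the bracket of \<open>h(k)\<close> and \<open>t(r - k)\<close> is purely central.\<close>

lemma central_pair_exists: "\<exists>h t a. central_pair h t a"
proof -
  obtain h0 where h0: "h0 \<in> cartan T" "lam h0 \<noteq> 0"
    using lam_nonzero hdual_eqI[OF lam_dual hdual_zero] by (metis zero_fun_apply)
  have "lam 0 = 0"
    using hdual_linear(2)[OF lam_dual, of 0 0] g.subspace_0[OF cartan_toral(2)] by simp
  then obtain h t where ht: "h \<in> cartan T" "t \<in> gk_weight T 0 0" "bracket h t = 0" "form T h t \<noteq> 0"
    using nonisotropic_pair_exists[OF h0(1)] h0(2) by metis
  have "R (axis i (int (ordr T i))) h (R (r - axis i (int (ordr T i))) t v)
       - R (r - axis i (int (ordr T i))) t (R (axis i (int (ordr T i))) h v)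
       = sV (form T h t * of_nat (ordr T i)) (C (tK r i) v)" if r: "r \<in> Gam T" for r i v
  proof -
    let ?k = "axis i (int (ordr T i))"
    have h: "h \<in> gk T ?k" using ht(1) cartan_toral(1) gk_Gam[OF Gam_axis] by auto
    have t: "t \<in> gk T (r - ?k)" using gk_weight_gk[OF ht(2)] gk_Gam[OF Gam_diff[OF r Gam_axis]] by auto
    have "(\<Sum>j\<in>UNIV. cscale (of_int (?k $ j)) (tK (?k + (r - ?k)) j)) =
        (\<Sum>j\<in>UNIV. if j = i then cscale (of_nat (ordr T i)) (tK r i) else 0)"
      by (rule sum.cong) (auto simp: axis_def)
    then have "cocycle T (Poly_Mapping.single ?k h) (Poly_Mapping.single (r - ?k) t)
      = cscale (form T h t * of_nat (ordr T i)) (tK r i)"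
      by (simp add: cocycle_single)
    then show ?thesis
      using R_R[OF h t, of v] by (simp add: ht(3) C_scale tK_central_m r)
  qed
  then have "central_pair h t (\<lambda>i. form T h t * of_nat (ordr T i))"
    using ht ordr_pos by (simp add: central_pair_def)
  then show ?thesis by blast
qed

lemma C_tK_closed:
  assumes N: "V.subspace N" and r: "r \<in> Gam T" and v: "v \<in> N"
    and R: "\<And>k x v. x \<in> gk_weight T k 0 \<Longrightarrow> v \<in> N \<Longrightarrow> R k x v \<in> N"
  shows "C (tK r i) v \<in> N"
proof -
  obtain h t a where p: "central_pair h t a" using central_pair_exists by blast
  have ht: "h \<in> cartan T" "t \<in> gk_weight T 0 0" "a i \<noteq> 0" and
    eq: "R (axis i (int (ordr T i))) h (R (r - axis i (int (ordr T i))) t v)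
       - R (r - axis i (int (ordr T i))) t (R (axis i (int (ordr T i))) h v) = sV (a i) (C (tK r i) v)"
    using p r by (simp_all add: central_pair_def)
  have "h \<in> gk_weight T (axis i (int (ordr T i))) 0" "t \<in> gk_weight T (r - axis i (int (ordr T i))) 0"
    using cartan_weight_zero[OF ht(1)] ht(2) gk_weight_Gam[OF Gam_axis] gk_weight_Gam[OF Gam_diff[OF r Gam_axis]]
    by auto
  then have "sV (a i) (C (tK r i) v) \<in> N"
    unfolding eq[symmetric] using R v N by (intro V.subspace_diff) auto
  then have "sV (inverse (a i)) (sV (a i) (C (tK r i) v)) \<in> N"
    using N by (rule V.subspace_scale[rotated])
  then show ?thesis using ht(3) by simp
qed

text \<open>Stability under the center follows from stability under operators of weight zero, as t^r
  K_i acts as a commutator of two of them.\<close>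

lemma irreducible:
  assumes N: "V.subspace N"
    and R: "\<And>k \<alpha> x v. \<alpha> \<in> hdual T \<Longrightarrow> x \<in> gk_weight T k \<alpha> \<Longrightarrow> v \<in> N \<Longrightarrow> R k x v \<in> N"
    and D: "\<And>i v. v \<in> N \<Longrightarrow> D i v \<in> N"
  shows "N = {0} \<or> N = UNIV"
proof (rule irreducible_with_center[OF N])
  fix r i v assume r: "r \<in> Gam T" and v: "v \<in> N"
  show "C (tK r i) v \<in> N"
    using hdual_zero by (rule C_tK_closed[OF N r v, OF R])
qed (fact R D)+

section \<open>Weight spaces and triangular decomposition\<close>

lemma subspace_LT: "module.subspace (lscale T) (elems (LT T))"
proof -
  interpret L: vector_space "lscale T" by (rule vector_space_lscale)
  show ?thesis
    by (auto simp: L.subspace_def LT_def lookup_add lookup_lscale[OF g.vector_space_axioms]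
        intro: g.subspace_0[OF subspace_gk] g.subspace_add[OF subspace_gk] g.subspace_scale[OF subspace_gk])
qed

text \<open>The raising part is a span, so its generators suffice. Passing from enlarged roots to
  all positive functionals adds nothing, since a non-zero vector of non-zero weight already has an
  enlarged root as weight.\<close>

lemma V_plus_iff: "v \<in> V_plus T \<rho> \<longleftrightarrow>
    (\<forall>k \<alpha> x. \<alpha> \<in> hdual T \<longrightarrow> positive \<alpha> \<longrightarrow> x \<in> gk_weight T k \<alpha> \<longrightarrow> R k x v = 0)"
proof -
  interpret L: vector_space "lscale T" by (rule vector_space_lscale)
  let ?S = "{Poly_Mapping.single k x |k x \<alpha>. \<alpha> \<in> roots_en T \<and> positive \<alpha> \<and> x \<in> gk_weight T k \<alpha>}"
  show ?thesis
  proof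
    assume v: "v \<in> V_plus T \<rho>"
    show "\<forall>k \<alpha> x. \<alpha> \<in> hdual T \<longrightarrow> positive \<alpha> \<longrightarrow> x \<in> gk_weight T k \<alpha> \<longrightarrow> R k x v = 0"
    proof (intro allI impI)
      fix k \<alpha> x assume x: "\<alpha> \<in> hdual T" "positive \<alpha>" "x \<in> gk_weight T k \<alpha>"
      show "R k x v = 0"
      proof (cases "x = 0")
        case False
        then have "\<alpha> \<in> roots_en T" using gk_weight_root[OF x(1,3)] x(2) by auto
        then have "Poly_Mapping.single k x \<in> ?S" using x by blast
        then have "Poly_Mapping.single k x \<in> LT_plus T"
          unfolding LT_plus_alt by (rule L.span_base)
        then show ?thesis using v by (simp add: V_plus_def R_def)
      qed simp
    qed
  next
    assume R: "\<forall>k \<alpha> x. \<alpha> \<in> hdual T \<longrightarrow> positive \<alpha> \<longrightarrow> x \<in> gk_weight T k \<alpha> \<longrightarrow> R k x v = 0"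
    have "u \<in> elems (LT T) \<and> \<rho> (loop_elt u) v = 0" if "u \<in> L.span ?S" for u
      using that
    proof (induction rule: L.span_induct_alt)
      case base
      show ?case using zero_in(1) by (simp add: loop_elt_zero rho_zero)
    next
      case (step c x y)
      then obtain k x' \<alpha> where x: "x = Poly_Mapping.single k x'" "\<alpha> \<in> roots_en T" "positive \<alpha>" "x' \<in> gk_weight T k \<alpha>"
        by blast
      have xL: "x \<in> elems (LT T)" using single_in_LT[OF gk_weight_gk[OF x(4)]] x(1) by simp
      then have cx: "lscale T c x \<in> elems (LT T)" by (rule L.subspace_scale[OF subspace_LT])
      have "\<rho> (loop_elt x) v = 0"
        using R[rule_format, OF roots_en_cases(1)[OF x(2)] x(3,4)] by (simp add: R_def x(1))
      moreover have "loop_elt (lscale T c x) = gltscale T c (loop_elt x :: ('g, 'n) glt)"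
        by (simp add: loop_elt_def gltscale_def)
      ultimately have "\<rho> (loop_elt (lscale T c x)) v = 0"
        using rho_scale_left[OF in_GLT(2)[OF xL]] by simp
      then show ?case
        using step.IH cx rho_add_left[OF in_GLT(2) in_GLT(2), of "lscale T c x" y v]
          L.subspace_add[OF subspace_LT cx] by (simp add: loop_elt_add)
    qed
    then show "v \<in> V_plus T \<rho>" by (simp add: V_plus_def LT_plus_alt)
  qed
qed

lemma V_plusD: "v \<in> V_plus T \<rho> \<Longrightarrow> \<alpha> \<in> hdual T \<Longrightarrow> positive \<alpha> \<Longrightarrow> x \<in> gk_weight T k \<alpha> \<Longrightarrow> R k x v = 0"
  using V_plus_iff by blast

lemma single_in_LT_zero: "x \<in> gk_weight T k 0 \<Longrightarrow> Poly_Mapping.single k x \<in> LT_zero T"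
  using g.subspace_0[OF subspace_gk_weight] by (auto simp: LT_zero_def lookup_single when_def)

lemma R_linear:
  assumes "x \<in> gk T k"
  shows "R k x 0 = 0" "R k x (v + w) = R k x v + R k x w" "R k x (sV c v) = sV c (R k x v)"
    "R k x (v - w) = R k x v - R k x w" "R k x (\<Sum>i\<in>I. u i) = (\<Sum>i\<in>I. R k x (u i))"
proof -
  interpret r: Vector_Spaces.linear sV sV "R k x" by (rule linear_R[OF assms])
  show "R k x 0 = 0" "R k x (v + w) = R k x v + R k x w" "R k x (sV c v) = sV c (R k x v)"
    "R k x (v - w) = R k x v - R k x w" "R k x (\<Sum>i\<in>I. u i) = (\<Sum>i\<in>I. R k x (u i))"
    by (rule r.zero r.add r.scale r.diff r.sum)+
qed

lemma D_linear: "D i 0 = 0" "D i (v + w) = D i v + D i w" "D i (sV c v) = sV c (D i v)"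
  "D i (v - w) = D i v - D i w"
proof -
  interpret r: Vector_Spaces.linear sV sV "D i" by (rule linear_D)
  show "D i 0 = 0" "D i (v + w) = D i v + D i w" "D i (sV c v) = sV c (D i v)"
    "D i (v - w) = D i v - D i w"
    by (rule r.zero r.add r.scale r.diff)+
qed

lemma C_linear:
  assumes "c \<in> central_m T"
  shows "C c 0 = 0" "C c (v + w) = C c v + C c w" "C c (sV a v) = sV a (C c v)" "C c (v - w) = C c v - C c w"
proof -
  interpret r: Vector_Spaces.linear sV sV "C c" by (rule linear_C[OF assms])
  show "C c 0 = 0" "C c (v + w) = C c v + C c w" "C c (sV a v) = sV a (C c v)" "C c (v - w) = C c v - C c w"
    by (rule r.zero r.add r.scale r.diff)+
qed

lemma subspace_V_plus: "V.subspace (V_plus T \<rho>)"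
  unfolding V.subspace_def
proof (intro conjI ballI allI)
  show "0 \<in> V_plus T \<rho>"
    unfolding V_plus_iff by (intro allI impI R_linear gk_weight_gk)
next
  fix v w assume v: "v \<in> V_plus T \<rho>" and w: "w \<in> V_plus T \<rho>"
  show "v + w \<in> V_plus T \<rho>"
    unfolding V_plus_iff
  proof (intro allI impI)
    fix k \<alpha> x assume x: "\<alpha> \<in> hdual T" "positive \<alpha>" "x \<in> gk_weight T k \<alpha>"
    show "R k x (v + w) = 0"
      using V_plusD[OF v x] V_plusD[OF w x] by (simp add: R_linear gk_weight_gk[OF x(3)])
  qed
next
  fix c v assume v: "v \<in> V_plus T \<rho>"
  show "sV c v \<in> V_plus T \<rho>"
    unfolding V_plus_iff
  proof (intro allI impI)
    fix k \<alpha> x assume x: "\<alpha> \<in> hdual T" "positive \<alpha>" "x \<in> gk_weight T k \<alpha>"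
    show "R k x (sV c v) = 0"
      using V_plusD[OF v x] by (simp add: R_linear gk_weight_gk[OF x(3)])
  qed
qed

text \<open>The bracket with a raising element is again raising, and the central term vanishes
  because weights \<alpha> > 0 and 0 are orthogonal.\<close>

lemma R_V_plus:
  assumes y: "y \<in> gk_weight T k 0" and v: "v \<in> V_plus T \<rho>"
  shows "R k y v \<in> V_plus T \<rho>"
  unfolding V_plus_iff
proof (intro allI impI)
  fix m \<alpha> x assume x: "\<alpha> \<in> hdual T" "positive \<alpha>" "x \<in> gk_weight T m \<alpha>"
  have "form T x y = 0"
    by (rule form_weight[OF x(3) y x(1) hdual_zero]) (use x(2) in auto)
  then have "cocycle T (Poly_Mapping.single m x) (Poly_Mapping.single k y) = 0"
    by (simp add: cocycle_single)
  moreover have "R (m + k) (bracket x y) v = 0"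
    using V_plusD[OF v x(1,2)] gk_weight_bracket[OF x(3) y] by simp
  ultimately show "R m x (R k y v) = 0"
    using R_R[OF gk_weight_gk[OF x(3)] gk_weight_gk[OF y], of v] V_plusD[OF v x]
    by (simp add: R_linear gk_weight_gk[OF y])
qed

lemma D_V_plus:
  assumes v: "v \<in> V_plus T \<rho>"
  shows "D i v \<in> V_plus T \<rho>"
  unfolding V_plus_iff
proof (intro allI impI)
  fix m \<alpha> x assume x: "\<alpha> \<in> hdual T" "positive \<alpha>" "x \<in> gk_weight T m \<alpha>"
  show "R m x (D i v) = 0"
    using D_R[OF gk_weight_gk[OF x(3)], of i v] V_plusD[OF v x] by (simp add: D_linear)
qed

section \<open>Vectors homogeneous for the Cartan subalgebra and for D\<close>

definition homogeneous :: "('n \<Rightarrow> complex) \<Rightarrow> ('g \<Rightarrow> complex) \<Rightarrow> int ^ 'n \<Rightarrow> 'v set" where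
  "homogeneous a \<nu> k = {v. (\<forall>h\<in>cartan T. R 0 h v = sV (\<nu> h) v) \<and> (\<forall>i. D i v = sV (a i + of_int (k $ i)) v)}"

lemma W_plus_zero: "0 \<in> W_plus T sV \<rho> z"
  unfolding W_plus_def by (rule V.span_zero)

lemma V_plus_nonzero: "\<exists>v\<in>V_plus T \<rho>. v \<noteq> 0"
  using W_proper W_plus_zero by auto

lemma h_tilde_mem:
  "h \<in> cartan T \<Longrightarrow> loop_elt (Poly_Mapping.single 0 h) \<in> h_tilde T"
  unfolding h_tilde_def loop_elt_def
  using central.span_zero[of "range (tK 0)"] by blast

lemma d_elt_h_tilde: "d_elt i \<in> h_tilde T"
proof -
  have "d_elt i = (Poly_Mapping.single 0 0, 0, axis i 1)" by (simp add: d_elt_def)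
  then show ?thesis
    unfolding h_tilde_def
    using g.subspace_0[OF cartan_toral(2)] central.span_zero[of "range (tK 0)"] by blast
qed

lemma homogeneous_vector_exists: "\<exists>a. \<exists>\<nu>\<in>hdual T. \<exists>v\<in>homogeneous a \<nu> 0. v \<noteq> 0"
proof -
  let ?I = "dual_space (gltscale T) (h_tilde T)"
  obtain v :: 'v where "v \<noteq> 0" using V_plus_nonzero by blast
  have "direct_sum_decomposition ?I (weight_space T sV \<rho>)"
    using integ unfolding integrable_module_def by (elim conjE)
  from this[unfolded direct_sum_decomposition_def, rule_format, of v, THEN ex1_implies_ex]
  obtain c where c: "\<forall>\<mu>\<in>?I. c \<mu> \<in> weight_space T sV \<rho> \<mu>" "\<forall>\<mu>. \<mu> \<notin> ?I \<longrightarrow> c \<mu> = 0"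
    "v = (\<Sum>\<mu> | c \<mu> \<noteq> 0. c \<mu>)"
    by (elim exE conjE) (rule that)
  have "\<exists>\<mu>. c \<mu> \<noteq> 0"
  proof (rule ccontr)
    assume "\<not> ?thesis"
    then have "v = 0" unfolding c(3) by simp
    with \<open>v \<noteq> 0\<close> show False by simp
  qed
  then obtain \<mu> where \<mu>: "c \<mu> \<noteq> 0" by blast
  then have I: "\<mu> \<in> ?I" and w: "c \<mu> \<in> weight_space T sV \<rho> \<mu>" using c by blast+
  define \<nu> where "\<nu> h = (if h \<in> cartan T then \<mu> (loop_elt (Poly_Mapping.single 0 h)) else 0)" for h
  have "\<nu> \<in> hdual T"
    unfolding hdual_def dual_space_def
  proof (intro CollectI conjI ballI allI impI)
    fix h h' assume h: "h \<in> cartan T" "h' \<in> cartan T"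
    then have "h + h' \<in> cartan T" using cartan_toral(2) g.subspace_add by blast
    moreover have "loop_elt (Poly_Mapping.single 0 (h + h')) =
        loop_elt (Poly_Mapping.single 0 h) + (loop_elt (Poly_Mapping.single 0 h') :: ('g, 'n) glt)"
      by (simp add: single_add loop_elt_def)
    ultimately show "\<nu> (h + h') = \<nu> h + \<nu> h'"
      using I h h_tilde_mem by (simp add: \<nu>_def dual_space_def)
  next
    fix e h assume h: "h \<in> cartan T"
    then have "gscale T e h \<in> cartan T" using cartan_toral(2) g.subspace_scale by blast
    moreover have "loop_elt (Poly_Mapping.single 0 (gscale T e h)) =
        gltscale T e (loop_elt (Poly_Mapping.single 0 h) :: ('g, 'n) glt)"
      by (simp add: loop_elt_def gltscale_def lscale_single)
    ultimately show "\<nu> (gscale T e h) = e * \<nu> h"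
      using I h h_tilde_mem by (simp add: \<nu>_def dual_space_def)
  qed (simp add: \<nu>_def)
  moreover have "c \<mu> \<in> homogeneous (\<lambda>i. \<mu> (d_elt i)) \<nu> 0"
    using w h_tilde_mem d_elt_h_tilde by (simp add: homogeneous_def weight_space_def R_def D_def \<nu>_def)
  ultimately show ?thesis using \<mu> by blast
qed

text \<open>The eigenvalues of D need not be integers, but on an irreducible module they lie in a
  single coset of \<int>^n; this is a representative of it, and degrees are counted relative to
  it.\<close>

definition offset :: "'n \<Rightarrow> complex" where
  "offset = (SOME a. \<exists>\<nu>\<in>hdual T. \<exists>v\<in>homogeneous a \<nu> 0. v \<noteq> 0)"

definition Vw :: "('g \<Rightarrow> complex) \<Rightarrow> 'v set" where
  "Vw \<nu> = V.joint_eigenspace (R 0) (cartan T) \<nu>"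

definition Vh :: "('g \<Rightarrow> complex) \<Rightarrow> int ^ 'n \<Rightarrow> 'v set" where
  "Vh = homogeneous offset"

lemma Vh_Vw: "v \<in> Vh \<nu> k \<Longrightarrow> v \<in> Vw \<nu>"
  by (simp add: Vh_def Vw_def homogeneous_def V.joint_eigenspace_def)

lemma Vh_iff: "v \<in> Vh \<nu> k \<longleftrightarrow> v \<in> Vw \<nu> \<and> (\<forall>i. D i v = sV (offset i + of_int (k $ i)) v)"
  by (simp add: Vh_def Vw_def homogeneous_def V.joint_eigenspace_def)

lemma cartan_gk_zero: "h \<in> cartan T \<Longrightarrow> h \<in> gk T 0"
  using cartan_toral(1) by blast

lemma subspace_Vw: "V.subspace (Vw \<nu>)"
  unfolding Vw_def by (rule V.subspace_joint_eigenspace) (rule linear_R[OF cartan_gk_zero])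

lemma R_cartan_R:
  assumes h: "h \<in> cartan T" and x: "x \<in> gk T m"
  shows "R 0 h (R m x v) = R m (bracket h x) v + R m x (R 0 h v)"
proof -
  have "cocycle T (Poly_Mapping.single 0 h) (Poly_Mapping.single m x) = 0"
    by (simp add: cocycle_single)
  then show ?thesis using R_R[OF cartan_gk_zero[OF h] x, of v] by simp
qed

lemma R_Vw:
  assumes x: "x \<in> gk_weight T m \<alpha>" and v: "v \<in> Vw \<nu>"
  shows "R m x v \<in> Vw (\<nu> + \<alpha>)"
proof -
  have "R 0 h (R m x v) = sV ((\<nu> + \<alpha>) h) (R m x v)" if h: "h \<in> cartan T" for h
  proof -
    have "R 0 h (R m x v) = R m (gscale T (\<alpha> h) x) v + R m x (sV (\<nu> h) v)"
      using R_cartan_R[OF h gk_weight_gk[OF x], of v] x v h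
      by (simp add: gk_weight_def Vw_def V.joint_eigenspace_def)
    then show ?thesis
      by (simp add: R_scale R_linear gk_weight_gk[OF x] V.scale_left_distrib add.commute)
  qed
  then show ?thesis by (simp add: Vw_def V.joint_eigenspace_def)
qed

lemma R_Vh:
  assumes x: "x \<in> gk_weight T m \<alpha>" and v: "v \<in> Vh \<nu> k"
  shows "R m x v \<in> Vh (\<nu> + \<alpha>) (k + m)"
proof -
  have "D i (R m x v) = sV (offset i + of_int ((k + m) $ i)) (R m x v)" for i
  proof -
    have "D i (R m x v) = sV (of_int (m $ i)) (R m x v) + R m x (sV (offset i + of_int (k $ i)) v)"
      using D_R[OF gk_weight_gk[OF x], of i v] v by (simp add: Vh_iff)
    then show ?thesis
      by (simp add: R_linear gk_weight_gk[OF x] V.scale_left_distrib add_ac)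
  qed
  moreover have "R m x v \<in> Vw (\<nu> + \<alpha>)"
    using R_Vw[OF x] v by (simp add: Vh_iff)
  ultimately show ?thesis by (simp add: Vh_iff)
qed

text \<open>The homogeneous vectors for one fixed offset span a non-zero submodule, so no second
  coset of degrees can occur.\<close>

lemma span_Vh: "V.span (\<Union>\<nu>\<in>hdual T. \<Union>k. Vh \<nu> k) = UNIV"
proof -
  let ?S = "\<Union>\<nu>\<in>hdual T. \<Union>k. Vh \<nu> k"
  obtain \<nu> v where v: "\<nu> \<in> hdual T" "v \<in> Vh \<nu> 0" "v \<noteq> 0"
    using someI_ex[OF homogeneous_vector_exists] unfolding offset_def Vh_def by blast
  have "V.span ?S = {0} \<or> V.span ?S = UNIV"
  proof (rule irreducible)
    fix k \<alpha> x v assume x: "\<alpha> \<in> hdual T" "x \<in> gk_weight T k \<alpha>" and v: "v \<in> V.span ?S"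
    show "R k x v \<in> V.span ?S"
      using v
    proof (induction rule: V.span_induct_alt)
      case base
      show ?case by (simp add: R_linear gk_weight_gk[OF x(2)] V.span_zero)
    next
      case (step c v w)
      then obtain \<nu> m where "\<nu> \<in> hdual T" "v \<in> Vh \<nu> m" by blast
      then have "R k x v \<in> ?S" using R_Vh[OF x(2)] hdual_add[OF _ x(1)] by blast
      then show ?case
        using step.IH by (simp add: R_linear gk_weight_gk[OF x(2)] V.span_add V.span_scale V.span_base)
    qed
  next
    fix i v assume "v \<in> V.span ?S"
    then show "D i v \<in> V.span ?S"
    proof (induction rule: V.span_induct_alt)
      case base
      show ?case by (simp add: D_linear V.span_zero)
    next
      case (step c v w)
      then obtain \<nu> m where "v \<in> Vh \<nu> m" by blast
      then have "D i v = sV (offset i + of_int (m $ i)) v" by (simp add: Vh_iff)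
      then show ?case
        using step.IH V.span_base[OF step(1)]
        by (simp add: D_linear V.span_add V.span_scale del: V.scale_scale)
    qed
  qed simp
  moreover have "v \<in> V.span ?S" using v(1,2) by (intro V.span_base) blast
  ultimately show ?thesis using v(3) by blast
qed

lemma Vw_distinct:
  assumes "v \<in> Vw \<nu>" "v \<in> Vw \<mu>" "v \<noteq> 0" "\<nu> \<in> hdual T" "\<mu> \<in> hdual T"
  shows "\<nu> = \<mu>"
proof (rule hdual_eqI[OF assms(4,5)])
  fix h assume "h \<in> cartan T"
  then have "sV (\<nu> h) v = sV (\<mu> h) v"
    using assms(1,2) unfolding Vw_def V.joint_eigenspace_def by auto
  then show "\<nu> h = \<mu> h" by (rule V.scale_right_imp_eq[OF assms(3)])
qed

lemma Vw_span_Vh: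
  assumes \<nu>: "\<nu> \<in> hdual T"
  shows "Vw \<nu> \<subseteq> V.span (\<Union>k. Vh \<nu> k)"
proof
  fix v assume v: "v \<in> Vw \<nu>"
  let ?S = "\<Union>\<nu>\<in>hdual T. \<Union>k. Vh \<nu> k"
  have lin: "Vector_Spaces.linear sV sV (R 0 h)" if "h \<in> cartan T" for h
    by (rule linear_R[OF cartan_gk_zero[OF that]])
  have ev: "\<exists>\<mu>. s \<in> V.joint_eigenspace (R 0) (cartan T) \<mu>" if s: "s \<in> ?S" for s
  proof -
    obtain \<mu> k where "s \<in> Vh \<mu> k" using s by blast
    then show ?thesis using Vh_Vw unfolding Vw_def by blast
  qed
  have vS: "v \<in> V.span ?S" by (simp add: span_Vh)
  have "v \<in> V.span (?S \<inter> V.joint_eigenspace (R 0) (cartan T) \<nu>)"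
    by (rule V.joint_eigenspace_component[where A = "R 0" and H = "cartan T", OF lin ev vS v[unfolded Vw_def]])
  moreover have "?S \<inter> V.joint_eigenspace (R 0) (cartan T) \<nu> \<subseteq> insert 0 (\<Union>k. Vh \<nu> k)"
  proof
    fix s assume s: "s \<in> ?S \<inter> V.joint_eigenspace (R 0) (cartan T) \<nu>"
    then obtain \<mu> k where \<mu>: "\<mu> \<in> hdual T" "s \<in> Vh \<mu> k" by blast
    show "s \<in> insert 0 (\<Union>k. Vh \<nu> k)"
    proof (cases "s = 0")
      case False
      then have "\<mu> = \<nu>" using Vw_distinct[of s \<mu> \<nu>] Vh_Vw[OF \<mu>(2)] s \<mu>(1) \<nu> by (simp add: Vw_def)
      then show ?thesis using \<mu>(2) by blast
    qed simp
  qed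
  then have "V.span (?S \<inter> V.joint_eigenspace (R 0) (cartan T) \<nu>) \<subseteq> V.span (insert 0 (\<Union>k. Vh \<nu> k))"
    by (rule V.span_mono)
  ultimately have "v \<in> V.span (insert 0 (\<Union>k. Vh \<nu> k))" by blast
  then show "v \<in> V.span (\<Union>k. Vh \<nu> k)" by simp
qed

text \<open>The K_i act by zero, so a weight of the Cartan subalgebra together with a degree
  determines a full weight of \<open>h_tilde T\<close>; integrability then applies.\<close>

lemma finite_dim_Vh:
  assumes \<nu>: "\<nu> \<in> hdual T"
  shows "\<exists>B. finite B \<and> Vh \<nu> k \<subseteq> V.span B"
proof -
  \<comment> \<open>The three coordinates of an element of \<open>h_tilde T\<close> contribute the
    value of \<nu>, the value zero on the central part, and the eigenvalue of the D-part.\<close>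
  define \<mu> :: "('g, 'n) glt \<Rightarrow> complex" where
    "\<mu> H = (if H \<in> h_tilde T then \<nu> (Poly_Mapping.lookup (fst H) 0)
       + (\<Sum>i\<in>UNIV. snd (snd H) $ i * (offset i + of_int (k $ i))) else 0)" for H
  have "\<mu> \<in> dual_space (gltscale T) (h_tilde T)"
    unfolding dual_space_def
  proof (intro CollectI conjI ballI allI impI)
    fix H H' :: "('g, 'n) glt" assume "H \<in> h_tilde T" "H' \<in> h_tilde T"
    then obtain h c d h' c' d' where
      H: "H = (Poly_Mapping.single 0 h, c, d)" "h \<in> cartan T" "c \<in> central.span (range (tK 0))"
      "H' = (Poly_Mapping.single 0 h', c', d')" "h' \<in> cartan T" "c' \<in> central.span (range (tK 0))"
      by (auto simp: h_tilde_def)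
    have hh: "h + h' \<in> cartan T" using H(2,5) cartan_toral(2) g.subspace_add by blast
    then have "H + H' \<in> h_tilde T"
      using central.span_add[OF H(3,6)] by (auto simp: h_tilde_def H single_add[symmetric])
    then show "\<mu> (H + H') = \<mu> H + \<mu> H'"
      using \<open>H \<in> h_tilde T\<close> \<open>H' \<in> h_tilde T\<close>
      by (simp add: \<mu>_def H lookup_add hdual_linear(1)[OF \<nu> H(2,5)] hdual_linear(1)[OF \<nu> H(5,2)] sum.distrib algebra_simps)
  next
    fix e and H :: "('g, 'n) glt" assume "H \<in> h_tilde T"
    then obtain h c d where
      H: "H = (Poly_Mapping.single 0 h, c, d)" "h \<in> cartan T" "c \<in> central.span (range (tK 0))"
      by (auto simp: h_tilde_def)
    have "gscale T e h \<in> cartan T" using H(2) cartan_toral(2) g.subspace_scale by blast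
    then have "gltscale T e H \<in> h_tilde T"
      using central.span_scale[OF H(3)] by (auto simp: h_tilde_def H gltscale_def lscale_single)
    then show "\<mu> (gltscale T e H) = e * \<mu> H"
      using \<open>H \<in> h_tilde T\<close>
      by (simp add: \<mu>_def H gltscale_def lscale_single hdual_linear(2)[OF \<nu> H(2)]
          sum_distrib_left distrib_left mult.assoc)
  qed (simp add: \<mu>_def)
  moreover have "\<forall>\<mu>\<in>dual_space (gltscale T) (h_tilde T). fd_subspace sV (weight_space T sV \<rho> \<mu>)"
    using integ unfolding integrable_module_def by (elim conjE)
  ultimately have "fd_subspace sV (weight_space T sV \<rho> \<mu>)"
    by (rule bspec[rotated])
  moreover have "Vh \<nu> k \<subseteq> weight_space T sV \<rho> \<mu>"
  proof
    fix v assume v: "v \<in> Vh \<nu> k"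
    show "v \<in> weight_space T sV \<rho> \<mu>"
      unfolding weight_space_def
    proof (intro CollectI ballI)
      fix H :: "('g, 'n) glt" assume Ht: "H \<in> h_tilde T"
      then obtain h c d where
        H: "H = (Poly_Mapping.single 0 h, c, d)" "h \<in> cartan T" "c \<in> central.span (range (tK 0))"
        by (auto simp: h_tilde_def)
      have Cc: "c \<in> central_m T \<and> C c v = 0"
        using H(3)
      proof (induction rule: central.span_induct_alt)
        case base
        show ?case using zero_in(2) by simp
      next
        case (step a x y)
        then obtain i where x: "x = tK 0 i" by blast
        have "0 \<in> Gam T" by (simp add: Gam_def)
        then have xm: "x \<in> central_m T" using tK_central_m x by simp
        moreover have "C x v = 0" using K_trivial by (simp add: x C_def K_elt_def)
        moreover have "cscale a x \<in> central_m T" "cscale a x + y \<in> central_m T"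
          using xm step.IH unfolding central_m_def by (auto intro: central.span_scale central.span_add)
        ultimately show ?case using step.IH by (simp add: C_add C_scale)
      qed
      have "Poly_Mapping.single 0 h \<in> elems (LT T)"
        using single_in_LT cartan_gk_zero H(2) by blast
      then have "\<rho> H v = R 0 h v + C c v + (\<Sum>i\<in>UNIV. sV (d $ i) (D i v))"
        using rho_decomposition[of "Poly_Mapping.single 0 h" c d v] Cc
        by (simp add: H(1) elems_GLT R_def rho_d)
      also have "\<dots> = sV (\<nu> h) v + (\<Sum>i\<in>UNIV. sV (d $ i * (offset i + of_int (k $ i))) v)"
        using v H(2) Cc by (simp add: Vh_iff Vw_def V.joint_eigenspace_def)
      also have "\<dots> = sV (\<mu> H) v"
        using Ht by (simp add: \<mu>_def H(1) V.scale_left_distrib V.scale_sum_left)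
      finally show "\<rho> H v = sV (\<mu> H) v" .
    qed
  qed
  ultimately show ?thesis by (auto simp: fd_subspace_def)
qed

lemma V_plus_Vw: "v \<in> V_plus T \<rho> \<Longrightarrow> v \<in> Vw lam"
  using lam_acts by (simp add: Vw_def V.joint_eigenspace_def R_def)

section \<open>Lowering operators and the spaces they generate\<close>

definition lower :: "'v set" where
  "lower = V.span (\<Union>\<nu>\<in>{\<nu> \<in> hdual T. positive (lam - \<nu>)}. Vw \<nu>)"

lemma subspace_lower: "V.subspace lower"
  by (simp add: lower_def)

lemma V_plus_Int_lower:
  assumes "v \<in> V_plus T \<rho>" "v \<in> lower"
  shows "v = 0"
proof -
  let ?S = "\<Union>\<nu>\<in>{\<nu> \<in> hdual T. positive (lam - \<nu>)}. Vw \<nu>"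
  have lin: "Vector_Spaces.linear sV sV (R 0 h)" if "h \<in> cartan T" for h
    by (rule linear_R[OF cartan_gk_zero[OF that]])
  have ev: "\<exists>\<mu>. s \<in> V.joint_eigenspace (R 0) (cartan T) \<mu>" if "s \<in> ?S" for s
    using that unfolding Vw_def by blast
  have "v \<in> V.span (?S \<inter> V.joint_eigenspace (R 0) (cartan T) lam)"
    by (rule V.joint_eigenspace_component[where A = "R 0" and H = "cartan T", OF lin ev
          assms(2)[unfolded lower_def] V_plus_Vw[OF assms(1), unfolded Vw_def]])
  moreover have "?S \<inter> V.joint_eigenspace (R 0) (cartan T) lam \<subseteq> {0}"
  proof
    fix s assume s: "s \<in> ?S \<inter> V.joint_eigenspace (R 0) (cartan T) lam"
    then obtain \<nu> where \<nu>: "\<nu> \<in> hdual T" "positive (lam - \<nu>)" "s \<in> Vw \<nu>" by blast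
    have "s \<in> Vw lam" using s by (simp add: Vw_def)
    moreover have "\<nu> \<noteq> lam" using \<nu>(2) by auto
    ultimately have "s = 0" using Vw_distinct[OF \<nu>(3) _ _ \<nu>(1) lam_dual] by blast
    then show "s \<in> {0}" by simp
  qed
  ultimately show ?thesis
    using V.span_mono[of _ "{0}"] by auto
qed

definition Minus :: "('v \<Rightarrow> 'v) set" where
  "Minus = {R k x |k x \<alpha>. \<alpha> \<in> hdual T \<and> positive (- \<alpha>) \<and> x \<in> gk_weight T k \<alpha>}"

text \<open>These operators map V_+ into itself. The central ones are included because the cocycle
  makes them appear in commutators with lowering operators.\<close>

definition Rest :: "('v \<Rightarrow> 'v) set" where
  "Rest = {R k x |k x \<alpha>. \<alpha> \<in> hdual T \<and> (\<alpha> = 0 \<or> positive \<alpha>) \<and> x \<in> gk_weight T k \<alpha>} \<union> C ` central_m T"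

lemma R_Minus_Rest: "\<alpha> \<in> hdual T \<Longrightarrow> x \<in> gk_weight T k \<alpha> \<Longrightarrow> R k x \<in> Minus \<union> Rest"
proof (cases "x = 0")
  case True
  \<comment> \<open>The trichotomy of weights needs a non-zero vector; the zero vector is counted as
    having weight zero.\<close>
  have "0 \<in> gk_weight T k 0" using g.subspace_0[OF subspace_gk_weight] .
  then show ?thesis unfolding True Rest_def using hdual_zero by blast
next
  case False
  assume "\<alpha> \<in> hdual T" "x \<in> gk_weight T k \<alpha>"
  then show ?thesis using weight_trichotomy[of \<alpha> x k] False unfolding Minus_def Rest_def by blast
qed

lemma linear_Minus_Rest: "X \<in> Minus \<union> Rest \<Longrightarrow> Vector_Spaces.linear sV sV X"
  unfolding Minus_def Rest_def using linear_R[OF gk_weight_gk] linear_C by blast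

lemma commutator_Minus_Rest:
  assumes X: "X \<in> Rest" and Y: "Y \<in> Minus"
  shows "\<exists>A\<in>Minus \<union> Rest. \<exists>B\<in>Minus \<union> Rest. \<forall>v. X (Y v) - Y (X v) = A v + B v"
proof -
  obtain m y \<beta> where y: "Y = R m y" "\<beta> \<in> hdual T" "y \<in> gk_weight T m \<beta>"
    using Y by (auto simp: Minus_def)
  show ?thesis
  proof (cases "X \<in> C ` central_m T")
    case True
    then obtain c where c: "X = C c" "c \<in> central_m T" by blast
    \<comment> \<open>The commutator vanishes; zero is written as a sum of two zero operators to fit
      the common form A v + B v.\<close>
    have "0 \<in> gk_weight T 0 0" using g.subspace_0[OF subspace_gk_weight] .
    then have "R 0 0 \<in> Minus \<union> Rest" using R_Minus_Rest[OF hdual_zero] by blast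
    moreover have "X (Y v) - Y (X v) = R 0 0 v + R 0 0 v" for v
      using C_R[OF c(2) gk_weight_gk[OF y(3)], of v] by (simp add: c(1) y(1))
    ultimately show ?thesis by blast
  next
    case False
    then obtain k x \<alpha> where x: "X = R k x" "\<alpha> \<in> hdual T" "x \<in> gk_weight T k \<alpha>"
      using X by (auto simp: Rest_def)
    let ?c = "cocycle T (Poly_Mapping.single k x) (Poly_Mapping.single m y)"
    have "R (k + m) (bracket x y) \<in> Minus \<union> Rest"
      by (rule R_Minus_Rest[OF hdual_add[OF x(2) y(2)] gk_weight_bracket[OF x(3) y(3)]])
    moreover have "C ?c \<in> Minus \<union> Rest"
      using cocycle_central[OF gk_weight_gk[OF x(3)] gk_weight_gk[OF y(3)]] by (simp add: Rest_def)
    moreover have "X (Y v) - Y (X v) = R (k + m) (bracket x y) v + C ?c v" for v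
      using R_R[OF gk_weight_gk[OF x(3)] gk_weight_gk[OF y(3)], of v] by (simp add: x(1) y(1))
    ultimately show ?thesis by blast
  qed
qed

text \<open>The space U(n) N for n the lowering part, expressed without an enveloping
  algebra.\<close>

definition Y :: "'v set \<Rightarrow> 'v set" where
  "Y N = V.op_span Minus N"

lemma subspace_Y: "V.subspace (Y N)"
  unfolding Y_def by (rule V.subspace_op_span)

lemma Y_base: "v \<in> N \<Longrightarrow> v \<in> Y N"
  unfolding Y_def by (rule V.op_span.base)

text \<open>Raising operators vanish on N, and central ones are commutators of operators of weight
  zero. The statement is for a subspace N because both V_+ and W_+ are needed.\<close>

lemma Rest_V_plus:
  assumes N: "V.subspace N" "N \<subseteq> V_plus T \<rho>" "\<And>k x v. x \<in> gk_weight T k 0 \<Longrightarrow> v \<in> N \<Longrightarrow> R k x v \<in> N"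
    and X: "X \<in> Rest" and v: "v \<in> N"
  shows "X v \<in> N"
proof (cases "X \<in> C ` central_m T")
  case True
  then obtain c where c: "X = C c" "c \<in> central_m T" by blast
  show ?thesis
    unfolding c(1)
  proof (rule C_closed[OF N(1) c(2)])
    fix r i assume "r \<in> Gam T"
    then show "C (tK r i) v \<in> N" by (rule C_tK_closed[OF N(1) _ v]) (rule N(3))
  qed
next
  case False
  then obtain k x \<alpha> where x: "X = R k x" "\<alpha> \<in> hdual T" "\<alpha> = 0 \<or> positive \<alpha>" "x \<in> gk_weight T k \<alpha>"
    using X unfolding Rest_def by blast
  from x(3) show ?thesis
  proof
    assume "\<alpha> = 0"
    then show ?thesis using N(3) x v by simp
  next
    assume "positive \<alpha>"
    then have "X v = 0" using V_plusD[OF _ x(2) _ x(4)] v N(2) x(1) by blast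
    then show ?thesis using V.subspace_0[OF N(1)] by simp
  qed
qed

lemma Y_stable:
  assumes N: "V.subspace N" "N \<subseteq> V_plus T \<rho>" "\<And>k x v. x \<in> gk_weight T k 0 \<Longrightarrow> v \<in> N \<Longrightarrow> R k x v \<in> N"
    and X: "X \<in> Minus \<union> Rest" and v: "v \<in> Y N"
  shows "X v \<in> Y N"
proof (cases "X \<in> Minus")
  case True
  then show ?thesis using v unfolding Y_def by (rule V.op_span.op)
next
  case False
  show ?thesis
    unfolding Y_def
  proof (rule V.op_span_stable[where R = Rest and M = Minus and x = X and v = v])
    fix X Y' v assume "X \<in> Rest" "Y' \<in> Minus"
    from commutator_Minus_Rest[OF this] obtain A B where AB: "A \<in> Minus \<union> Rest" "B \<in> Minus \<union> Rest"
      "X (Y' v) - Y' (X v) = A v + B v" by blast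
    have "A v \<in> {u v |u. u \<in> Minus \<union> Rest}" "B v \<in> {u v |u. u \<in> Minus \<union> Rest}"
      using AB by blast+
    then show "X (Y' v) - Y' (X v) \<in> V.span {u v |u. u \<in> Minus \<union> Rest}"
      unfolding AB(3) by (intro V.span_add V.span_base)
  next
    fix X v assume "X \<in> Rest" "v \<in> N"
    then show "X v \<in> V.op_span Minus N"
      using Rest_V_plus[OF N] by (intro V.op_span.base) blast
  qed (use linear_Minus_Rest v X False in \<open>auto simp: Y_def\<close>)
qed

lemma Y_stable_R:
  assumes N: "V.subspace N" "N \<subseteq> V_plus T \<rho>" "\<And>k x v. x \<in> gk_weight T k 0 \<Longrightarrow> v \<in> N \<Longrightarrow> R k x v \<in> N"
    and x: "\<alpha> \<in> hdual T" "x \<in> gk_weight T k \<alpha>" and v: "v \<in> Y N"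
  shows "R k x v \<in> Y N"
  by (rule Y_stable[OF N R_Minus_Rest[OF x] v])

text \<open>The commutator of a degree operator with a lowering operator is a multiple of the
  latter. This serves V_+; the space W_+ mixes degrees and is not stable under D.\<close>

lemma Y_stable_D:
  assumes N: "\<And>i v. v \<in> N \<Longrightarrow> D i v \<in> N" and v: "v \<in> Y N"
  shows "D i v \<in> Y N"
  unfolding Y_def
proof (rule V.op_span_stable[where R = "range D" and M = Minus and x = "D i" and v = v])
  fix X Y' v assume "X \<in> range D" "Y' \<in> Minus"
  then obtain j k x \<alpha> where x: "X = D j" "Y' = R k x" "x \<in> gk_weight T k \<alpha>"
    unfolding Minus_def by blast
  have "X (Y' v) - Y' (X v) = sV (of_int (k $ j)) (Y' v)"
    using D_R[OF gk_weight_gk[OF x(3)], of j v] by (simp add: x)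
  moreover have "Y' v \<in> {u v |u. u \<in> Minus \<union> range D}" using \<open>Y' \<in> Minus\<close> by blast
  ultimately show "X (Y' v) - Y' (X v) \<in> V.span {u v |u. u \<in> Minus \<union> range D}"
    by (simp add: V.span_scale V.span_base)
qed (use linear_D N v in \<open>auto simp: Y_def intro: V.op_span.base\<close>)

lemma Minus_lower:
  assumes X: "X \<in> Minus" and w: "w \<in> lower \<or> w \<in> V_plus T \<rho>"
  shows "X w \<in> lower"
proof -
  obtain k x \<alpha> where x: "X = R k x" "\<alpha> \<in> hdual T" "positive (- \<alpha>)" "x \<in> gk_weight T k \<alpha>"
    using X unfolding Minus_def by blast
  let ?S = "\<Union>\<nu>\<in>{\<nu> \<in> hdual T. positive (lam - \<nu>)}. Vw \<nu>"
  have key: "R k x v \<in> ?S" if v: "v \<in> Vw \<nu>" "\<nu> \<in> hdual T" "\<nu> = lam \<or> positive (lam - \<nu>)" for v \<nu>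
  proof -
    have eq: "lam - (\<nu> + \<alpha>) = (lam - \<nu>) + (- \<alpha>)" by simp
    from v(3) have "positive (lam - (\<nu> + \<alpha>))"
    proof
      assume "positive (lam - \<nu>)"
      then show ?thesis unfolding eq using x(3) by (rule positive_add)
    qed (use x(3) in simp)
    then show ?thesis using R_Vw[OF x(4) v(1)] hdual_add[OF v(2) x(2)] by blast
  qed
  from w show ?thesis
  proof
    assume "w \<in> lower"
    then show ?thesis
      unfolding lower_def x(1)
    proof (induction rule: V.span_induct_alt)
      case base
      show ?case by (simp add: R_linear gk_weight_gk[OF x(4)] V.span_zero)
    next
      case (step c v w)
      then have "R k x v \<in> V.span ?S" using key by (intro V.span_base) blast
      then show ?case
        unfolding R_linear(2,3)[OF gk_weight_gk[OF x(4)]]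
        by (intro V.span_add V.span_scale step.IH)
    qed
  next
    assume "w \<in> V_plus T \<rho>"
    then show ?thesis
      unfolding x(1) lower_def using key[OF V_plus_Vw lam_dual] by (intro V.span_base) blast
  qed
qed

text \<open>A lowering operator sends both N and \<open>lower\<close> into \<open>lower\<close>, so
  a generated vector has its component of highest weight in N.\<close>

lemma Y_decomposition:
  assumes N: "V.subspace N" "N \<subseteq> V_plus T \<rho>" and v: "v \<in> Y N"
  shows "\<exists>n\<in>N. \<exists>w\<in>lower. v = n + w"
proof -
  let ?X = "{n + w |n w. n \<in> N \<and> w \<in> lower}"
  have "Y N \<subseteq> ?X"
    unfolding Y_def
  proof (rule V.op_span_least)
    show "V.subspace ?X" by (rule V.subspace_sums[OF N(1) subspace_lower])
    show "N \<subseteq> ?X" using V.subspace_0[OF subspace_lower] by force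
    fix X v assume X: "X \<in> Minus" and "v \<in> ?X"
    then obtain n w where v: "v = n + w" "n \<in> N" "w \<in> lower" by blast
    interpret X: Vector_Spaces.linear sV sV X by (rule linear_Minus_Rest) (simp add: X)
    have "X v \<in> lower"
      unfolding v(1) X.add using Minus_lower[OF X] v N(2)
      by (intro V.subspace_add[OF subspace_lower]) blast+
    then show "X v \<in> ?X" using V.subspace_0[OF N(1)] by force
  qed
  then show ?thesis using v by blast
qed

lemma Y_V_plus: "Y (V_plus T \<rho>) = UNIV"
proof -
  have "Y (V_plus T \<rho>) = {0} \<or> Y (V_plus T \<rho>) = UNIV"
    by (rule irreducible[OF subspace_Y])
       (blast intro: Y_stable_R[OF subspace_V_plus subset_refl R_V_plus] Y_stable_D D_V_plus)+
  moreover obtain v where "v \<in> V_plus T \<rho>" "v \<noteq> 0" using V_plus_nonzero by blast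
  ultimately show ?thesis using Y_base[of v "V_plus T \<rho>"] by blast
qed

section \<open>Extending the highest central operators\<close>

definition pairscale :: "complex \<Rightarrow> 'v \<times> 'v \<Rightarrow> 'v \<times> 'v" where
  "pairscale c p = (sV c (fst p), sV c (snd p))"

sublocale PV: complex_vector_space pairscale
  by unfold_locales (simp_all add: pairscale_def prod_eq_iff V.scale_right_distrib V.scale_left_distrib)

definition both :: "('v \<Rightarrow> 'v) \<Rightarrow> 'v \<times> 'v \<Rightarrow> 'v \<times> 'v" where
  "both X p = (X (fst p), X (snd p))"

lemma linear_both: "Vector_Spaces.linear sV sV X \<Longrightarrow> Vector_Spaces.linear pairscale pairscale (both X)"
  by (auto simp: Vector_Spaces.linear_iff PV.vector_space_axioms both_def pairscale_def)

definition deg :: "'n \<Rightarrow> int ^ 'n" where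
  "deg i = l i *s f i"

lemma z_facts:
  "v \<in> V_plus T \<rho> \<Longrightarrow> z i v \<in> V_plus T \<rho>"
  "v \<in> V_plus T \<rho> \<Longrightarrow> w \<in> V_plus T \<rho> \<Longrightarrow> z i (v + w) = z i v + z i w"
  "v \<in> V_plus T \<rho> \<Longrightarrow> z i (sV c v) = sV c (z i v)"
  "x \<in> gk_weight T k 0 \<Longrightarrow> v \<in> V_plus T \<rho> \<Longrightarrow> z i (R k x v) = R k x (z i v)"
  "v \<in> V_plus T \<rho> \<Longrightarrow> D j (z i v) - z i (D j v) = sV (of_int (deg i $ j)) (z i v)"
proof -
  note H = z_hco[rule_format, of i, unfolded highest_central_operator_def]
  show "v \<in> V_plus T \<rho> \<Longrightarrow> z i v \<in> V_plus T \<rho>"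
    using H[THEN conjunct1] by blast
  show "v \<in> V_plus T \<rho> \<Longrightarrow> w \<in> V_plus T \<rho> \<Longrightarrow> z i (v + w) = z i v + z i w"
    using H[THEN conjunct2, THEN conjunct1] by blast
  show "v \<in> V_plus T \<rho> \<Longrightarrow> z i (sV c v) = sV c (z i v)"
    using H[THEN conjunct2, THEN conjunct2, THEN conjunct1] by blast
  show "x \<in> gk_weight T k 0 \<Longrightarrow> v \<in> V_plus T \<rho> \<Longrightarrow> z i (R k x v) = R k x (z i v)"
    using H[THEN conjunct2, THEN conjunct2, THEN conjunct2, THEN conjunct1] single_in_LT_zero
    unfolding R_def by blast
  show "v \<in> V_plus T \<rho> \<Longrightarrow> D j (z i v) - z i (D j v) = sV (of_int (deg i $ j)) (z i v)"
    using H[THEN conjunct2, THEN conjunct2, THEN conjunct2, THEN conjunct2] unfolding D_def deg_def by blast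
qed

lemma z_zero: "z i 0 = 0"
  using z_facts(3)[OF V.subspace_0[OF subspace_V_plus], of i 0] by simp

text \<open>By definition z_i commutes only with the part of weight zero; t^r K_i is reached through
  a commutator of two such operators.\<close>

lemma z_C_tK:
  assumes v: "v \<in> V_plus T \<rho>" and r: "r \<in> Gam T"
  shows "z i (C (tK r j) v) = C (tK r j) (z i v)"
proof -
  obtain h t a where p: "central_pair h t a" using central_pair_exists by blast
  let ?k = "axis j (int (ordr T j))"
  have ht: "h \<in> gk_weight T ?k 0" "t \<in> gk_weight T (r - ?k) 0" "a j \<noteq> 0" and
    eq: "R ?k h (R (r - ?k) t v) - R (r - ?k) t (R ?k h v) = sV (a j) (C (tK r j) v)" for v
    using p r cartan_weight_zero[of h] gk_weight_Gam[OF Gam_axis] gk_weight_Gam[OF Gam_diff[OF r Gam_axis]]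
    by (simp_all add: central_pair_def)
  have CV: "C (tK r j) v \<in> V_plus T \<rho>"
    by (rule C_tK_closed[OF subspace_V_plus r v]) (rule R_V_plus)
  have RV: "R ?k h v \<in> V_plus T \<rho>" "R (r - ?k) t v \<in> V_plus T \<rho>"
    "R ?k h (R (r - ?k) t v) \<in> V_plus T \<rho>" "R (r - ?k) t (R ?k h v) \<in> V_plus T \<rho>"
    using R_V_plus ht v by blast+
  have zdiff: "z i (u - w) = z i u - z i w" if "u \<in> V_plus T \<rho>" "w \<in> V_plus T \<rho>" for u w
    by (rule V.operator_diff[where f = "z i", OF subspace_V_plus z_facts(2,3) that])
  have "sV (a j) (z i (C (tK r j) v)) = z i (R ?k h (R (r - ?k) t v) - R (r - ?k) t (R ?k h v))"
    using z_facts(3)[OF CV] by (simp add: eq)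
  also have "\<dots> = R ?k h (R (r - ?k) t (z i v)) - R (r - ?k) t (R ?k h (z i v))"
    using z_facts(4) ht(1,2) RV v by (simp add: zdiff)
  also have "\<dots> = sV (a j) (C (tK r j) (z i v))" by (rule eq)
  finally show ?thesis using ht(3) by simp
qed

lemma C_V_plus: "c \<in> central_m T \<Longrightarrow> v \<in> V_plus T \<rho> \<Longrightarrow> C c v \<in> V_plus T \<rho>"
  by (rule Rest_V_plus[OF subspace_V_plus subset_refl R_V_plus]) (auto simp: Rest_def)

lemma z_C:
  assumes v: "v \<in> V_plus T \<rho>" and c: "c \<in> central_m T"
  shows "z i (C c v) = C c (z i v)"
proof -
  have "c \<in> central_m T \<and> z i (C c v) = C c (z i v)" if "c \<in> central.span {tK k i |k i. k \<in> Gam T}" for c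
    using that
  proof (induction rule: central.span_induct_alt)
    case base
    show ?case using zero_in(2) by (simp add: z_zero)
  next
    case (step a x y)
    then obtain r j where x: "x = tK r j" "r \<in> Gam T" by blast
    have c: "cscale a x \<in> central_m T" "y \<in> central_m T" "x \<in> central_m T"
      using step tK_central_m[OF x(2), of j] unfolding central_m_def x(1) by (auto intro: central.span_scale)
    then have "cscale a x + y \<in> central_m T"
      unfolding central_m_def by (intro central.span_add)
    moreover have "z i (C (cscale a x + y) v) = C (cscale a x + y) (z i v)"
      using c step.IH z_C_tK[OF v x(2), of i j] C_V_plus[OF _ v] V.subspace_scale[OF subspace_V_plus]
      by (simp add: C_add C_scale z_facts x(1))
    ultimately show ?case by blast
  qed
  then show ?thesis using c unfolding central_m_def by blast
qed

definition G :: "'n \<Rightarrow> ('v \<times> 'v) set" where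
  "G i = PV.op_span (both ` Minus) {(v, z i v) |v. v \<in> V_plus T \<rho>}"

lemma subspace_G: "PV.subspace (G i)"
  unfolding G_def by (rule PV.subspace_op_span)

lemma G_stable:
  assumes X: "X \<in> Minus \<union> Rest" and p: "p \<in> G i"
  shows "both X p \<in> G i"
proof (cases "X \<in> Minus")
  case True
  then show ?thesis using p unfolding G_def by (blast intro: PV.op_span.op)
next
  case False
  then have XR: "both X \<in> both ` Rest" using X by blast
  show ?thesis
    unfolding G_def
  proof (rule PV.op_span_stable[where R = "both ` Rest" and M = "both ` Minus" and x = "both X" and v = p,
        OF _ _ _ p[unfolded G_def] XR])
    fix x assume "x \<in> both ` Rest"
    then show "Vector_Spaces.linear pairscale pairscale x" using linear_both linear_Minus_Rest by blast
  next
    fix x y q assume "x \<in> both ` Rest" "y \<in> both ` Minus"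
    then obtain X' Y' where XY: "x = both X'" "X' \<in> Rest" "y = both Y'" "Y' \<in> Minus" by blast
    from commutator_Minus_Rest[OF XY(2,4)] obtain A B where
      AB: "A \<in> Minus \<union> Rest" "B \<in> Minus \<union> Rest" "\<And>v. X' (Y' v) - Y' (X' v) = A v + B v" by blast
    have "both A q \<in> {u q |u. u \<in> both ` Minus \<union> both ` Rest}"
      "both B q \<in> {u q |u. u \<in> both ` Minus \<union> both ` Rest}"
      using AB(1,2) by blast+
    moreover have eq: "x (y q) - y (x q) = both A q + both B q"
      by (simp add: XY both_def AB(3))
    ultimately show "x (y q) - y (x q) \<in> PV.span {u q |u. u \<in> both ` Minus \<union> both ` Rest}"
      unfolding eq by (intro PV.span_add PV.span_base)
  next
    fix x q assume "x \<in> both ` Rest" "q \<in> {(v, z i v) |v. v \<in> V_plus T \<rho>}"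
    then obtain X' v where x: "x = both X'" "X' \<in> Rest" "q = (v, z i v)" "v \<in> V_plus T \<rho>" by blast
    have XV: "X' v \<in> V_plus T \<rho>"
      by (rule Rest_V_plus[OF subspace_V_plus subset_refl R_V_plus x(2,4)])
    have "X' (z i v) = z i (X' v)"
    proof (cases "X' \<in> C ` central_m T")
      case True
      then show ?thesis using z_C[OF x(4)] by auto
    next
      case False
      then obtain k y \<alpha> where y: "X' = R k y" "\<alpha> \<in> hdual T" "\<alpha> = 0 \<or> positive \<alpha>" "y \<in> gk_weight T k \<alpha>"
        using x(2) unfolding Rest_def by blast
      from y(3) show ?thesis
      proof
        assume "\<alpha> = 0"
        then show ?thesis using z_facts(4) y x(4) by simp
      next
        assume "positive \<alpha>"
        then show ?thesis
          using V_plusD[OF x(4) y(2) _ y(4)] V_plusD[OF z_facts(1)[OF x(4), of i] y(2) _ y(4)] y(1) z_zero by simp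
      qed
    qed
    then have "x q = (X' v, z i (X' v))" by (simp add: x both_def)
    then show "x q \<in> PV.op_span (both ` Minus) {(v, z i v) |v. v \<in> V_plus T \<rho>}"
      using XV by (intro PV.op_span.base) blast
  qed
qed

text \<open>Shifting \<open>d\<^sub>j\<close> on the second component by the degree makes the graph of an operator of that degree stable.\<close>

definition twisted_D :: "'n \<Rightarrow> 'n \<Rightarrow> 'v \<times> 'v \<Rightarrow> 'v \<times> 'v" where
  "twisted_D i j p = (D j (fst p), D j (snd p) - sV (of_int (deg i $ j)) (snd p))"

lemma G_twisted_D:
  assumes p: "p \<in> G i"
  shows "twisted_D i j p \<in> G i"
  unfolding G_def
proof (rule PV.op_span_stable[where R = "{twisted_D i j}" and M = "both ` Minus" and x = "twisted_D i j" and v = p,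
      OF _ _ _ p[unfolded G_def] singletonI])
  fix x assume "x \<in> {twisted_D i j}"
  then show "Vector_Spaces.linear pairscale pairscale x"
    by (simp add: Vector_Spaces.linear_iff PV.vector_space_axioms twisted_D_def pairscale_def D_linear
        V.scale_right_distrib V.scale_right_diff_distrib mult.commute)
next
  fix x y q assume "x \<in> {twisted_D i j}" "y \<in> both ` Minus"
  then obtain k u \<alpha> where xy: "x = twisted_D i j" "y = both (R k u)" "R k u \<in> Minus" "u \<in> gk_weight T k \<alpha>"
    unfolding Minus_def by blast
  have "x (y q) - y (x q) = pairscale (of_int (k $ j)) (y q)"
    using D_R[OF gk_weight_gk[OF xy(4)], of j]
    by (simp add: xy(1,2) twisted_D_def both_def pairscale_def R_linear gk_weight_gk[OF xy(4)])
  moreover have "y q \<in> {u q |u. u \<in> both ` Minus \<union> {twisted_D i j}}" using xy(2,3) by blast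
  ultimately show "x (y q) - y (x q) \<in> PV.span {u q |u. u \<in> both ` Minus \<union> {twisted_D i j}}"
    by (simp add: PV.span_scale PV.span_base)
next
  fix x q assume "x \<in> {twisted_D i j}" "q \<in> {(v, z i v) |v. v \<in> V_plus T \<rho>}"
  then obtain v where x: "x = twisted_D i j" "q = (v, z i v)" "v \<in> V_plus T \<rho>" by blast
  have "x q = (D j v, z i (D j v))"
    using z_facts(5)[OF x(3), of j i] by (simp add: x twisted_D_def algebra_simps)
  then show "x q \<in> PV.op_span (both ` Minus) {(v, z i v) |v. v \<in> V_plus T \<rho>}"
    using D_V_plus[OF x(3)] by (intro PV.op_span.base) blast
qed

text \<open>In V_+ the two components remain related by z_i, because lowering operators push
  everything else into \<open>lower\<close>. This controls the pairs with first component
  zero.\<close>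

lemma G_decomposition:
  assumes p: "p \<in> G i"
  shows "\<exists>v\<in>V_plus T \<rho>. \<exists>w\<in>lower. \<exists>w'\<in>lower. p = (v + w, z i v + w')"
proof -
  let ?X = "{p. \<exists>v\<in>V_plus T \<rho>. \<exists>w\<in>lower. \<exists>w'\<in>lower. p = (v + w, z i v + w')}"
  note VS = V.subspace_0[OF subspace_V_plus] V.subspace_add[OF subspace_V_plus] V.subspace_scale[OF subspace_V_plus]
  note LS = V.subspace_0[OF subspace_lower] V.subspace_add[OF subspace_lower] V.subspace_scale[OF subspace_lower]
  have "G i \<subseteq> ?X"
    unfolding G_def
  proof (rule PV.op_span_least)
    show "PV.subspace ?X"
      unfolding PV.subspace_def
    proof (intro conjI ballI allI)
      show "0 \<in> ?X"
        using VS(1) LS(1) z_zero[of i] by (force simp: zero_prod_def)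
    next
      fix p q assume "p \<in> ?X" "q \<in> ?X"
      then obtain v w w' u y y' where pq: "p = (v + w, z i v + w')" "v \<in> V_plus T \<rho>" "w \<in> lower" "w' \<in> lower"
        "q = (u + y, z i u + y')" "u \<in> V_plus T \<rho>" "y \<in> lower" "y' \<in> lower" by blast
      have "p + q = ((v + u) + (w + y), z i (v + u) + (w' + y'))"
        using z_facts(2)[OF pq(2,6)] by (simp add: pq(1,5) add_ac)
      then show "p + q \<in> ?X"
        using VS(2)[OF pq(2,6)] LS(2)[OF pq(3,7)] LS(2)[OF pq(4,8)] by blast
    next
      fix c p assume "p \<in> ?X"
      then obtain v w w' where p: "p = (v + w, z i v + w')" "v \<in> V_plus T \<rho>" "w \<in> lower" "w' \<in> lower" by blast
      have "pairscale c p = (sV c v + sV c w, z i (sV c v) + sV c w')"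
        using z_facts(3)[OF p(2)] by (simp add: p(1) pairscale_def V.scale_right_distrib)
      then show "pairscale c p \<in> ?X"
        using VS(3)[OF p(2)] LS(3)[OF p(3)] LS(3)[OF p(4)] by blast
    qed
    show "{(v, z i v) |v. v \<in> V_plus T \<rho>} \<subseteq> ?X"
      using LS(1) by force
    fix y p assume "y \<in> both ` Minus" "p \<in> ?X"
    then obtain X v w w' where y: "y = both X" "X \<in> Minus"
      and p: "p = (v + w, z i v + w')" "v \<in> V_plus T \<rho>" "w \<in> lower" "w' \<in> lower" by blast
    interpret X: Vector_Spaces.linear sV sV X by (rule linear_Minus_Rest) (simp add: y)
    have "X (v + w) \<in> lower" "X (z i v + w') \<in> lower"
      unfolding X.add using Minus_lower[OF y(2)] p(2-4) z_facts(1)[OF p(2), of i] by (blast intro: LS(2))+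
    \<comment> \<open>The image has no part in V_+, so the witness there is 0.\<close>
    moreover have "y p = (0 + X (v + w), z i 0 + X (z i v + w'))"
      by (simp add: y p(1) both_def z_zero)
    ultimately show "y p \<in> ?X" using VS(1) by blast
  qed
  then show ?thesis using p by blast
qed

text \<open>The second components over 0 form a submodule of the irreducible V. It lies in
  \<open>lower\<close>, which is not all of V as it meets V_+ only in 0.\<close>

lemma G_single_valued:
  assumes "(0, w) \<in> G i"
  shows "w = 0"
proof -
  let ?K = "{w. (0, w) \<in> G i}"
  have "?K = {0} \<or> ?K = UNIV"
  proof (rule irreducible)
    show "V.subspace ?K"
      unfolding V.subspace_def
    proof (intro conjI ballI allI)
      show "0 \<in> ?K" using PV.subspace_0[OF subspace_G] by (simp add: zero_prod_def)
    next
      fix v w assume "v \<in> ?K" "w \<in> ?K"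
      then have "(0, v) + (0, w) \<in> G i" using PV.subspace_add[OF subspace_G] by blast
      then show "v + w \<in> ?K" by simp
    next
      fix c v assume "v \<in> ?K"
      then have "pairscale c (0, v) \<in> G i" using PV.subspace_scale[OF subspace_G] by blast
      then show "sV c v \<in> ?K" by (simp add: pairscale_def)
    qed
  next
    fix k \<alpha> x v assume x: "\<alpha> \<in> hdual T" "x \<in> gk_weight T k \<alpha>" and v: "v \<in> ?K"
    have "both (R k x) (0, v) \<in> G i"
      using G_stable[OF R_Minus_Rest[OF x]] v by blast
    then show "R k x v \<in> ?K" by (simp add: both_def R_linear gk_weight_gk[OF x(2)])
  next
    fix j v assume v: "v \<in> ?K"
    \<comment> \<open>On pairs (0, v) the twist is a scalar multiple of the pair itself and can be
      added back.\<close>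
    have "twisted_D i j (0, v) + pairscale (of_int (deg i $ j)) (0, v) \<in> G i"
      using G_twisted_D v by (intro PV.subspace_add[OF subspace_G] PV.subspace_scale[OF subspace_G]) auto
    then show "D j v \<in> ?K" by (simp add: twisted_D_def pairscale_def D_linear)
  qed
  moreover have "?K \<subseteq> lower"
  proof
    fix w assume "w \<in> ?K"
    then obtain v u w' where v: "v \<in> V_plus T \<rho>" "u \<in> lower" "w' \<in> lower" "0 = v + u" "w = z i v + w'"
      using G_decomposition[of "(0, w)" i] by auto
    have "v = - u" using v(4) by (simp add: eq_neg_iff_add_eq_0)
    then have "v \<in> lower" using V.subspace_neg[OF subspace_lower v(2)] by simp
    then have "v = 0" using V_plus_Int_lower v(1) by blast
    then show "w \<in> lower" using v(3,5) z_zero by simp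
  qed
  moreover have "lower \<noteq> UNIV" using V_plus_nonzero V_plus_Int_lower by blast
  ultimately show ?thesis using assms by blast
qed

text \<open>The first components form a subspace stable under lowering operators that contains V_+,
  and V_+ generates V.\<close>

lemma G_total: "\<exists>w. (v, w) \<in> G i"
proof -
  have "Y (V_plus T \<rho>) \<subseteq> {v. \<exists>w. (v, w) \<in> G i}"
    unfolding Y_def
  proof (rule V.op_span_least)
    show "V.subspace {v. \<exists>w. (v, w) \<in> G i}"
      unfolding V.subspace_def
    proof (intro conjI ballI allI)
      show "0 \<in> {v. \<exists>w. (v, w) \<in> G i}"
        using PV.subspace_0[OF subspace_G] by (auto simp: zero_prod_def)
    next
      fix v v' assume "v \<in> {v. \<exists>w. (v, w) \<in> G i}" "v' \<in> {v. \<exists>w. (v, w) \<in> G i}"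
      then obtain w w' where "(v, w) \<in> G i" "(v', w') \<in> G i" by blast
      from PV.subspace_add[OF subspace_G this] show "v + v' \<in> {v. \<exists>w. (v, w) \<in> G i}" by auto
    next
      fix c v assume "v \<in> {v. \<exists>w. (v, w) \<in> G i}"
      then obtain w where "(v, w) \<in> G i" by blast
      from PV.subspace_scale[OF subspace_G this, of c] show "sV c v \<in> {v. \<exists>w. (v, w) \<in> G i}"
        by (auto simp: pairscale_def)
    qed
    show "V_plus T \<rho> \<subseteq> {v. \<exists>w. (v, w) \<in> G i}"
      unfolding G_def by (blast intro: PV.op_span.base)
    fix X v assume "X \<in> Minus" "v \<in> {v. \<exists>w. (v, w) \<in> G i}"
    then obtain w where "both X (v, w) \<in> G i" using G_stable by blast
    then show "X v \<in> {v. \<exists>w. (v, w) \<in> G i}" by (auto simp: both_def)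
  qed
  then show ?thesis by (auto simp: Y_V_plus)
qed

definition Z :: "'n \<Rightarrow> 'v \<Rightarrow> 'v" where
  "Z i v = (THE w. (v, w) \<in> G i)"

lemma Z_unique:
  assumes "(v, w) \<in> G i" "(v, w') \<in> G i"
  shows "w = w'"
proof -
  have "(v, w) - (v, w') \<in> G i" using assms by (rule PV.subspace_diff[OF subspace_G])
  then show ?thesis using G_single_valued[of "w - w'" i] by simp
qed

lemma Z_graph: "(v, Z i v) \<in> G i"
  unfolding Z_def using G_total[of v i] Z_unique by (metis theI)

lemma Z_eqI: "(v, w) \<in> G i \<Longrightarrow> Z i v = w"
  using Z_unique Z_graph by blast

lemma Z_add: "Z i (v + w) = Z i v + Z i w"
  using PV.subspace_add[OF subspace_G Z_graph Z_graph, of v i w] by (intro Z_eqI) simp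

lemma Z_scale: "Z i (sV c v) = sV c (Z i v)"
  using PV.subspace_scale[OF subspace_G Z_graph, of c v i] by (intro Z_eqI) (simp add: pairscale_def)

lemma linear_Z: "Vector_Spaces.linear sV sV (Z i)"
  by (simp add: Vector_Spaces.linear_iff V.vector_space_axioms Z_add Z_scale)

lemma Z_zero: "Z i 0 = 0"
  using Z_scale[of i 0 0] by simp

lemma Z_z: "v \<in> V_plus T \<rho> \<Longrightarrow> Z i v = z i v"
  by (rule Z_eqI) (auto simp: G_def intro: PV.op_span.base)

lemma Z_R:
  assumes "\<alpha> \<in> hdual T" "x \<in> gk_weight T k \<alpha>"
  shows "Z i (R k x v) = R k x (Z i v)"
  using G_stable[OF R_Minus_Rest[OF assms] Z_graph, of v i] by (intro Z_eqI) (simp add: both_def)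

lemma D_Z: "D j (Z i v) = Z i (D j v) + sV (of_int (deg i $ j)) (Z i v)"
proof -
  have "Z i (D j v) = D j (Z i v) - sV (of_int (deg i $ j)) (Z i v)"
    using G_twisted_D[OF Z_graph, of i j v] by (intro Z_eqI) (simp add: twisted_D_def)
  then show ?thesis by simp
qed

lemma Z_C:
  assumes r: "r \<in> Gam T"
  shows "Z i (C (tK r j) v) = C (tK r j) (Z i v)"
proof -
  have "C (tK r j) \<in> Minus \<union> Rest" using tK_central_m[OF r] by (simp add: Rest_def)
  from G_stable[OF this Z_graph, of v i] show ?thesis by (intro Z_eqI) (simp add: both_def)
qed

text \<open>Schur's lemma for an operator of degree r: it does not commute with D, but the defect is
  a scalar multiple of Q itself, so kernel and image are still D-stable. It is applied to the Z_i
  and to the central operators.\<close>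

lemma homogeneous_operator_bij:
  assumes lin: "Vector_Spaces.linear sV sV Q"
    and R: "\<And>\<alpha> x k v. \<alpha> \<in> hdual T \<Longrightarrow> x \<in> gk_weight T k \<alpha> \<Longrightarrow> Q (R k x v) = R k x (Q v)"
    and D: "\<And>j v. D j (Q v) = Q (D j v) + sV (of_int (r $ j)) (Q v)"
    and nz: "Q v0 \<noteq> 0"
  shows "bij Q"
proof -
  interpret Q: Vector_Spaces.linear sV sV Q by (rule lin)
  have ker: "{v. Q v = 0} = {0} \<or> {v. Q v = 0} = UNIV"
  proof (rule irreducible)
    show "V.subspace {v. Q v = 0}" by (auto simp: V.subspace_def Q.zero Q.add Q.scale)
    fix k \<alpha> x v assume x: "\<alpha> \<in> hdual T" "x \<in> gk_weight T k \<alpha>" and v: "v \<in> {v. Q v = 0}"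
    then show "R k x v \<in> {v. Q v = 0}" by (simp add: R[OF x] R_linear gk_weight_gk[OF x(2)])
  next
    fix j v assume "v \<in> {v. Q v = 0}"
    then show "D j v \<in> {v. Q v = 0}" using D[of j v] by (simp add: D_linear)
  qed
  have im: "range Q = {0} \<or> range Q = UNIV"
  proof (rule irreducible)
    show "V.subspace (range Q)" by (rule Q.subspace_image) simp
    fix k \<alpha> x v assume x: "\<alpha> \<in> hdual T" "x \<in> gk_weight T k \<alpha>" and v: "v \<in> range Q"
    then show "R k x v \<in> range Q" by (auto simp: R[OF x, symmetric])
  next
    fix j v assume "v \<in> range Q"
    then obtain u where "v = Q u" by blast
    then have "D j v = Q (D j u + sV (of_int (r $ j)) u)"
      using D by (simp add: Q.add Q.scale)
    then show "D j v \<in> range Q" by blast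
  qed
  have "inj Q" using ker nz by (subst Q.inj_iff_eq_0) auto
  moreover have "surj Q" using im nz by auto
  ultimately show ?thesis by (simp add: bij_def)
qed

lemma bij_Z: "bij (Z i)"
proof -
  obtain v where v: "v \<in> V_plus T \<rho>" "z i v \<noteq> 0" using z_nonzero by blast
  then have "Z i v \<noteq> 0" using Z_z[of v i] by simp
  show ?thesis
    by (rule homogeneous_operator_bij[OF linear_Z Z_R D_Z \<open>Z i v \<noteq> 0\<close>])
qed

lemma Z_Vh: "Z i v \<in> Vh \<nu> (k + deg i) \<longleftrightarrow> v \<in> Vh \<nu> k"
proof -
  have inj: "Z i v = Z i w \<longleftrightarrow> v = w" for v w
    using bij_Z[of i] by (meson bij_is_inj injD)
  have "R 0 h (Z i v) = sV (\<nu> h) (Z i v) \<longleftrightarrow> R 0 h v = sV (\<nu> h) v" if "h \<in> cartan T" for h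
    using Z_R[OF hdual_zero cartan_weight_zero[OF that], of i v]
    by (simp add: Z_scale[symmetric] inj flip: Z_R[OF hdual_zero cartan_weight_zero[OF that]])
  moreover have "D j (Z i v) = sV (offset j + of_int ((k + deg i) $ j)) (Z i v) \<longleftrightarrow>
      D j v = sV (offset j + of_int (k $ j)) v" for j
  proof -
    have "D j (Z i v) = sV (offset j + of_int ((k + deg i) $ j)) (Z i v) \<longleftrightarrow>
        Z i (D j v) = Z i (sV (offset j + of_int (k $ j)) v)"
      by (simp add: D_Z Z_scale Z_add V.scale_left_distrib algebra_simps)
    then show ?thesis by (simp add: inj)
  qed
  ultimately show ?thesis
    by (simp add: Vh_iff Vw_def V.joint_eigenspace_def)
qed

section \<open>The submodule generated by \<open>W\<^sub>+\<close>\<close>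

abbreviation "WP \<equiv> W_plus T sV \<rho> z"

lemma subspace_WP: "V.subspace WP"
  unfolding W_plus_def by simp

lemma WP_V_plus: "WP \<subseteq> V_plus T \<rho>"
  using W_proper by blast

lemma R_WP: "x \<in> gk_weight T k 0 \<Longrightarrow> w \<in> WP \<Longrightarrow> R k x w \<in> WP"
  using W_submodule single_in_LT_zero by (simp add: R_def)

text \<open>Generated by lowering operators only, which makes the intersection with V_+ computable;
  \<open>V_prime_eq\<close> identifies it with U(LT) W_+.\<close>

definition VP :: "'v set" where
  "VP = Y WP"

lemma subspace_VP: "V.subspace VP"
  unfolding VP_def by (rule subspace_Y)

lemma R_VP: "\<alpha> \<in> hdual T \<Longrightarrow> x \<in> gk_weight T k \<alpha> \<Longrightarrow> v \<in> VP \<Longrightarrow> R k x v \<in> VP"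
  unfolding VP_def by (rule Y_stable_R[OF subspace_WP WP_V_plus R_WP])

lemma V_plus_Int_VP:
  assumes "v \<in> V_plus T \<rho>" "v \<in> VP"
  shows "v \<in> WP"
proof -
  obtain n w where nw: "n \<in> WP" "w \<in> lower" "v = n + w"
    using Y_decomposition[OF subspace_WP WP_V_plus] assms(2) unfolding VP_def by blast
  have "w = v - n" using nw(3) by simp
  then have "w \<in> V_plus T \<rho>"
    using V.subspace_diff[OF subspace_V_plus assms(1)] nw(1) WP_V_plus by blast
  then have "w = 0" using V_plus_Int_lower nw(2) by blast
  then show ?thesis using nw by simp
qed

lemma V_plus_not_VP: "\<not> V_plus T \<rho> \<subseteq> VP"
  using V_plus_Int_VP W_proper by blast

text \<open>Since Z_i commutes with lowering operators and V' is stable under them, the vectors with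
  this property form a space closed under these operators; it contains V_+ by the choice of
  W_+.\<close>

lemma Z_minus_id_VP: "Z i v - v \<in> VP"
proof -
  have "Y (V_plus T \<rho>) \<subseteq> {v. Z i v - v \<in> VP}"
    unfolding Y_def
  proof (rule V.op_span_least)
    show "V.subspace {v. Z i v - v \<in> VP}"
      unfolding V.subspace_def
    proof (intro conjI ballI allI)
      show "0 \<in> {v. Z i v - v \<in> VP}" using V.subspace_0[OF subspace_VP] by (simp add: Z_zero)
    next
      fix v w assume "v \<in> {v. Z i v - v \<in> VP}" "w \<in> {v. Z i v - v \<in> VP}"
      then have "(Z i v - v) + (Z i w - w) \<in> VP" using V.subspace_add[OF subspace_VP] by blast
      then show "v + w \<in> {v. Z i v - v \<in> VP}" by (simp add: Z_add algebra_simps)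
    next
      fix c v assume "v \<in> {v. Z i v - v \<in> VP}"
      then have "sV c (Z i v - v) \<in> VP" using V.subspace_scale[OF subspace_VP] by blast
      then show "sV c v \<in> {v. Z i v - v \<in> VP}" by (simp add: Z_scale V.scale_right_diff_distrib)
    qed
    show "V_plus T \<rho> \<subseteq> {v. Z i v - v \<in> VP}"
    proof
      fix v assume v: "v \<in> V_plus T \<rho>"
      then have "z i v - v \<in> WP" unfolding W_plus_def by (intro V.span_base) blast
      then show "v \<in> {v. Z i v - v \<in> VP}" unfolding VP_def using Z_z[OF v] Y_base by simp
    qed
    fix X v assume "X \<in> Minus" and v: "v \<in> {v. Z i v - v \<in> VP}"
    then obtain k x \<alpha> where x: "X = R k x" "\<alpha> \<in> hdual T" "x \<in> gk_weight T k \<alpha>"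
      unfolding Minus_def by blast
    have "R k x (Z i v - v) \<in> VP" using R_VP[OF x(2,3)] v by blast
    then show "X v \<in> {v. Z i v - v \<in> VP}"
      by (simp add: x(1) Z_R[OF x(2,3)] R_linear gk_weight_gk[OF x(3)])
  qed
  then show ?thesis by (auto simp: Y_V_plus)
qed

lemma VP_eq: "VP = V.span {Z i v - v |i v. True}"
proof
  let ?S = "{Z i v - v |i v. True}"
  show "V.span ?S \<subseteq> VP"
    by (rule V.span_minimal[OF _ subspace_VP]) (use Z_minus_id_VP in blast)
  show "VP \<subseteq> V.span ?S"
    unfolding VP_def Y_def
  proof (rule V.op_span_least[OF V.subspace_span])
    show "WP \<subseteq> V.span ?S"
      unfolding W_plus_def by (rule V.span_mono) (use Z_z in \<open>auto, metis\<close>)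
    fix X v assume "X \<in> Minus" and v: "v \<in> V.span ?S"
    then obtain k x \<alpha> where x: "X = R k x" "\<alpha> \<in> hdual T" "x \<in> gk_weight T k \<alpha>"
      unfolding Minus_def by blast
    show "X v \<in> V.span ?S"
      using v
    proof (induction rule: V.span_induct_alt)
      case base
      show ?case by (simp add: x(1) R_linear gk_weight_gk[OF x(3)] V.span_zero)
    next
      case (step c u w)
      then obtain i v where "u = Z i v - v" by blast
      then have "R k x u = Z i (R k x v) - R k x v"
        by (simp add: R_linear gk_weight_gk[OF x(3)] Z_R[OF x(2,3)])
      then have "R k x u \<in> V.span ?S" by (intro V.span_base) blast
      then show ?case
        using step.IH unfolding x(1) R_linear(2,3)[OF gk_weight_gk[OF x(3)]]
        by (intro V.span_add V.span_scale)
    qed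
  qed
qed

text \<open>A bijective Q commuting with all Z_i permutes the spanning vectors Z_i v - v, hence
  every element of V' is the image of one in V'. Thus Q is injective also modulo V'.\<close>

lemma VP_reflect:
  assumes lin: "Vector_Spaces.linear sV sV Q" and bij: "bij Q"
    and Z: "\<And>i v. Z i (Q v) = Q (Z i v)" and v: "Q v \<in> VP"
  shows "v \<in> VP"
proof -
  interpret Q: Vector_Spaces.linear sV sV Q by (rule lin)
  have "VP \<subseteq> Q ` VP"
  proof -
    have "u \<in> Q ` VP" if u: "u \<in> {Z i v - v |i v. True}" for u
    proof -
      obtain i v where "u = Z i v - v" using u by blast
      moreover obtain v' where "v = Q v'" using bij by (metis bij_pointE)
      ultimately have "u = Q (Z i v' - v')" by (simp add: Z Q.diff)
      then show ?thesis using Z_minus_id_VP by blast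
    qed
    then show ?thesis
      unfolding VP_eq by (intro V.span_minimal Q.subspace_image) (auto simp: VP_eq)
  qed
  then obtain u where "u \<in> VP" "Q v = Q u" using v by blast
  then show ?thesis using bij by (metis bij_is_inj injD)
qed

section \<open>Weight spaces modulo the submodule\<close>

text \<open>Chaining the steps by Z_i gives this relation whenever the two degrees differ by an
  element of the lattice spanned by the l_i f_i, which has finite index.\<close>

definition sim :: "int ^ 'n \<Rightarrow> int ^ 'n \<Rightarrow> bool" where
  "sim k k' \<longleftrightarrow> (\<forall>\<nu>. Vh \<nu> k \<subseteq> V.span (Vh \<nu> k' \<union> VP))"

lemma sim_refl: "sim k k"
  unfolding sim_def using V.span_superset by blast

lemma sim_trans:
  assumes "sim k k'" "sim k' k''"
  shows "sim k k''"
proof -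
  have "V.span (Vh \<nu> k' \<union> VP) \<subseteq> V.span (Vh \<nu> k'' \<union> VP)" for \<nu>
    using assms(2) V.span_superset[of "Vh \<nu> k'' \<union> VP"]
    by (intro V.span_minimal V.subspace_span) (auto simp: sim_def)
  then show ?thesis using assms(1) unfolding sim_def by blast
qed

text \<open>A vector v and Z_i v agree modulo V'. The backward direction uses that Z_i is onto and
  that Z_i v is homogeneous only if v is.\<close>

lemma sim_deg: "sim k (k + deg i)" "sim (k + deg i) k"
proof -
  show "sim k (k + deg i)"
    unfolding sim_def
  proof (intro allI subsetI)
    fix \<nu> v assume "v \<in> Vh \<nu> k"
    then have "Z i v \<in> V.span (Vh \<nu> (k + deg i) \<union> VP)"
      using Z_Vh by (intro V.span_base) blast
    moreover have "Z i v - v \<in> V.span (Vh \<nu> (k + deg i) \<union> VP)"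
      using Z_minus_id_VP by (intro V.span_base) blast
    ultimately have "Z i v - (Z i v - v) \<in> V.span (Vh \<nu> (k + deg i) \<union> VP)"
      by (rule V.span_diff)
    then show "v \<in> V.span (Vh \<nu> (k + deg i) \<union> VP)" by simp
  qed
  show "sim (k + deg i) k"
    unfolding sim_def
  proof (intro allI subsetI)
    fix \<nu> v assume v: "v \<in> Vh \<nu> (k + deg i)"
    obtain u where u: "v = Z i u" using bij_Z by (metis bij_pointE)
    have "u \<in> V.span (Vh \<nu> k \<union> VP)" using v u Z_Vh by (intro V.span_base) blast
    moreover have "Z i u - u \<in> V.span (Vh \<nu> k \<union> VP)" using Z_minus_id_VP by (intro V.span_base) blast
    ultimately have "u + (Z i u - u) \<in> V.span (Vh \<nu> k \<union> VP)" by (rule V.span_add)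
    then show "v \<in> V.span (Vh \<nu> k \<union> VP)" by (simp add: u)
  qed
qed

lemma sim_multiple: "sim k (k + q *s deg i)"
proof (induction q rule: int_induct[where k = 0])
  case base
  show ?case by (simp add: sim_refl)
next
  case (step1 q)
  have "k + (q + 1) *s deg i = (k + q *s deg i) + deg i"
    by (simp add: vector_sadd_rdistrib add.assoc)
  then show ?case using sim_trans[OF step1(2) sim_deg(1)[of _ i]] by metis
next
  case (step2 q)
  have "k + q *s deg i = (k + (q - 1) *s deg i) + deg i"
    by (simp add: vec_eq_iff algebra_simps)
  then show ?case using sim_trans[OF _ sim_deg(2)] step2(2) by metis
qed

lemma sim_sum: "finite I \<Longrightarrow> sim k (k + (\<Sum>i\<in>I. q i *s deg i))"
proof (induction rule: finite_induct)
  case empty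
  show ?case by (simp add: sim_refl)
next
  case (insert i I)
  have "k + (\<Sum>i\<in>insert i I. q i *s deg i) = (k + (\<Sum>i\<in>I. q i *s deg i)) + q i *s deg i"
    using insert.hyps by (simp add: add_ac)
  then show ?case using sim_trans[OF insert.IH sim_multiple[of _ "q i" i]] by metis
qed

lemma sim_representatives: "\<exists>K. finite K \<and> (\<forall>k. \<exists>k0\<in>K. sim k k0)"
proof -
  \<comment> \<open>Coordinates in the basis f are reduced modulo the l_i, which may be
    negative.\<close>
  define K where "K = (\<lambda>r. \<Sum>i\<in>UNIV. r i *s f i) ` (PiE UNIV (\<lambda>i. {0..<\<bar>l i\<bar>}))"
  have "finite K" unfolding K_def by (intro finite_imageI finite_PiE) auto
  moreover have "\<exists>k0\<in>K. sim k k0" for k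
  proof -
    obtain c where c: "k = (\<Sum>i\<in>UNIV. c i *s f i)" using f_basis by blast
    define r where "r i = c i mod \<bar>l i\<bar>" for i
    define q where "q i = (r i - c i) div l i" for i
    have "l i dvd r i - c i" for i
      unfolding r_def by (metis abs_dvd_iff dvd_minus_mod dvd_diff_commute)
    then have q: "r i = c i + q i * l i" for i by (simp add: q_def)
    have "(\<Sum>i\<in>UNIV. r i *s f i) = k + (\<Sum>i\<in>UNIV. q i *s deg i)"
      unfolding c sum.distrib[symmetric]
      by (rule sum.cong) (simp_all add: q deg_def vector_sadd_rdistrib vector_smult_assoc)
    then have "sim k (\<Sum>i\<in>UNIV. r i *s f i)" using sim_sum[of UNIV k q] by simp
    moreover have "(\<Sum>i\<in>UNIV. r i *s f i) \<in> K"
      unfolding K_def using l_nonzero by (intro imageI) (auto simp: r_def)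
    ultimately show ?thesis by blast
  qed
  ultimately show ?thesis by blast
qed

lemma Vw_finite_mod:
  assumes \<nu>: "\<nu> \<in> hdual T"
  shows "\<exists>B. finite B \<and> Vw \<nu> \<subseteq> V.span (B \<union> VP)"
proof -
  obtain K where K: "finite K" "\<And>k. \<exists>k0\<in>K. sim k k0" using sim_representatives by blast
  obtain B where B: "\<And>k. finite (B k)" "\<And>k. Vh \<nu> k \<subseteq> V.span (B k)"
    using finite_dim_Vh[OF \<nu>] by metis
  define BB where "BB = (\<Union>k\<in>K. B k)"
  have "Vh \<nu> k \<subseteq> V.span (BB \<union> VP)" for k
  proof -
    obtain k0 where k0: "k0 \<in> K" "sim k k0" using K(2) by blast
    have "V.span (B k0) \<subseteq> V.span (BB \<union> VP)"
      by (rule V.span_mono) (use k0(1) in \<open>auto simp: BB_def\<close>)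
    then have "Vh \<nu> k0 \<union> VP \<subseteq> V.span (BB \<union> VP)"
      using B(2)[of k0] V.span_superset[of "BB \<union> VP"] by blast
    then have "V.span (Vh \<nu> k0 \<union> VP) \<subseteq> V.span (BB \<union> VP)"
      by (rule V.span_minimal) simp
    then show ?thesis using k0(2) unfolding sim_def by blast
  qed
  then have "V.span (\<Union>k. Vh \<nu> k) \<subseteq> V.span (BB \<union> VP)"
    by (intro V.span_minimal V.subspace_span) blast
  then have "Vw \<nu> \<subseteq> V.span (BB \<union> VP)" using Vw_span_Vh[OF \<nu>] by blast
  moreover have "finite BB" using K(1) B(1) by (simp add: BB_def)
  ultimately show ?thesis by blast
qed

lemma V_plus_finite_mod: "\<exists>B. finite B \<and> V_plus T \<rho> \<subseteq> V.span (B \<union> VP)"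
  using Vw_finite_mod[OF lam_dual] V_plus_Vw by blast

section \<open>The center acts trivially\<close>

text \<open>If non-zero, t^r K_i acts bijectively on V and commutes with all Z_i, so it is injective
  modulo V'. Up to a scalar it is the commutator of two operators acting on V_+ modulo V', and the
  Heisenberg lemma forces V_+ into V', a contradiction.\<close>

lemma C_tK_trivial:
  assumes r: "r \<in> Gam T"
  shows "C (tK r i) v = 0"
proof (rule ccontr)
  assume nz: "C (tK r i) v \<noteq> 0"
  note cm = tK_central_m[OF r, of i]
  have CR: "C (tK r i) (R k x v) = R k x (C (tK r i) v)" if "\<alpha> \<in> hdual T" "x \<in> gk_weight T k \<alpha>" for \<alpha> x k v
    by (rule C_R[OF cm gk_weight_gk[OF that(2)]])
  have CD: "D j (C (tK r i) v) = C (tK r i) (D j v) + sV (of_int (r $ j)) (C (tK r i) v)" for j v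
    using D_C[OF r, of j i v] by (simp add: add.commute)
  have bij: "bij (C (tK r i))"
    by (rule homogeneous_operator_bij[OF linear_C[OF cm] CR CD nz])
  obtain h t a where p: "central_pair h t a" using central_pair_exists by blast
  let ?k = "axis i (int (ordr T i))"
  have ht: "h \<in> gk_weight T ?k 0" "t \<in> gk_weight T (r - ?k) 0" "a i \<noteq> 0" and
    eq: "R ?k h (R (r - ?k) t v) - R (r - ?k) t (R ?k h v) = sV (a i) (C (tK r i) v)" for v
    using p r cartan_weight_zero[of h] gk_weight_Gam[OF Gam_axis] gk_weight_Gam[OF Gam_diff[OF r Gam_axis]]
    by (simp_all add: central_pair_def)
  let ?a = "R ?k h" and ?b = "R (r - ?k) t" and ?c = "\<lambda>v. sV (a i) (C (tK r i) v)"
  obtain B where B: "finite B" "V_plus T \<rho> \<subseteq> V.span (B \<union> VP)" using V_plus_finite_mod by blast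
  have lin: "Vector_Spaces.linear sV sV u" if "u \<in> {?a, ?b, ?c}" for u
    using that linear_R[OF gk_weight_gk[OF ht(1)]] linear_R[OF gk_weight_gk[OF ht(2)]]
    by (auto simp: Vector_Spaces.linear_iff V.vector_space_axioms C_linear[OF cm]
        V.scale_right_distrib mult.commute)
  have "V_plus T \<rho> \<subseteq> VP"
  proof (rule V.no_finite_dim_heisenberg[where a = ?a and b = ?b and c = ?c, OF subspace_V_plus subspace_VP B])
    fix u v w assume "u \<in> {?a, ?b, ?c}"
    then interpret u: Vector_Spaces.linear sV sV u by (rule lin)
    show "u (v + w) = u v + u w" by (rule u.add)
  next
    fix u e v assume "u \<in> {?a, ?b, ?c}"
    then interpret u: Vector_Spaces.linear sV sV u by (rule lin)
    show "u (sV e v) = sV e (u v)" by (rule u.scale)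
  next
    fix u v assume "u \<in> {?a, ?b, ?c}" "v \<in> V_plus T \<rho>"
    then show "u v \<in> V_plus T \<rho>"
      using R_V_plus ht C_V_plus[OF cm] V.subspace_scale[OF subspace_V_plus] by blast
  next
    fix u v assume u: "u \<in> {?a, ?b, ?c}" and v: "v \<in> VP"
    have ab: "?a w \<in> VP" "?b w \<in> VP" if "w \<in> VP" for w
      using R_VP[OF hdual_zero] ht that by blast+
    then have "?c v \<in> VP"
      unfolding eq[symmetric] by (intro V.subspace_diff[OF subspace_VP] ab v)
    then show "u v \<in> VP" using u ab v by blast
  next
    fix v show "?a (?b v) - ?b (?a v) = ?c v" by (rule eq)
    show "?c (?a v) = ?a (?c v)"
      using CR[OF hdual_zero ht(1)] by (simp add: R_linear gk_weight_gk[OF ht(1)])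
  next
    fix v assume "?c v \<in> VP"
    then have "sV (inverse (a i)) (?c v) \<in> VP" by (rule V.subspace_scale[OF subspace_VP])
    then have "C (tK r i) v \<in> VP" using ht(3) by simp
    then show "v \<in> VP" by (rule VP_reflect[OF linear_C[OF cm] bij Z_C[OF r]])
  qed
  then show False using V_plus_not_VP by blast
qed

lemma C_trivial: "c \<in> central_m T \<Longrightarrow> C c v = 0"
  using C_closed[of "{0}" c v] C_tK_trivial by (simp add: V.subspace_single_0)

lemma R_commutator:
  "x \<in> gk T k \<Longrightarrow> y \<in> gk T m \<Longrightarrow> R k x (R m y v) - R m y (R k x v) = R (k + m) (bracket x y) v"
  using R_R[of x k y m v] C_trivial[OF cocycle_central, of x k y m v] by simp

section \<open>V as a module over LT\<close>

lemma lie_algebra_LT: "lie_algebra (LT T)"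
proof -
  note A = GLT_algebra[unfolded lie_algebra_def GLT_simps]
  \<comment> \<open>LT is not a subalgebra of the graded Lie torus because of the cocycle, but its
    bracket is the first coordinate of the larger one; the axioms are obtained by
    projection.\<close>
  have br: "gltbr T (loop_elt u) (loop_elt w) = (lbr T u w, cocycle T u w, 0)" for u w
    by (simp add: gltbr_def loop_elt_def)
  have br2: "fst (gltbr T (u, c, 0) (w, c', 0)) = lbr T u w" for u w c c'
    by (simp add: gltbr_def)
  have sc: "loop_elt (lscale T a u) = gltscale T a (loop_elt u :: ('g, 'n) glt)" for a u
    by (simp add: loop_elt_def gltscale_def)
  have fst_sc: "fst (gltscale T a p) = lscale T a (fst p)" for a p
    by (simp add: gltscale_def split: prod.splits)
  note add = A[THEN conjunct2, THEN conjunct2, THEN conjunct2, THEN conjunct1, rule_format, OF in_GLT(2) in_GLT(2) in_GLT(2)]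
    and add' = A[THEN conjunct2, THEN conjunct2, THEN conjunct2, THEN conjunct2, THEN conjunct1, rule_format, OF in_GLT(2) in_GLT(2) in_GLT(2)]
    and scl = A[THEN conjunct2, THEN conjunct2, THEN conjunct2, THEN conjunct2, THEN conjunct2, THEN conjunct1, rule_format, OF in_GLT(2) in_GLT(2)]
    and scr = A[THEN conjunct2, THEN conjunct2, THEN conjunct2, THEN conjunct2, THEN conjunct2, THEN conjunct2, THEN conjunct1, rule_format, OF in_GLT(2) in_GLT(2)]
    and alt = A[THEN conjunct2, THEN conjunct2, THEN conjunct2, THEN conjunct2, THEN conjunct2, THEN conjunct2, THEN conjunct2, THEN conjunct1, rule_format, OF in_GLT(2)]
    and jac = A[THEN conjunct2, THEN conjunct2, THEN conjunct2, THEN conjunct2, THEN conjunct2, THEN conjunct2, THEN conjunct2, THEN conjunct2, rule_format, OF in_GLT(2) in_GLT(2) in_GLT(2)]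
  have LT_simps: "smul (LT T) = lscale T" "brk (LT T) = lbr T" by (simp_all add: LT_def)
  show ?thesis
    unfolding lie_algebra_def LT_simps
  proof (intro conjI ballI allI)
    fix u w assume u: "u \<in> elems (LT T)" and w: "w \<in> elems (LT T)"
    have "gltbr T (loop_elt u) (loop_elt w) \<in> elems (GLT T)"
      by (rule GLT_bracket[OF in_GLT(2)[OF u] in_GLT(2)[OF w]])
    then show "lbr T u w \<in> elems (LT T)" by (simp add: br elems_GLT)
  next
    fix u v w assume uvw: "u \<in> elems (LT T)" "v \<in> elems (LT T)" "w \<in> elems (LT T)"
    show "lbr T (u + v) w = lbr T u w + lbr T v w"
      using arg_cong[OF add[OF uvw], of fst] by (simp add: br flip: loop_elt_add)
    show "lbr T w (u + v) = lbr T w u + lbr T w v"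
      using arg_cong[OF add'[OF uvw], of fst] by (simp add: br flip: loop_elt_add)
    show "lbr T u (lbr T v w) + lbr T v (lbr T w u) + lbr T w (lbr T u v) = 0"
      using arg_cong[OF jac[OF uvw], of fst] by (simp add: br) (simp add: loop_elt_def br2)
  next
    fix a u w assume uw: "u \<in> elems (LT T)" "w \<in> elems (LT T)"
    show "lbr T (lscale T a u) w = lscale T a (lbr T u w)"
      using arg_cong[OF scl[OF uw, of a], of fst] by (simp add: br fst_sc flip: sc)
    show "lbr T u (lscale T a w) = lscale T a (lbr T u w)"
      using arg_cong[OF scr[OF uw, of a], of fst] by (simp add: br fst_sc flip: sc)
  next
    fix u assume u: "u \<in> elems (LT T)"
    show "lbr T u u = 0"
      using arg_cong[OF alt[OF u], of fst] by (simp add: br)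
  qed (rule vector_space_lscale subspace_LT)+
qed

lemma rho_LT_bracket:
  assumes u: "u \<in> elems (LT T)" and w: "w \<in> elems (LT T)"
  shows "\<rho> (loop_elt u) (\<rho> (loop_elt w) v) = \<rho> (loop_elt (lbr T u w)) v + \<rho> (loop_elt w) (\<rho> (loop_elt u) v)"
proof -
  have br: "gltbr T (loop_elt u) (loop_elt w) = (lbr T u w, cocycle T u w, 0)"
    by (simp add: gltbr_def loop_elt_def)
  then have el: "(lbr T u w, cocycle T u w, 0) \<in> elems (GLT T)"
    using GLT_bracket[OF in_GLT(2)[OF u] in_GLT(2)[OF w]] by simp
  then have "\<rho> (lbr T u w, cocycle T u w, 0) v = \<rho> (loop_elt (lbr T u w)) v"
    using rho_decomposition[OF el, of v] C_trivial[of "cocycle T u w" v] rho_zero[of v]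
    by (simp add: elems_GLT zero_prod_def)
  then show ?thesis
    using rho_bracket[OF in_GLT(2)[OF u] in_GLT(2)[OF w], of v] by (simp add: br)
qed

lemma lie_module_LT: "lie_module (LT T) (LT_module sV \<rho>)"
proof -
  have LT_simps: "smul (LT T) = lscale T" "brk (LT T) = lbr T" by (simp_all add: LT_def)
  have cg: "comm_group \<lparr>carrier = UNIV, monoid.mult = (+), one = (0::'v)\<rparr>"
    using lie_module_GLT unfolding lie_module_def module_on_def by simp
  have sc: "loop_elt (lscale T a u) = gltscale T a (loop_elt u :: ('g, 'n) glt)" for a u
    by (simp add: loop_elt_def gltscale_def)
  show ?thesis
    unfolding lie_module_def LT_module_def module_on_def lie_mod.simps LT_simps
  proof (intro conjI ballI allI)
    show "lie_algebra (LT T)" by (rule lie_algebra_LT)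
    show "comm_group \<lparr>carrier = UNIV, monoid.mult = (+), one = (0::'v)\<rparr>" by (rule cg)
  next
    fix c v w show "sV c (v + w) = sV c v + sV c w" by (rule V.scale_right_distrib)
  next
    fix c d v show "sV (c + d) v = sV c v + sV d v" by (rule V.scale_left_distrib)
  next
    fix c d v show "sV c (sV d v) = sV (c * d) v" by simp
  next
    fix v show "sV 1 v = v" by simp
  next
    fix u v w assume "u \<in> elems (LT T)"
    then show "\<rho> (loop_elt u) (v + w) = \<rho> (loop_elt u) v + \<rho> (loop_elt u) w"
      by (rule rho_add[OF in_GLT(2)])
  next
    fix u c v assume "u \<in> elems (LT T)"
    then show "\<rho> (loop_elt u) (sV c v) = sV c (\<rho> (loop_elt u) v)"
      by (rule rho_scale[OF in_GLT(2)])
  next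
    fix u w v assume "u \<in> elems (LT T)" "w \<in> elems (LT T)"
    then show "\<rho> (loop_elt (u + w)) v = \<rho> (loop_elt u) v + \<rho> (loop_elt w) v"
      unfolding loop_elt_add by (intro rho_add_left in_GLT(2))
  next
    fix c u v assume "u \<in> elems (LT T)"
    then show "\<rho> (loop_elt (lscale T c u)) v = sV c (\<rho> (loop_elt u) v)"
      unfolding sc by (rule rho_scale_left[OF in_GLT(2)])
  next
    fix u w v assume "u \<in> elems (LT T)" "w \<in> elems (LT T)"
    then show "\<rho> (loop_elt u) (\<rho> (loop_elt w) v) = \<rho> (loop_elt (lbr T u w)) v + \<rho> (loop_elt w) (\<rho> (loop_elt u) v)"
      by (rule rho_LT_bracket)
  qed simp_all
qed

lemma LT_simps: "vecs (LT_module sV \<rho>) = UNIV" "vadd (LT_module sV \<rho>) = (+)" "vzero (LT_module sV \<rho>) = 0"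
  "vscale (LT_module sV \<rho>) = sV" "act (LT_module sV \<rho>) = (\<lambda>u. \<rho> (loop_elt u))"
  by (simp_all add: LT_module_def module_on_def)

lemma lie_submodule_LT_iff:
  "lie_submodule (LT T) (LT_module sV \<rho>) N \<longleftrightarrow>
     V.subspace N \<and> (\<forall>u\<in>elems (LT T). \<forall>v\<in>N. \<rho> (loop_elt u) v \<in> N)"
  using lie_module_LT by (auto simp: lie_submodule_def LT_simps V.subspace_def)

lemma VP_LT: "u \<in> elems (LT T) \<Longrightarrow> v \<in> VP \<Longrightarrow> \<rho> (loop_elt u) v \<in> VP"
  by (rule rho_loop_closed[OF subspace_VP _ R_VP])

lemma vspan_LT: "vspan (LT_module sV \<rho>) B = V.span B"
proof (intro equalityI subsetI)
  fix v assume "v \<in> vspan (LT_module sV \<rho>) B"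
  then show "v \<in> V.span B"
    by induction (auto simp: LT_simps intro: V.span_base V.span_add V.span_scale V.span_zero)
next
  fix v assume "v \<in> V.span B"
  then show "v \<in> vspan (LT_module sV \<rho>) B"
  proof (induction rule: V.span_induct_alt)
    case base
    show ?case using vspan.zero[of "LT_module sV \<rho>" B] by (simp add: LT_simps)
  next
    case (step c x y)
    then show ?case
      using vspan.add[OF vspan.scale[OF vspan.base[OF step(1)]] step.IH, of c] by (simp add: LT_simps)
  qed
qed

text \<open>Monomials in LT preserve \<open>VP\<close>, as it is an LT-submodule. Conversely a
  lowering operator applied to a monomial gives a longer monomial.\<close>

lemma V_prime_eq: "V_prime T sV \<rho> z = VP"
proof
  let ?M = "{foldr (act (LT_module sV \<rho>)) xs w |xs w. set xs \<subseteq> elems (LT T) \<and> w \<in> WP}"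
  have eq: "V_prime T sV \<rho> z = V.span ?M"
    by (simp add: V_prime_def envelope_span_def vspan_LT)
  have fold: "foldr (act (LT_module sV \<rho>)) xs w \<in> VP" if "set xs \<subseteq> elems (LT T)" "w \<in> WP" for xs w
    using that(1)
  proof (induction xs)
    case Nil
    show ?case using that(2) Y_base by (simp add: VP_def)
  next
    case (Cons x xs)
    then show ?case using VP_LT by (simp add: LT_simps)
  qed
  show "V_prime T sV \<rho> z \<subseteq> VP"
    unfolding eq by (rule V.span_minimal[OF _ subspace_VP]) (use fold in blast)
  show "VP \<subseteq> V_prime T sV \<rho> z"
    unfolding VP_def Y_def eq
  proof (rule V.op_span_least[OF V.subspace_span])
    show "WP \<subseteq> V.span ?M"
    proof
      fix w assume "w \<in> WP"
      then have "foldr (act (LT_module sV \<rho>)) [] w \<in> ?M" by (intro CollectI exI[of _ "[]"] exI[of _ w]) simp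
      then show "w \<in> V.span ?M" by (intro V.span_base) simp
    qed
    fix X v assume "X \<in> Minus" and v: "v \<in> V.span ?M"
    then obtain k x \<alpha> where x: "X = R k x" "x \<in> gk_weight T k \<alpha>" unfolding Minus_def by blast
    interpret X: Vector_Spaces.linear sV sV X
      unfolding x(1) by (rule linear_R[OF gk_weight_gk[OF x(2)]])
    show "X v \<in> V.span ?M"
      using v
    proof (induction rule: V.span_induct_alt)
      case base
      show ?case by (simp add: X.zero V.span_zero)
    next
      case (step c u w)
      then obtain xs n where u: "u = foldr (act (LT_module sV \<rho>)) xs n" "set xs \<subseteq> elems (LT T)" "n \<in> WP" by blast
      have "X u = foldr (act (LT_module sV \<rho>)) (Poly_Mapping.single k x # xs) n"
        by (simp add: u(1) x(1) LT_simps R_def)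
      moreover have "set (Poly_Mapping.single k x # xs) \<subseteq> elems (LT T)"
        using u(2) single_in_LT[OF gk_weight_gk[OF x(2)]] by simp
      ultimately have "X u \<in> V.span ?M" using u(3) by (intro V.span_base) blast
      then show ?case
        unfolding X.add X.scale by (intro V.span_add V.span_scale step.IH)
    qed
  qed
qed

end

section \<open>Operators indexed by Laurent polynomials\<close>

text \<open>Scaling as a product with a constant polynomial: its compatibility with multiplication
  is then associativity and commutativity.\<close>

definition laurent_scale :: "complex \<Rightarrow> ((int ^ 'n::finite) \<Rightarrow>\<^sub>0 complex) \<Rightarrow> ((int ^ 'n) \<Rightarrow>\<^sub>0 complex)" where
  "laurent_scale c q = Poly_Mapping.single 0 c * q"

interpretation laurent: complex_vector_space laurent_scale
  by unfold_locales
     (simp_all add: laurent_scale_def algebra_simps single_add mult_single flip: mult.assoc)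

lemma lookup_laurent_scale: "Poly_Mapping.lookup (laurent_scale c q) j = c * Poly_Mapping.lookup q j"
proof -
  have "Poly_Mapping.lookup (Poly_Mapping.map ((*) c) q) j = c * Poly_Mapping.lookup q j"
    by transfer (simp add: when_def)
  then show ?thesis by (simp add: laurent_scale_def mult_map_scale_conv_mult)
qed

lemma laurent_scale_mult: "laurent_scale c p * q = laurent_scale c (p * q)"
  "p * laurent_scale c q = laurent_scale c (p * q)"
  by (simp_all add: laurent_scale_def mult_ac)

lemma laurent_scale_single: "laurent_scale c (Poly_Mapping.single j a) = Poly_Mapping.single j (c * a)"
  by (simp add: laurent_scale_def mult_single)

lemma poly_mapping_additive_induct:
  fixes P :: "('a \<Rightarrow>\<^sub>0 'b::comm_monoid_add) \<Rightarrow> bool"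
  assumes single: "\<And>k a. P (Poly_Mapping.single k a)" and add: "\<And>p q. P p \<Longrightarrow> P q \<Longrightarrow> P (p + q)"
  shows "P p"
proof -
  have "P 0" using single[of _ 0] by simp
  have "P (\<Sum>k\<in>S. Poly_Mapping.single k (Poly_Mapping.lookup p k))" for S
    by (induction S rule: infinite_finite_induct) (auto intro: single add \<open>P 0\<close>)
  then show ?thesis by (metis poly_mapping_sum_single)
qed

lemma span_monomials: "laurent.span (range (\<lambda>j. Poly_Mapping.single j 1)) = UNIV"
proof -
  have "p \<in> laurent.span (range (\<lambda>j. Poly_Mapping.single j 1))" for p :: "(int ^ 'n) \<Rightarrow>\<^sub>0 complex"
  proof (induction rule: poly_mapping_additive_induct)
    case (1 k a)
    have "laurent_scale a (Poly_Mapping.single k 1) \<in> laurent.span (range (\<lambda>j. Poly_Mapping.single j 1))"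
      by (intro laurent.span_scale laurent.span_base) blast
    then show ?case by (simp add: laurent_scale_single)
  qed (rule laurent.span_add)
  then show ?thesis by blast
qed

context integrable_setting
begin

text \<open>A parametrization of \<Gamma> by \<int>^n, so that exponents of the t_i^{m_i} run over
  all integer vectors.\<close>

definition gam :: "int ^ 'n \<Rightarrow> int ^ 'n" where
  "gam j = (\<chi> i. int (ordr T i) * j $ i)"

lemma gam_Gam: "gam j \<in> Gam T"
  by (simp add: gam_def Gam_def)

lemma gam_add: "gam (i + j) = gam i + gam j" and gam_zero [simp]: "gam 0 = 0"
  by (simp_all add: gam_def vec_eq_iff algebra_simps)

lemma gk_gam [simp]: "gk T (k + gam j) = gk T k"
  by (rule gk_add_Gam[OF gam_Gam])

lemma gk_weight_gam [simp]: "gk_weight T (k + gam j) \<alpha> = gk_weight T k \<alpha>"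
  by (rule gk_weight_add_Gam[OF gam_Gam])

text \<open>\<open>Op q k x\<close> is the action of \<open>x \<otimes> t\<^sup>k q(t\<^sub>1\<^bsup>m\<^sub>1\<^esup>, \<dots>, t\<^sub>n\<^bsup>m\<^sub>n\<^esup>)\<close>.\<close>

definition Op :: "((int ^ 'n) \<Rightarrow>\<^sub>0 complex) \<Rightarrow> int ^ 'n \<Rightarrow> 'g \<Rightarrow> 'v \<Rightarrow> 'v" where
  "Op q k x v = (\<Sum>j\<in>Poly_Mapping.keys q. sV (Poly_Mapping.lookup q j) (R (k + gam j) x v))"

lemma Op_superset:
  assumes "finite S" "Poly_Mapping.keys q \<subseteq> S"
  shows "Op q k x v = (\<Sum>j\<in>S. sV (Poly_Mapping.lookup q j) (R (k + gam j) x v))"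
  unfolding Op_def by (rule sum.mono_neutral_left) (use assms in \<open>auto simp: in_keys_iff\<close>)

lemma Op_add: "Op (p + q) k x v = Op p k x v + Op q k x v"
  using Op_superset[of "Poly_Mapping.keys p \<union> Poly_Mapping.keys q" p k x v]
    Op_superset[of "Poly_Mapping.keys p \<union> Poly_Mapping.keys q" q k x v]
    Op_superset[of "Poly_Mapping.keys p \<union> Poly_Mapping.keys q" "p + q" k x v] Poly_Mapping.keys_add[of p q]
  by (simp add: lookup_add V.scale_left_distrib sum.distrib)

lemma Op_single: "Op (Poly_Mapping.single j a) k x v = sV a (R (k + gam j) x v)"
  using Op_superset[of "{j}" "Poly_Mapping.single j a" k x v] by simp

lemma Op_scale: "Op (laurent_scale c q) k x v = sV c (Op q k x v)"
proof -
  have "Poly_Mapping.keys (laurent_scale c q) \<subseteq> Poly_Mapping.keys q"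
    by (auto simp: in_keys_iff lookup_laurent_scale)
  then show ?thesis
    using Op_superset[of "Poly_Mapping.keys q" "laurent_scale c q" k x v]
    by (simp add: Op_def lookup_laurent_scale V.scale_sum_right)
qed

lemma linear_Op_poly: "Vector_Spaces.linear laurent_scale sV (\<lambda>q. Op q k x v)"
  by (simp add: Vector_Spaces.linear_iff laurent.vector_space_axioms V.vector_space_axioms Op_add Op_scale)

lemma Op_linear:
  assumes "x \<in> gk T k"
  shows "Op q k x 0 = 0" "Op q k x (v + w) = Op q k x v + Op q k x w" "Op q k x (sV c v) = sV c (Op q k x v)"
    "Op q k x (v - w) = Op q k x v - Op q k x w"
  unfolding Op_def using assms
  by (simp_all add: R_linear V.scale_right_distrib V.scale_right_diff_distrib sum.distrib sum_subtractf
      V.scale_sum_right mult.commute)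

lemma Op_elt:
  assumes "x \<in> gk T k" "y \<in> gk T k"
  shows "Op q k (x + y) v = Op q k x v + Op q k y v" "Op q k (gscale T c x) v = sV c (Op q k x v)"
  unfolding Op_def using assms
  by (simp_all add: R_add R_scale V.scale_right_distrib sum.distrib V.scale_sum_right mult.commute)

lemma Op_zero [simp]: "Op q k 0 v = 0"
  by (simp add: Op_def)

lemma Op_VP:
  assumes "\<alpha> \<in> hdual T" "x \<in> gk_weight T k \<alpha>" "v \<in> VP"
  shows "Op q k x v \<in> VP"
  unfolding Op_def
proof (intro V.subspace_sum[OF subspace_VP] V.subspace_scale[OF subspace_VP])
  fix j show "R (k + gam j) x v \<in> VP" using R_VP[OF assms(1) _ assms(3)] assms(2) by simp
qed

lemma Op_Vw:
  assumes "x \<in> gk_weight T k \<alpha>" "v \<in> Vw \<nu>"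
  shows "Op q k x v \<in> Vw (\<nu> + \<alpha>)"
  unfolding Op_def
proof (intro V.subspace_sum[OF subspace_Vw] V.subspace_scale[OF subspace_Vw])
  fix j show "R (k + gam j) x v \<in> Vw (\<nu> + \<alpha>)" using R_Vw[OF _ assms(2)] assms(1) by simp
qed

lemma Op_shift: "Op q (k + gam j) x v = Op (q * Poly_Mapping.single j 1) k x v"
proof (induction q rule: poly_mapping_additive_induct)
  case (1 i a)
  show ?case by (simp add: mult_single Op_single gam_add add_ac)
next
  case (2 p q)
  then show ?case by (simp add: Op_add distrib_right)
qed

lemma R_Op_commutator:
  assumes y: "y \<in> gk T m" and x: "x \<in> gk T k"
  shows "R m y (Op q k x v) - Op q k x (R m y v) = Op q (m + k) (bracket y x) v"
proof (induction q rule: poly_mapping_additive_induct)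
  case (1 j a)
  have "R m y (R (k + gam j) x v) - R (k + gam j) x (R m y v) = R (m + (k + gam j)) (bracket y x) v"
    using R_commutator[OF y, of x "k + gam j" v] x by simp
  then show ?case
    by (simp add: Op_single R_linear y add.assoc flip: V.scale_right_diff_distrib)
next
  case (2 p q)
  then show ?case by (simp add: Op_add R_linear y algebra_simps)
qed

text \<open>Here the ring structure enters: a bracket with h \<otimes> p multiplies the Laurent
  polynomial of a root vector by p.\<close>

lemma Op_cartan_commutator:
  assumes h: "h \<in> cartan T" and x: "x \<in> gk_weight T k \<alpha>"
  shows "Op p 0 h (Op q k x v) - Op q k x (Op p 0 h v) = sV (\<alpha> h) (Op (p * q) k x v)"
proof (induction p rule: poly_mapping_additive_induct)
  case (1 j a)
  have h': "h \<in> gk T (gam j)" using cartan_gk_zero[OF h] gk_gam[of 0 j] by simp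
  have x': "x \<in> gk T k" by (rule gk_weight_gk[OF x])
  have "bracket h x = gscale T (\<alpha> h) x" using x h by (simp add: gk_weight_def)
  then have "R (gam j) h (Op q k x v) - Op q k x (R (gam j) h v) = sV (\<alpha> h) (Op q (k + gam j) x v)"
    using R_Op_commutator[OF h' x', of q v] Op_elt(2)[of x "gam j + k" x] x'
    by (simp add: add.commute)
  also have "\<dots> = sV (\<alpha> h) (Op (Poly_Mapping.single j 1 * q) k x v)"
    by (simp add: Op_shift mult.commute)
  finally have "sV a (R (gam j) h (Op q k x v) - Op q k x (R (gam j) h v))
      = sV (\<alpha> h) (Op (laurent_scale a (Poly_Mapping.single j 1 * q)) k x v)"
    by (simp add: Op_scale mult.commute)
  moreover have "laurent_scale a (Poly_Mapping.single j 1 * q) = Poly_Mapping.single j a * q"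
    by (simp add: laurent_scale_single flip: laurent_scale_mult)
  ultimately show ?case
    by (simp add: Op_single Op_linear x' V.scale_right_diff_distrib)
next
  case (2 p p')
  then show ?case
    using gk_weight_gk[OF x] by (simp add: Op_add Op_linear distrib_right V.scale_right_distrib algebra_simps)
qed

definition killers :: "int ^ 'n \<Rightarrow> 'g \<Rightarrow> ((int ^ 'n) \<Rightarrow>\<^sub>0 complex) set" where
  "killers k x = {q. \<forall>v\<in>V_plus T \<rho>. Op q k x v \<in> VP}"

lemma subspace_killers: "laurent.subspace (killers k x)"
proof -
  have "Op 0 k x v = 0" for v by (simp add: Op_def)
  then show ?thesis
    unfolding laurent.subspace_def killers_def
    by (auto simp: Op_add Op_scale V.subspace_0[OF subspace_VP]
        intro: V.subspace_add[OF subspace_VP] V.subspace_scale[OF subspace_VP])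
qed

text \<open>Modulo V' the space V_+ is spanned by finitely many vectors, and x \<otimes> q maps each
  of them into one weight space, finite-dimensional modulo V'. So there are finitely many linear
  conditions on q.\<close>

lemma finite_codim_killers:
  assumes \<alpha>: "\<alpha> \<in> hdual T" and x: "x \<in> gk_weight T k \<alpha>"
  shows "laurent.finite_codim (killers k x)"
proof -
  obtain B0 where B0: "finite B0" "V_plus T \<rho> \<subseteq> V.span (B0 \<union> VP)" using V_plus_finite_mod by blast
  from V.finite_codim_subset[OF B0(1) subspace_V_plus subspace_VP B0(2)]
  obtain B where B: "finite B" "B \<subseteq> V_plus T \<rho>" "V_plus T \<rho> \<subseteq> V.span (B \<union> (V_plus T \<rho> \<inter> VP))" by blast
  have eq: "killers k x = (\<Inter>v\<in>B. {q. Op q k x v \<in> VP})"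
  proof (intro equalityI subsetI)
    fix q assume "q \<in> killers k x"
    then show "q \<in> (\<Inter>v\<in>B. {q. Op q k x v \<in> VP})" using B(2) unfolding killers_def by blast
  next
    fix q assume q: "q \<in> (\<Inter>v\<in>B. {q. Op q k x v \<in> VP})"
    have "V.subspace {v. Op q k x v \<in> VP}"
      using gk_weight_gk[OF x] V.subspace_0[OF subspace_VP]
      by (auto simp: V.subspace_def Op_linear intro: V.subspace_add[OF subspace_VP] V.subspace_scale[OF subspace_VP])
    moreover have "B \<union> (V_plus T \<rho> \<inter> VP) \<subseteq> {v. Op q k x v \<in> VP}"
      using q Op_VP[OF \<alpha> x] by blast
    ultimately have "V.span (B \<union> (V_plus T \<rho> \<inter> VP)) \<subseteq> {v. Op q k x v \<in> VP}"
      by (intro V.span_minimal)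
    then show "q \<in> killers k x" using B(3) unfolding killers_def by blast
  qed
  obtain C where C: "finite C" "Vw (lam + \<alpha>) \<subseteq> V.span (C \<union> VP)"
    using Vw_finite_mod[OF hdual_add[OF lam_dual \<alpha>]] by blast
  have "laurent.finite_codim {q. Op q k x v \<in> VP}" if v: "v \<in> B" for v
  proof (rule laurent.finite_codim_linear_vimage[OF V.vector_space_axioms linear_Op_poly C(1) subspace_VP])
    show "range (\<lambda>q. Op q k x v) \<subseteq> V.span (C \<union> VP)"
      using Op_Vw[OF x V_plus_Vw] v B(2) C(2) by blast
  qed
  then show ?thesis
    unfolding eq by (intro laurent.finite_codim_INT[OF B(1)])
qed

text \<open>The polynomials \<open>p\<close> with \<open>h \<otimes> p \<in> killers 0 h\<close> multiply \<open>killers k x\<close> into itself, so they act on the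
  finite-dimensional quotient by \<open>killers k x\<close>; the kernel of this action has finite codimension.\<close>

lemma finite_codim_ideal:
  assumes \<alpha>: "\<alpha> \<in> hdual T" "\<alpha> \<noteq> 0" and x: "x \<in> gk_weight T k \<alpha>"
  shows "\<exists>P. laurent.finite_codim P \<and> (\<forall>p\<in>P. \<forall>a. p * a \<in> killers k x)"
proof -
  obtain h where h: "h \<in> cartan T" "\<alpha> h \<noteq> 0"
    using hdual_eqI[OF \<alpha>(1) hdual_zero] \<alpha>(2) by (metis zero_fun_apply)
  have mult: "p * q \<in> killers k x" if p: "p \<in> killers 0 h" and q: "q \<in> killers k x" for p q
    unfolding killers_def
  proof (intro CollectI ballI)
    fix v assume v: "v \<in> V_plus T \<rho>"
    have "Op p 0 h (Op q k x v) \<in> VP"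
      using Op_VP[OF hdual_zero cartan_weight_zero[OF h(1)]] q v by (simp add: killers_def)
    moreover have "Op q k x (Op p 0 h v) \<in> VP"
      using Op_VP[OF \<alpha>(1) x] p v by (simp add: killers_def)
    ultimately have "sV (\<alpha> h) (Op (p * q) k x v) \<in> VP"
      unfolding Op_cartan_commutator[OF h(1) x, symmetric] by (rule V.subspace_diff[OF subspace_VP])
    then have "sV (inverse (\<alpha> h)) (sV (\<alpha> h) (Op (p * q) k x v)) \<in> VP"
      by (rule V.subspace_scale[OF subspace_VP])
    then show "Op (p * q) k x v \<in> VP" using h(2) by simp
  qed
  obtain B where B: "finite B" "laurent.span (B \<union> killers k x) = UNIV"
    using finite_codim_killers[OF \<alpha>(1) x] by (auto simp: laurent.finite_codim_def)
  \<comment> \<open>The first set makes p preserve \<open>killers k x\<close>, the others move the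
    representatives B of the quotient into it; together p annihilates the whole quotient.\<close>
  define P where "P = killers 0 h \<inter> (\<Inter>b\<in>B. {p. p * b \<in> killers k x})"
  have "laurent.finite_codim {p. p * b \<in> killers k x}" for b
  proof (rule laurent.finite_codim_linear_vimage[OF laurent.vector_space_axioms _ B(1) subspace_killers])
    show "Vector_Spaces.linear laurent_scale laurent_scale (\<lambda>p. p * b)"
      by (simp add: Vector_Spaces.linear_iff laurent.vector_space_axioms distrib_right laurent_scale_mult)
  qed (simp add: B(2))
  then have "laurent.finite_codim P"
    unfolding P_def
    by (intro laurent.finite_codim_Int laurent.finite_codim_INT[OF B(1)]
        finite_codim_killers[OF hdual_zero cartan_weight_zero[OF h(1)]])
  moreover have "p * a \<in> killers k x" if p: "p \<in> P" for p a
  proof -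
    have "laurent.subspace {a. p * a \<in> killers k x}"
      using subspace_killers[of k x]
      by (auto simp: laurent.subspace_def distrib_left laurent_scale_mult)
    moreover have "B \<union> killers k x \<subseteq> {a. p * a \<in> killers k x}"
      using p mult unfolding P_def by blast
    ultimately have "laurent.span (B \<union> killers k x) \<subseteq> {a. p * a \<in> killers k x}"
      by (intro laurent.span_minimal)
    then show ?thesis using B(2) by blast
  qed
  ultimately show ?thesis by blast
qed

section \<open>Finitely many root vectors up to multiplication by Laurent monomials\<close>

definition residues :: "(int ^ 'n) set" where
  "residues = {k. \<forall>i. k $ i \<in> {0..<int (ordr T i)}}"

lemma finite_residues: "finite residues"
  unfolding residues_def by (rule finite_vec_box) simp

lemma residue_exists: "\<exists>k0\<in>residues. \<exists>j. k = k0 + gam j"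
proof -
  have "(\<chi> i. k $ i mod int (ordr T i)) \<in> residues"
    using ordr_pos by (simp add: residues_def)
  moreover have "k = (\<chi> i. k $ i mod int (ordr T i)) + gam (\<chi> i. k $ i div int (ordr T i))"
    by (simp add: vec_eq_iff gam_def)
  ultimately show ?thesis by blast
qed

definition weight_basis :: "int ^ 'n \<Rightarrow> 'g set" where
  "weight_basis k = (SOME B. finite B \<and> (\<forall>b\<in>B. \<exists>\<alpha>\<in>hdual T. b \<in> gk_weight T k \<alpha>) \<and>
     (\<forall>\<alpha>. gk_weight T k \<alpha> \<subseteq> g.span (B \<inter> gk_weight T k \<alpha>)))"

lemma weight_basis:
  "finite (weight_basis k)" "gk_weight T k \<alpha> \<subseteq> g.span (weight_basis k \<inter> gk_weight T k \<alpha>)"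
  using someI_ex[OF finite_weight_basis[of k]] unfolding weight_basis_def by blast+

lemma weight_unique:
  assumes "\<alpha> \<in> hdual T" "\<beta> \<in> hdual T" "x \<in> gk_weight T k \<alpha>" "x \<in> gk_weight T k \<beta>" "x \<noteq> 0"
  shows "\<alpha> = \<beta>"
proof (rule hdual_eqI[OF assms(1,2)])
  fix h assume "h \<in> cartan T"
  then have "gscale T (\<alpha> h) x = gscale T (\<beta> h) x" using assms(3,4) by (auto simp: gk_weight_def)
  then show "\<alpha> h = \<beta> h" by (rule g.scale_right_imp_eq[OF assms(5)])
qed

text \<open>The weight is recorded together with the vector; as zero is excluded it is determined by
  the vector, and the set is finite.\<close>

definition root_basis :: "int ^ 'n \<Rightarrow> (('g \<Rightarrow> complex) \<times> 'g) set" where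
  "root_basis k = {(\<alpha>, x). \<alpha> \<in> hdual T \<and> \<alpha> \<noteq> 0 \<and> x \<noteq> 0 \<and> x \<in> weight_basis k \<inter> gk_weight T k \<alpha>}"

lemma finite_root_basis: "finite (root_basis k)"
proof (rule finite_imageD[of snd])
  show "finite (snd ` root_basis k)"
    by (rule finite_subset[OF _ weight_basis(1)[of k]]) (auto simp: root_basis_def)
  show "inj_on snd (root_basis k)"
    using weight_unique[of _ _ _ k] by (auto simp: inj_on_def root_basis_def)
qed

lemma root_basis_span:
  assumes \<alpha>: "\<alpha> \<in> hdual T" "\<alpha> \<noteq> 0" and x: "x \<in> gk_weight T k \<alpha>"
    and N: "g.subspace N" and b: "\<And>b. (\<alpha>, b) \<in> root_basis k \<Longrightarrow> b \<in> N"
  shows "x \<in> N"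
proof -
  have "weight_basis k \<inter> gk_weight T k \<alpha> \<subseteq> N"
  proof
    fix b assume "b \<in> weight_basis k \<inter> gk_weight T k \<alpha>"
    then show "b \<in> N"
      using b[of b] \<alpha> g.subspace_0[OF N] by (cases "b = 0") (auto simp: root_basis_def)
  qed
  then show ?thesis using weight_basis(2) x g.span_minimal[OF _ N] by blast
qed

definition kills_roots :: "((int ^ 'n) \<Rightarrow>\<^sub>0 complex) \<Rightarrow> bool" where
  "kills_roots q \<longleftrightarrow> (\<forall>k \<alpha> x v. \<alpha> \<in> hdual T \<longrightarrow> \<alpha> \<noteq> 0 \<longrightarrow> x \<in> gk_weight T k \<alpha> \<longrightarrow>
     v \<in> V_plus T \<rho> \<longrightarrow> Op q k x v \<in> VP)"

text \<open>Every degree differs from one of finitely many residues by an element of \<Gamma>, and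
  this shift multiplies q by a monomial. The ideal property makes such multiplications harmless, so
  finitely many conditions take care of all degrees.\<close>

lemma kills_roots_finite_codim: "\<exists>Q. laurent.finite_codim Q \<and> (\<forall>q\<in>Q. kills_roots q)"
proof -
  define J where "J = (SIGMA k:residues. root_basis k)"
  have J: "finite J" unfolding J_def by (intro finite_SigmaI finite_residues finite_root_basis)
  have "\<exists>P. laurent.finite_codim P \<and> (\<forall>p\<in>P. \<forall>a. p * a \<in> killers (fst j) (snd (snd j)))" if "j \<in> J" for j
    using that finite_codim_ideal[of "fst (snd j)" "snd (snd j)" "fst j"]
    by (auto simp: J_def root_basis_def)
  then obtain P where P: "\<And>j. j \<in> J \<Longrightarrow> laurent.finite_codim (P j)"
    "\<And>j p a. j \<in> J \<Longrightarrow> p \<in> P j \<Longrightarrow> p * a \<in> killers (fst j) (snd (snd j))"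
    by metis
  have "kills_roots q" if q: "q \<in> (\<Inter>j\<in>J. P j)" for q
    unfolding kills_roots_def
  proof (intro allI impI)
    fix k \<alpha> x v assume \<alpha>: "\<alpha> \<in> hdual T" "\<alpha> \<noteq> 0" and x: "x \<in> gk_weight T k \<alpha>" and v: "v \<in> V_plus T \<rho>"
    obtain k0 j where k: "k0 \<in> residues" "k = k0 + gam j" using residue_exists by blast
    let ?N = "{x \<in> gk T k0. Op q k x v \<in> VP}"
    have "x \<in> ?N"
    proof (rule root_basis_span[OF \<alpha>])
      show "x \<in> gk_weight T k0 \<alpha>" using x k(2) by simp
      show "g.subspace ?N"
        unfolding g.subspace_def
        using g.subspace_0[OF subspace_gk] g.subspace_add[OF subspace_gk] g.subspace_scale[OF subspace_gk]
          V.subspace_0[OF subspace_VP] V.subspace_add[OF subspace_VP] V.subspace_scale[OF subspace_VP]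
        by (auto simp: Op_elt k(2))
      fix b assume b: "(\<alpha>, b) \<in> root_basis k0"
      then have "(k0, \<alpha>, b) \<in> J" using k(1) by (simp add: J_def)
      then have "q * Poly_Mapping.single j 1 \<in> killers k0 b" using P(2)[of "(k0, \<alpha>, b)"] q by simp
      then have "Op q k b v \<in> VP" using v by (simp add: killers_def k(2) Op_shift)
      then show "b \<in> ?N" using b gk_weight_gk by (auto simp: root_basis_def)
    qed
    then show "Op q k x v \<in> VP" by simp
  qed
  moreover have "laurent.finite_codim (\<Inter>j\<in>J. P j)" by (rule laurent.finite_codim_INT[OF J P(1)])
  ultimately show ?thesis by blast
qed

text \<open>The elements below span the ideal of \<open>LT\<close> generated by the root spaces of non-zero weight.\<close>

definition root_ideal :: "int ^ 'n \<Rightarrow> 'g \<Rightarrow> bool" where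
  "root_ideal k x \<longleftrightarrow> (\<exists>\<alpha>\<in>hdual T. \<alpha> \<noteq> 0 \<and> x \<in> gk_weight T k \<alpha>) \<or>
     (\<exists>k1 k2 y w. \<exists>\<alpha>\<in>hdual T. \<alpha> \<noteq> 0 \<and> k = k1 + k2 \<and> y \<in> gk_weight T k1 \<alpha> \<and> w \<in> gk_weight T k2 (- \<alpha>) \<and>
        x = bracket y w)"

lemma root_ideal_gk: "root_ideal k x \<Longrightarrow> x \<in> gk T k"
  unfolding root_ideal_def using gk_weight_gk gk_bracket by metis

lemma root_ideal_weight: "\<alpha> \<in> hdual T \<Longrightarrow> \<alpha> \<noteq> 0 \<Longrightarrow> x \<in> gk_weight T k \<alpha> \<Longrightarrow> root_ideal k x"
  unfolding root_ideal_def by blast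

lemma root_ideal_bracket:
  "\<alpha> \<in> hdual T \<Longrightarrow> \<alpha> \<noteq> 0 \<Longrightarrow> y \<in> gk_weight T k1 \<alpha> \<Longrightarrow> w \<in> gk_weight T k2 (- \<alpha>) \<Longrightarrow>
     k = k1 + k2 \<Longrightarrow> root_ideal k (bracket y w)"
  unfolding root_ideal_def by blast

text \<open>For a bracket [y, w] with y raising, attach q to w. The commutator then has one term in
  V' because q works on root vectors, and another that vanishes because y kills v.\<close>

lemma Op_kills_root_ideal_V_plus:
  assumes q: "kills_roots q" and x: "root_ideal k x" and v: "v \<in> V_plus T \<rho>"
  shows "Op q k x v \<in> VP"
  using x unfolding root_ideal_def
proof (elim disjE bexE exE conjE)
  fix \<alpha> assume "\<alpha> \<in> hdual T" "\<alpha> \<noteq> 0" "x \<in> gk_weight T k \<alpha>"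
  then show ?thesis using q v unfolding kills_roots_def by blast
next
  fix k1 k2 y w \<alpha> assume \<alpha>: "\<alpha> \<in> hdual T" "\<alpha> \<noteq> 0" and k: "k = k1 + k2"
    and y: "y \<in> gk_weight T k1 \<alpha>" and w: "w \<in> gk_weight T k2 (- \<alpha>)" and x: "x = bracket y w"
  have pos: "Op q (k1 + k2) (bracket y w) v \<in> VP"
    if \<alpha>: "\<alpha> \<in> hdual T" "positive \<alpha>" and y: "y \<in> gk_weight T k1 \<alpha>" and w: "w \<in> gk_weight T k2 (- \<alpha>)"
    for k1 k2 y w \<alpha>
  proof -
    have "\<alpha> \<noteq> 0" using \<alpha>(2) by auto
    then have "Op q k2 w v \<in> VP" using q w v hdual_neg[OF \<alpha>(1)] unfolding kills_roots_def by simp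
    then have "R k1 y (Op q k2 w v) \<in> VP" by (rule R_VP[OF \<alpha>(1) y])
    moreover have "R k1 y v = 0" by (rule V_plusD[OF v \<alpha> y])
    ultimately show ?thesis
      using R_Op_commutator[OF gk_weight_gk[OF y] gk_weight_gk[OF w], of q v]
      by (simp add: Op_linear gk_weight_gk[OF w])
  qed
  consider "y = 0" | "positive \<alpha>" | "positive (- \<alpha>)"
    using weight_trichotomy[OF \<alpha>(1) y] \<alpha>(2) by blast
  then show ?thesis
  proof cases
    case 1
    then show ?thesis using V.subspace_0[OF subspace_VP] by (simp add: x)
  next
    case 2
    then show ?thesis using pos[OF \<alpha>(1) _ y w] by (simp add: x k)
  next
    case 3
    \<comment> \<open>Now w is the raising factor; the roles are exchanged and the sign is corrected
      afterwards.\<close>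
    have "Op q (k2 + k1) (bracket w y) v \<in> VP"
      using pos[OF hdual_neg[OF \<alpha>(1)] 3 w, of y k1] y by simp
    then have "sV (- 1) (Op q k (bracket w y) v) \<in> VP"
      by (intro V.subspace_scale[OF subspace_VP]) (simp add: k add.commute)
    moreover have "bracket w y \<in> gk T k"
      using gk_bracket[OF gk_weight_gk[OF w] gk_weight_gk[OF y]] by (simp add: k add.commute)
    ultimately have "Op q k (gscale T (- 1) (bracket w y)) v \<in> VP" by (simp only: Op_elt(2))
    moreover have "gscale T (- 1) (bracket w y) = x"
      using bracket_anticomm[of y w] by (simp add: x)
    ultimately show ?thesis by simp
  qed
qed

text \<open>Two summands are allowed because the Jacobi identity splits [y, [u, w]] for y of weight
  zero. In the other cases the second summand is 0.\<close>

lemma root_ideal_ad: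
  assumes x: "root_ideal k x" and y: "y \<in> gk_weight T m \<beta>" "\<beta> \<in> hdual T"
  shows "\<exists>x1 x2. root_ideal (m + k) x1 \<and> root_ideal (m + k) x2 \<and> bracket y x = x1 + x2"
proof -
  have triv: ?thesis if "root_ideal (m + k) (bracket y x)"
  proof -
    obtain \<alpha> where "\<alpha> \<in> hdual T" "\<alpha> \<noteq> 0" using x unfolding root_ideal_def by blast
    then have "root_ideal (m + k) 0"
      using root_ideal_weight g.subspace_0[OF subspace_gk_weight] by blast
    then show ?thesis using that by (intro exI[of _ "bracket y x"] exI[of _ 0]) simp
  qed
  from x show ?thesis unfolding root_ideal_def[of k x]
  proof (elim disjE bexE exE conjE)
    fix \<alpha> assume \<alpha>: "\<alpha> \<in> hdual T" "\<alpha> \<noteq> 0" "x \<in> gk_weight T k \<alpha>"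
    show ?thesis
    proof (cases "\<beta> + \<alpha> = 0")
      case True
      then have "\<beta> = - \<alpha>" "\<alpha> = - \<beta>" by (simp_all add: eq_neg_iff_add_eq_0 add.commute)
      then show ?thesis
        using \<alpha> y by (intro triv root_ideal_bracket[of \<beta> y m x k]) auto
    next
      case False
      then show ?thesis
        using gk_weight_bracket[OF y(1) \<alpha>(3)] hdual_add[OF y(2) \<alpha>(1)] root_ideal_weight triv by blast
    qed
  next
    fix k1 k2 u w \<alpha> assume \<alpha>: "\<alpha> \<in> hdual T" "\<alpha> \<noteq> 0" and k: "k = k1 + k2"
      and u: "u \<in> gk_weight T k1 \<alpha>" and w: "w \<in> gk_weight T k2 (- \<alpha>)" and x: "x = bracket u w"
    show ?thesis
    proof (cases "\<beta> = 0")
      case False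
      have "bracket y x \<in> gk_weight T (m + k) \<beta>"
        using gk_weight_bracket[OF y(1) gk_weight_bracket[OF u w]] by (simp add: x k)
      then show ?thesis using root_ideal_weight[OF y(2) False] triv by blast
    next
      case True
      have "bracket y u \<in> gk_weight T (m + k1) \<alpha>" "bracket y w \<in> gk_weight T (m + k2) (- \<alpha>)"
        using gk_weight_bracket[OF y(1) u] gk_weight_bracket[OF y(1) w] True by simp_all
      then have "root_ideal (m + k) (bracket (bracket y u) w)" "root_ideal (m + k) (bracket u (bracket y w))"
        using root_ideal_bracket[OF \<alpha> _ w, of _ "m + k1" "m + k"] root_ideal_bracket[OF \<alpha> u, of _ "m + k2" "m + k"]
        by (simp_all add: k add_ac)
      then show ?thesis using jacobi[of y u w] x by blast
    qed
  qed
qed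

text \<open>Commuting with a lowering operator stays inside the ideal spanned by these elements. So
  the vectors on which all of them act into V' are stable under lowering operators, and they include
  V_+.\<close>

lemma Op_kills_root_ideal:
  assumes q: "kills_roots q" and x: "root_ideal k x"
  shows "Op q k x v \<in> VP"
proof -
  let ?M = "{v. \<forall>k x. root_ideal k x \<longrightarrow> Op q k x v \<in> VP}"
  have "Y (V_plus T \<rho>) \<subseteq> ?M"
    unfolding Y_def
  proof (rule V.op_span_least)
    show "V.subspace ?M"
      unfolding V.subspace_def
      using root_ideal_gk V.subspace_0[OF subspace_VP] V.subspace_add[OF subspace_VP] V.subspace_scale[OF subspace_VP]
      by (simp add: Op_linear)
    show "V_plus T \<rho> \<subseteq> ?M"
      using Op_kills_root_ideal_V_plus[OF q] by blast
    fix X v assume "X \<in> Minus" and v: "v \<in> ?M"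
    then obtain m y \<beta> where y: "X = R m y" "\<beta> \<in> hdual T" "y \<in> gk_weight T m \<beta>"
      unfolding Minus_def by blast
    show "X v \<in> ?M"
    proof (intro CollectI allI impI)
      fix k x assume x: "root_ideal k x"
      obtain x1 x2 where x12: "root_ideal (m + k) x1" "root_ideal (m + k) x2" "bracket y x = x1 + x2"
        using root_ideal_ad[OF x y(3,2)] by blast
      have "Op q (m + k) x1 v + Op q (m + k) x2 v \<in> VP"
        using v x12(1,2) by (intro V.subspace_add[OF subspace_VP]) blast+
      then have "Op q (m + k) (bracket y x) v \<in> VP"
        using x12 by (simp add: Op_elt(1) root_ideal_gk)
      moreover have "R m y (Op q k x v) \<in> VP"
        using v x by (intro R_VP[OF y(2,3)]) blast
      ultimately have "R m y (Op q k x v) - Op q (m + k) (bracket y x) v \<in> VP"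
        by (intro V.subspace_diff[OF subspace_VP])
      then show "Op q k x (X v) \<in> VP"
        using R_Op_commutator[OF gk_weight_gk[OF y(3)] root_ideal_gk[OF x], of q v]
        by (simp add: y(1) algebra_simps flip: R_Op_commutator[OF gk_weight_gk[OF y(3)] root_ideal_gk[OF x]])
    qed
  qed
  then show ?thesis using x by (auto simp: Y_V_plus)
qed

text \<open>Finitely many monomials span all Laurent polynomials modulo the good ones, which act
  into V' on root vectors. The set F does not depend on v, and the weight \<alpha> is retained, as
  is needed for ordering by depth.\<close>

lemma finitely_many_operators:
  "\<exists>F. finite F \<and> (\<forall>(k, \<alpha>, x)\<in>F. \<alpha> \<in> hdual T \<and> x \<in> gk_weight T k \<alpha>) \<and>
     (\<forall>k \<alpha> x v. \<alpha> \<in> hdual T \<longrightarrow> \<alpha> \<noteq> 0 \<longrightarrow> x \<in> gk_weight T k \<alpha> \<longrightarrow>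
        R k x v \<in> V.span ({R k' x' v |k' x'. (k', \<alpha>, x') \<in> F} \<union> VP))"
proof -
  obtain Q where Q: "laurent.finite_codim Q" "\<And>q. q \<in> Q \<Longrightarrow> kills_roots q"
    using kills_roots_finite_codim by blast
  obtain G where G: "G \<subseteq> range (\<lambda>j. Poly_Mapping.single j 1)" "finite G" "laurent.span (G \<union> Q) = UNIV"
    using laurent.finite_codim_spanning[OF Q(1) span_monomials] by blast
  define J where "J = {j. Poly_Mapping.single j 1 \<in> G}"
  have "inj (\<lambda>j :: int ^ 'n. Poly_Mapping.single j (1 :: complex))"
  proof (rule injI)
    fix i j :: "int ^ 'n" assume "Poly_Mapping.single i (1 :: complex) = Poly_Mapping.single j 1"
    then have "Poly_Mapping.keys (Poly_Mapping.single i (1 :: complex)) = Poly_Mapping.keys (Poly_Mapping.single j (1 :: complex))"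
      by simp
    then show "i = j" by simp
  qed
  from finite_vimageI[OF G(2) this] have J: "finite J"
    by (simp add: J_def vimage_def)
  define F where "F = (\<lambda>((k, \<alpha>, x), j). (k + gam j, \<alpha>, x)) ` ((SIGMA k:residues. root_basis k) \<times> J)"
  have "finite F"
    unfolding F_def by (intro finite_imageI finite_cartesian_product finite_SigmaI finite_residues finite_root_basis J)
  moreover have "\<forall>(k, \<alpha>, x)\<in>F. \<alpha> \<in> hdual T \<and> x \<in> gk_weight T k \<alpha>"
    by (auto simp: F_def root_basis_def)
  moreover have "R k x v \<in> V.span ({R k' x' v |k' x'. (k', \<alpha>, x') \<in> F} \<union> VP)"
    if \<alpha>: "\<alpha> \<in> hdual T" "\<alpha> \<noteq> 0" and x: "x \<in> gk_weight T k \<alpha>" for k \<alpha> x v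
  proof -
    let ?S = "V.span ({R k' x' v |k' x'. (k', \<alpha>, x') \<in> F} \<union> VP)"
    obtain k0 i where k: "k0 \<in> residues" "k = k0 + gam i" using residue_exists by blast
    have "x \<in> {x \<in> gk T k0. R k x v \<in> ?S}"
    proof (rule root_basis_span[OF \<alpha>])
      show "x \<in> gk_weight T k0 \<alpha>" using x k(2) by simp
      show "g.subspace {x \<in> gk T k0. R k x v \<in> ?S}"
        unfolding g.subspace_def
        using g.subspace_0[OF subspace_gk] g.subspace_add[OF subspace_gk] g.subspace_scale[OF subspace_gk]
        by (auto simp: R_add R_scale k(2) V.span_zero intro: V.span_add V.span_scale)
      fix b assume b: "(\<alpha>, b) \<in> root_basis k0"
      then have bk: "b \<in> gk_weight T k0 \<alpha>" by (simp add: root_basis_def)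
      have "G \<union> Q \<subseteq> {q. Op q k0 b v \<in> ?S}"
      proof
        fix q assume "q \<in> G \<union> Q"
        then show "q \<in> {q. Op q k0 b v \<in> ?S}"
        proof
          assume "q \<in> Q"
          then have "Op q k0 b v \<in> VP"
            by (intro Op_kills_root_ideal Q(2) root_ideal_weight[OF \<alpha> bk])
          then show ?thesis by (simp add: V.span_base)
        next
          assume q: "q \<in> G"
          then obtain j where j: "q = Poly_Mapping.single j 1" using G(1) by blast
          then have "((k0, \<alpha>, b), j) \<in> (SIGMA k:residues. root_basis k) \<times> J"
            using q k(1) b by (simp add: J_def)
          then have "(k0 + gam j, \<alpha>, b) \<in> F" unfolding F_def by force
          then show ?thesis by (auto simp: j Op_single intro!: V.span_base)
        qed
      qed
      moreover have "laurent.subspace {q. Op q k0 b v \<in> ?S}"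
        by (auto simp: laurent.subspace_def Op_add Op_scale V.span_zero Op_def[of 0]
            intro: V.span_add V.span_scale)
      ultimately have "laurent.span (G \<union> Q) \<subseteq> {q. Op q k0 b v \<in> ?S}"
        by (rule laurent.span_minimal)
      then have "Op (Poly_Mapping.single i 1) k0 b v \<in> ?S" using G(3) by blast
      then show "b \<in> {x \<in> gk T k0. R k x v \<in> ?S}"
        using gk_weight_gk[OF bk] by (simp add: Op_single k(2))
    qed
    then show ?thesis by simp
  qed
  ultimately show ?thesis by (intro exI[of _ F] conjI allI impI)
qed

section \<open>Finite dimension of the quotient\<close>

text \<open>The height of the negative as a natural number, available for sorting; the height itself
  is complex-valued.\<close>

definition depth :: "('g \<Rightarrow> complex) \<Rightarrow> nat" where
  "depth \<alpha> = nat \<lfloor>Re (height (- \<alpha>))\<rfloor>"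

lemma height_depth:
  assumes "positive (- \<alpha>)"
  shows "height (- \<alpha>) = of_nat (depth \<alpha>)" "depth \<alpha> > 0"
proof -
  obtain n :: nat where n: "n > 0" "height (- \<alpha>) = of_nat n" using assms unfolding positive_def by blast
  have "Re (of_nat n) = real n" by simp
  then have "depth \<alpha> = n" unfolding depth_def n(2) by (simp del: height_neg)
  with n show "height (- \<alpha>) = of_nat (depth \<alpha>)" "depth \<alpha> > 0" by simp_all
qed

lemma depth_add:
  assumes "positive (- \<alpha>)" "positive (- \<beta>)"
  shows "depth (\<alpha> + \<beta>) = depth \<alpha> + depth \<beta>"
proof -
  have eq: "- (\<alpha> + \<beta>) = (- \<alpha>) + (- \<beta>)" by simp
  have "positive (- (\<alpha> + \<beta>))" unfolding eq by (rule positive_add[OF assms])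
  then have "of_nat (depth (\<alpha> + \<beta>)) = height (- (\<alpha> + \<beta>))"
    by (rule height_depth(1)[symmetric])
  also have "\<dots> = height (- \<alpha>) + height (- \<beta>)"
    unfolding eq by (rule height_add)
  also have "\<dots> = of_nat (depth \<alpha> + depth \<beta>)"
    using height_depth(1)[OF assms(1)] height_depth(1)[OF assms(2)] by simp
  finally show ?thesis using of_nat_eq_iff by blast
qed

lemma R_nilpotent:
  assumes "\<alpha> \<in> hdual T" "\<alpha> \<noteq> 0" "x \<in> gk_weight T k \<alpha>"
  shows "\<exists>N. (R k x ^^ N) v = 0"
proof -
  have "\<forall>k. \<forall>\<alpha>\<in>hdual T. \<alpha> \<noteq> 0 \<longrightarrow> (\<forall>x\<in>gk_weight T k \<alpha>. \<forall>v.
        \<exists>N. (\<rho> (loop_elt (Poly_Mapping.single k x)) ^^ N) v = 0)"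
    using integ unfolding integrable_module_def by (elim conjE)
  from this[rule_format, OF assms] show ?thesis by (simp add: R_def)
qed

text \<open>The spanning operators of negative weight are listed by decreasing depth: then the commutator of
  two of them involves only earlier ones.\<close>

lemma finite_dim_mod_VP: "\<exists>B. finite B \<and> V.span (B \<union> VP) = UNIV"
proof -
  obtain F where F0: "finite F \<and> (\<forall>(k, \<alpha>, x)\<in>F. \<alpha> \<in> hdual T \<and> x \<in> gk_weight T k \<alpha>) \<and>
     (\<forall>k \<alpha> x v. \<alpha> \<in> hdual T \<longrightarrow> \<alpha> \<noteq> 0 \<longrightarrow> x \<in> gk_weight T k \<alpha> \<longrightarrow>
        R k x v \<in> V.span ({R k' x' v |k' x'. (k', \<alpha>, x') \<in> F} \<union> VP))"
    using finitely_many_operators by (elim exE)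
  note F = F0[THEN conjunct1] F0[THEN conjunct2, THEN conjunct1]
    and span = F0[THEN conjunct2, THEN conjunct2, rule_format]
  define F' where "F' = {(k, \<alpha>, x) \<in> F. positive (- \<alpha>)}"
  have F'D: "\<alpha> \<in> hdual T" "\<alpha> \<noteq> 0" "x \<in> gk_weight T k \<alpha>" "positive (- \<alpha>)" if "(k, \<alpha>, x) \<in> F'" for k \<alpha> x
    using that F(2) by (auto simp: F'_def)
  have "finite F'" using F(1) by (rule finite_subset[rotated]) (auto simp: F'_def)
  then obtain xs where xs: "set xs = F'" using finite_list by blast
  \<comment> \<open>The minus sign makes the ascending sort start with the deepest
    operators.\<close>
  define key :: "(int ^ 'n) \<times> ('g \<Rightarrow> complex) \<times> 'g \<Rightarrow> int" where "key t = - int (depth (fst (snd t)))" for t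
  define ts where "ts = sort_key key xs"
  have ts: "set ts = F'" by (simp add: ts_def xs)
  have sorted: "key (ts ! i) \<le> key (ts ! j)" if "i \<le> j" "j < length ts" for i j
    using sorted_nth_mono[OF sorted_sort_key[of key xs], of i j] that by (simp add: ts_def)
  define op where "op t = R (fst t) (snd (snd t))" for t :: "(int ^ 'n) \<times> ('g \<Rightarrow> complex) \<times> 'g"
  define ys where "ys = map op ts"
  obtain B where B: "finite B" "V_plus T \<rho> \<subseteq> V.span (B \<union> VP)" using V_plus_finite_mod by blast
  have "\<exists>X' B'. V.subspace X' \<and> V.span (B \<union> VP) \<subseteq> X' \<and> finite B' \<and> X' \<subseteq> V.span (B' \<union> VP) \<and>
    (\<forall>y\<in>set ys. \<forall>v\<in>X'. y v \<in> X')"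
  proof (rule V.nilpotent_extension[OF V.subspace_span subspace_VP _ B(1) subset_refl])
    show "VP \<subseteq> V.span (B \<union> VP)" using V.span_superset[of "B \<union> VP"] by blast
  next
    fix y assume "y \<in> set ys"
    then obtain k \<alpha> x where y: "y = R k x" "(k, \<alpha>, x) \<in> F'" by (auto simp: ys_def ts op_def)
    show "Vector_Spaces.linear sV sV y"
      unfolding y(1) by (rule linear_R[OF gk_weight_gk[OF F'D(3)[OF y(2)]]])
    show "\<exists>k. (y ^^ k) v = 0" for v
      unfolding y(1) by (rule R_nilpotent[OF F'D(1-3)[OF y(2)]])
    show "y v \<in> VP" if "v \<in> VP" for v
      unfolding y(1) by (rule R_VP[OF F'D(1,3)[OF y(2)] that])
  next
    fix i j v assume ij: "j < i" "i < length ys"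
    then have len: "i < length ts" "j < length ts" by (simp_all add: ys_def)
    obtain k \<alpha> x where t: "ts ! i = (k, \<alpha>, x)" by (cases "ts ! i")
    obtain m \<beta> y where u: "ts ! j = (m, \<beta>, y)" by (cases "ts ! j")
    have tF: "(k, \<alpha>, x) \<in> F'" and uF: "(m, \<beta>, y) \<in> F'"
      using nth_mem[OF len(1)] nth_mem[OF len(2)] by (simp_all add: t u ts)
    note tD = F'D[OF tF] and uD = F'D[OF uF]
    have eq: "- (\<alpha> + \<beta>) = (- \<alpha>) + (- \<beta>)" by simp
    have pos: "positive (- (\<alpha> + \<beta>))" unfolding eq by (rule positive_add[OF tD(4) uD(4)])
    then have nz: "\<alpha> + \<beta> \<noteq> 0" by (metis minus_zero not_positive_zero)
    have d: "depth (\<alpha> + \<beta>) > depth \<alpha>"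
      using depth_add[OF tD(4) uD(4)] height_depth(2)[OF uD(4)] by simp
    have "(ys ! i) ((ys ! j) v) - (ys ! j) ((ys ! i) v) = R (k + m) (bracket x y) v"
      using R_commutator[OF gk_weight_gk[OF tD(3)] gk_weight_gk[OF uD(3)], of v] len
      by (simp add: ys_def op_def t u)
    \<comment> \<open>The commutator has weight \<alpha> + \<beta>, and modulo V' only members of F
      of exactly this weight are needed; their depth exceeds that of both factors.\<close>
    also have "\<dots> \<in> V.span ({R k' x' v |k' x'. (k', \<alpha> + \<beta>, x') \<in> F} \<union> VP)"
      by (rule span[OF hdual_add[OF tD(1) uD(1)] nz gk_weight_bracket[OF tD(3) uD(3)]])
    also have "\<dots> \<subseteq> V.span ({(ys ! k) v |k. k < i} \<union> VP)"
    proof (rule V.span_mono, rule Un_mono[OF _ subset_refl], rule subsetI)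
      fix w assume "w \<in> {R k' x' v |k' x'. (k', \<alpha> + \<beta>, x') \<in> F}"
      then obtain k' x' where w: "w = R k' x' v" "(k', \<alpha> + \<beta>, x') \<in> F" by blast
      then have "(k', \<alpha> + \<beta>, x') \<in> set ts" using pos by (simp add: ts F'_def)
      then obtain n where n: "n < length ts" "ts ! n = (k', \<alpha> + \<beta>, x')" by (metis in_set_conv_nth)
      \<comment> \<open>Strictly larger depth means a strictly smaller key, so equal keys cannot
        spoil the order.\<close>
      have "n < i"
      proof (rule ccontr)
        assume "\<not> n < i"
        then have "key (ts ! i) \<le> key (ts ! n)" using sorted n(1) by simp
        then show False using d by (simp add: key_def n(2) t)
      qed
      moreover have "w = (ys ! n) v" using n by (simp add: ys_def op_def w(1))
      ultimately show "w \<in> {(ys ! k) v |k. k < i}" by blast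
    qed
    finally show "(ys ! i) ((ys ! j) v) - (ys ! j) ((ys ! i) v) \<in> V.span ({(ys ! k) v |k. k < i} \<union> VP)" .
  qed
  then obtain X' B' where X': "V.subspace X'" "V.span (B \<union> VP) \<subseteq> X'" "finite B'" "X' \<subseteq> V.span (B' \<union> VP)"
    and st: "\<And>y v. y \<in> set ys \<Longrightarrow> v \<in> X' \<Longrightarrow> y v \<in> X'" by blast
  have "Y (V_plus T \<rho>) \<subseteq> X'"
    unfolding Y_def
  proof (rule V.op_span_least[OF X'(1)])
    show "V_plus T \<rho> \<subseteq> X'" using B(2) X'(2) by blast
    fix X v assume "X \<in> Minus" and v: "v \<in> X'"
    then obtain k x \<alpha> where x: "X = R k x" "\<alpha> \<in> hdual T" "positive (- \<alpha>)" "x \<in> gk_weight T k \<alpha>"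
      unfolding Minus_def by blast
    have "\<alpha> \<noteq> 0" using x(3) by auto
    have "{R k' x' v |k' x'. (k', \<alpha>, x') \<in> F} \<union> VP \<subseteq> X'"
    proof (rule Un_least)
      show "VP \<subseteq> X'" using X'(2) V.span_superset[of "B \<union> VP"] by blast
      show "{R k' x' v |k' x'. (k', \<alpha>, x') \<in> F} \<subseteq> X'"
      proof
        fix w assume "w \<in> {R k' x' v |k' x'. (k', \<alpha>, x') \<in> F}"
        then obtain k' x' where w: "w = R k' x' v" "(k', \<alpha>, x') \<in> F" by blast
        then have "op (k', \<alpha>, x') \<in> set ys" using x(3) by (simp add: ys_def ts F'_def)
        then show "w \<in> X'" using st[OF _ v] by (simp add: op_def w(1))
      qed
    qed
    then have "V.span ({R k' x' v |k' x'. (k', \<alpha>, x') \<in> F} \<union> VP) \<subseteq> X'"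
      by (rule V.span_minimal[OF _ X'(1)])
    then show "X v \<in> X'" using span[OF x(2) \<open>\<alpha> \<noteq> 0\<close> x(4), of v] x(1) by blast
  qed
  then have "V.span (B' \<union> VP) = UNIV" using X'(4) by (auto simp: Y_V_plus)
  then show ?thesis using X'(3) by blast
qed

section \<open>Quotient modules\<close>

definition LT_stable :: "'v set \<Rightarrow> bool" where
  "LT_stable N \<longleftrightarrow> V.subspace N \<and> (\<forall>u\<in>elems (LT T). \<forall>v\<in>N. \<rho> (loop_elt u) v \<in> N)"

definition coset :: "'v set \<Rightarrow> 'v \<Rightarrow> 'v set" where
  "coset N v = {v + w |w. w \<in> N}"

lemma coset_eq_iff:
  assumes "V.subspace N"
  shows "coset N v = coset N w \<longleftrightarrow> v - w \<in> N"
proof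
  assume "coset N v = coset N w"
  moreover have "v \<in> coset N v" unfolding coset_def using V.subspace_0[OF assms] by force
  ultimately obtain n where "v = w + n" "n \<in> N" unfolding coset_def by blast
  then show "v - w \<in> N" by simp
next
  have sub: "coset N v \<subseteq> coset N w" if d: "v - w \<in> N" for v w
  proof
    fix u assume "u \<in> coset N v"
    then obtain n where n: "u = v + n" "n \<in> N" unfolding coset_def by blast
    then have "u = w + ((v - w) + n)" "(v - w) + n \<in> N" using d V.subspace_add[OF assms] by simp_all
    then show "u \<in> coset N w" unfolding coset_def by blast
  qed
  assume d: "v - w \<in> N"
  then have "w - v \<in> N" using V.subspace_neg[OF assms d] by simp
  with d show "coset N v = coset N w" using sub by blast
qed

lemma coset_zero: "coset N 0 = N"
  by (simp add: coset_def)

lemma quotient_ops: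
  assumes N: "LT_stable N"
  shows "vecs (quotient_module (LT_module sV \<rho>) N) = range (coset N)"
    "vzero (quotient_module (LT_module sV \<rho>) N) = coset N 0"
    "vadd (quotient_module (LT_module sV \<rho>) N) (coset N v) (coset N w) = coset N (v + w)"
    "vscale (quotient_module (LT_module sV \<rho>) N) c (coset N v) = coset N (sV c v)"
    "u \<in> elems (LT T) \<Longrightarrow> act (quotient_module (LT_module sV \<rho>) N) u (coset N v) = coset N (\<rho> (loop_elt u) v)"
proof -
  have S: "V.subspace N" using N by (simp add: LT_stable_def)
  note S0 = V.subspace_0[OF S] and Sa = V.subspace_add[OF S]
  show "vecs (quotient_module (LT_module sV \<rho>) N) = range (coset N)"
    by (auto simp: quotient_module_def LT_simps coset_def)
  show "vzero (quotient_module (LT_module sV \<rho>) N) = coset N 0"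
    by (simp add: quotient_module_def coset_zero)
  show "vadd (quotient_module (LT_module sV \<rho>) N) (coset N v) (coset N w) = coset N (v + w)"
  proof -
    have "{a + b |a b. a \<in> coset N v \<and> b \<in> coset N w} = coset N (v + w)"
    proof (intro equalityI subsetI)
      fix x assume "x \<in> {a + b |a b. a \<in> coset N v \<and> b \<in> coset N w}"
      then obtain m n where "x = (v + m) + (w + n)" "m \<in> N" "n \<in> N" unfolding coset_def by blast
      then have "x = (v + w) + (m + n)" "m + n \<in> N" using Sa by (simp_all add: add_ac)
      then show "x \<in> coset N (v + w)" unfolding coset_def by blast
    next
      fix x assume "x \<in> coset N (v + w)"
      then obtain n where "x = (v + 0) + (w + n)" "n \<in> N" unfolding coset_def by (auto simp: add_ac)
      then show "x \<in> {a + b |a b. a \<in> coset N v \<and> b \<in> coset N w}" unfolding coset_def using S0 by blast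
    qed
    then show ?thesis by (simp add: quotient_module_def LT_simps)
  qed
  \<comment> \<open>Scaling and the action are treated together: an additive map that preserves N
    descends to cosets.\<close>
  have op: "{g a + w |a w. a \<in> coset N v \<and> w \<in> N} = coset N (g v)"
    if add: "\<And>v w. g (v + w) = g v + g w" and gN: "\<And>n. n \<in> N \<Longrightarrow> g n \<in> N" for g :: "'v \<Rightarrow> 'v" and v
  proof (intro equalityI subsetI)
    fix x assume "x \<in> {g a + w |a w. a \<in> coset N v \<and> w \<in> N}"
    then obtain m n where "x = g (v + m) + n" "m \<in> N" "n \<in> N" unfolding coset_def by blast
    then have "x = g v + (g m + n)" "g m + n \<in> N" using Sa gN by (simp_all add: add add_ac)
    then show "x \<in> coset N (g v)" unfolding coset_def by blast
  next
    fix x assume "x \<in> coset N (g v)"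
    then obtain n where "x = g (v + 0) + n" "n \<in> N" unfolding coset_def by auto
    then show "x \<in> {g a + w |a w. a \<in> coset N v \<and> w \<in> N}" unfolding coset_def using S0 by blast
  qed
  show "vscale (quotient_module (LT_module sV \<rho>) N) c (coset N v) = coset N (sV c v)"
    using op[of "sV c" v] V.subspace_scale[OF S] by (simp add: quotient_module_def LT_simps V.scale_right_distrib)
  show "act (quotient_module (LT_module sV \<rho>) N) u (coset N v) = coset N (\<rho> (loop_elt u) v)"
    if u: "u \<in> elems (LT T)"
    using op[of "\<rho> (loop_elt u)" v] N u rho_add[OF in_GLT(2)[OF u]]
    by (simp add: quotient_module_def LT_simps LT_stable_def)
qed

lemma lie_module_quotient:
  assumes N: "LT_stable N"
  shows "lie_module (LT T) (quotient_module (LT_module sV \<rho>) N)"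
proof -
  note Q = quotient_ops[OF N]
  let ?Q = "quotient_module (LT_module sV \<rho>) N"
  have LTs: "smul (LT T) = lscale T" "brk (LT T) = lbr T" by (simp_all add: LT_def)
  have sc: "loop_elt (lscale T a u) = gltscale T a (loop_elt u :: ('g, 'n) glt)" for a u
    by (simp add: loop_elt_def gltscale_def)
  interpret L: vector_space "lscale T" by (rule vector_space_lscale)
  note Ladd = L.subspace_add[OF subspace_LT] and Lscale = L.subspace_scale[OF subspace_LT]
  have Lbr: "lbr T u w \<in> elems (LT T)" if "u \<in> elems (LT T)" "w \<in> elems (LT T)" for u w
    using lie_algebra_LT that by (simp add: lie_algebra_def LTs)
  have grp: "comm_group \<lparr>carrier = vecs ?Q, monoid.mult = vadd ?Q, one = vzero ?Q\<rparr>"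
  proof (rule comm_groupI)
    fix A assume "A \<in> carrier \<lparr>carrier = vecs ?Q, monoid.mult = vadd ?Q, one = vzero ?Q\<rparr>"
    then obtain v where v: "A = coset N v" by (auto simp: Q)
    have "vadd ?Q (coset N (- v)) (coset N v) = coset N 0" by (simp add: Q)
    then show "\<exists>B\<in>carrier \<lparr>carrier = vecs ?Q, monoid.mult = vadd ?Q, one = vzero ?Q\<rparr>.
        B \<otimes>\<^bsub>\<lparr>carrier = vecs ?Q, monoid.mult = vadd ?Q, one = vzero ?Q\<rparr>\<^esub> A
          = \<one>\<^bsub>\<lparr>carrier = vecs ?Q, monoid.mult = vadd ?Q, one = vzero ?Q\<rparr>\<^esub>"
      by (intro bexI[of _ "coset N (- v)"]) (simp_all add: Q v)
  qed (auto simp: Q add_ac)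
  show ?thesis
    unfolding lie_module_def LTs
  proof (intro conjI ballI allI)
    show "lie_algebra (LT T)" by (rule lie_algebra_LT)
    show "comm_group \<lparr>carrier = vecs ?Q, monoid.mult = vadd ?Q, one = vzero ?Q\<rparr>" by (rule grp)
  next
    fix u w A assume uw: "u \<in> elems (LT T)" "w \<in> elems (LT T)" and "A \<in> vecs ?Q"
    then obtain v where "A = coset N v" by (auto simp: Q)
    then show "act ?Q (u + w) A = vadd ?Q (act ?Q u A) (act ?Q w A)"
      "act ?Q u (act ?Q w A) = vadd ?Q (act ?Q (lbr T u w) A) (act ?Q w (act ?Q u A))"
      using uw Ladd[OF uw] Lbr[OF uw] rho_LT_bracket[OF uw]
        rho_add_left[OF in_GLT(2)[OF uw(1)] in_GLT(2)[OF uw(2)]]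
      by (simp_all add: Q loop_elt_add)
  next
    fix c u A assume u: "u \<in> elems (LT T)" and "A \<in> vecs ?Q"
    then obtain v where "A = coset N v" by (auto simp: Q)
    then show "act ?Q (lscale T c u) A = vscale ?Q c (act ?Q u A)"
      using u Lscale[OF u, of c] rho_scale_left[OF in_GLT(2)[OF u]] by (simp add: Q sc)
  next
    fix u A B assume u: "u \<in> elems (LT T)" and "A \<in> vecs ?Q" "B \<in> vecs ?Q"
    then obtain v w where "A = coset N v" "B = coset N w" by (auto simp: Q)
    then show "act ?Q u (vadd ?Q A B) = vadd ?Q (act ?Q u A) (act ?Q u B)"
      using u rho_add[OF in_GLT(2)[OF u]] by (simp add: Q)
  next
    fix u c A assume u: "u \<in> elems (LT T)" and "A \<in> vecs ?Q"
    then obtain v where "A = coset N v" by (auto simp: Q)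
    then show "act ?Q u (vscale ?Q c A) = vscale ?Q c (act ?Q u A)"
      using u rho_scale[OF in_GLT(2)[OF u]] by (simp add: Q)
  qed (auto simp: Q V.scale_right_distrib V.scale_left_distrib)
qed

lemma fd_module_quotient:
  assumes N: "LT_stable N" and B: "finite B" "V.span (B \<union> N) = UNIV"
  shows "fd_module (quotient_module (LT_module sV \<rho>) N)"
proof -
  note Q = quotient_ops[OF N]
  let ?Q = "quotient_module (LT_module sV \<rho>) N"
  have S: "V.subspace N" using N by (simp add: LT_stable_def)
  have "coset N v \<in> vspan ?Q (coset N ` B)" for v
  proof -
    have "v \<in> V.span (B \<union> N)" using B(2) by simp
    then show ?thesis
    proof (induction rule: V.span_induct_alt)
      case base
      show ?case using vspan.zero[of ?Q] by (simp add: Q)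
    next
      case (step c x y)
      have "coset N x \<in> vspan ?Q (coset N ` B)"
      proof (cases "x \<in> B")
        case True
        then show ?thesis by (intro vspan.base) simp
      next
        case False
        then have "coset N x = coset N 0" using step(1) coset_eq_iff[OF S, of x 0] by simp
        then show ?thesis using vspan.zero[of ?Q "coset N ` B"] by (simp add: Q)
      qed
      then show ?case
        using vspan.add[OF vspan.scale step.IH, of "coset N x" c] by (simp add: Q)
    qed
  qed
  moreover have "A \<in> range (coset N)" if "A \<in> vspan ?Q (coset N ` B)" for A
    using that by induction (auto simp: Q)
  ultimately have "vecs ?Q = vspan ?Q (coset N ` B)" by (auto simp: Q)
  then show ?thesis
    unfolding fd_module_def using B(1) by (intro exI[of _ "coset N ` B"]) (auto simp: Q)
qed

text \<open>A submodule of the quotient is pulled back to a submodule of V containing N, and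
  maximality leaves only N and V.\<close>

lemma irreducible_quotient:
  assumes N: "LT_stable N" "N \<noteq> UNIV" and max: "\<And>L. LT_stable L \<Longrightarrow> N \<subseteq> L \<Longrightarrow> L \<noteq> UNIV \<Longrightarrow> L = N"
  shows "irreducible_module (LT T) (quotient_module (LT_module sV \<rho>) N)"
proof -
  note Q = quotient_ops[OF N(1)]
  let ?Q = "quotient_module (LT_module sV \<rho>) N"
  have S: "V.subspace N" using N(1) by (simp add: LT_stable_def)
  have "vecs ?Q \<noteq> {vzero ?Q}"
  proof
    assume eq: "vecs ?Q = {vzero ?Q}"
    have "coset N v = coset N 0" for v using eq by (auto simp: Q)
    then have "v \<in> N" for v using coset_eq_iff[OF S, of v 0] by simp
    then show False using N(2) by blast
  qed
  moreover have "K = {vzero ?Q} \<or> K = vecs ?Q" if K: "lie_submodule (LT T) ?Q K" for K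
  proof -
    have Ksub: "K \<subseteq> range (coset N)" "coset N 0 \<in> K"
      and Kadd: "\<And>A B. A \<in> K \<Longrightarrow> B \<in> K \<Longrightarrow> vadd ?Q A B \<in> K"
      and Kscale: "\<And>c A. A \<in> K \<Longrightarrow> vscale ?Q c A \<in> K"
      and Kact: "\<And>u A. u \<in> elems (LT T) \<Longrightarrow> A \<in> K \<Longrightarrow> act ?Q u A \<in> K"
      using K unfolding lie_submodule_def Q(1,2) by blast+
    define L where "L = {v. coset N v \<in> K}"
    have "LT_stable L"
      unfolding LT_stable_def V.subspace_def L_def
      using Ksub(2) Kadd[of "coset N _" "coset N _"] Kscale[of "coset N _"] Kact[of _ "coset N _"]
      by (simp add: Q)
    moreover have "N \<subseteq> L"
    proof
      fix n assume "n \<in> N"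
      then have "coset N n = coset N 0" using coset_eq_iff[OF S, of n 0] by simp
      then show "n \<in> L" using Ksub(2) by (simp add: L_def)
    qed
    ultimately have LN: "L = UNIV \<or> L = N" using max by blast
    have KL: "K = coset N ` L" using Ksub(1) by (auto simp: L_def)
    from LN show ?thesis
    proof
      assume "L = N"
      then have "K \<subseteq> {coset N 0}" unfolding KL using coset_eq_iff[OF S, of _ 0] by auto
      then show ?thesis using Ksub(2) by (auto simp: Q)
    qed (simp add: KL Q)
  qed
  ultimately show ?thesis
    unfolding irreducible_module_def using lie_module_quotient[OF N(1)] by blast
qed

lemma LT_stable_VP: "LT_stable VP"
  unfolding LT_stable_def using subspace_VP VP_LT by blast

text \<open>Zorn's lemma. The union of a chain stays proper because a finite set B spans V modulo
  V': if the union contained B, one member of the chain would, and it would be all of V.\<close>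

lemma maximal_submodule_exists:
  "\<exists>N. LT_stable N \<and> VP \<subseteq> N \<and> N \<noteq> UNIV \<and> (\<forall>L. LT_stable L \<longrightarrow> N \<subseteq> L \<longrightarrow> L \<noteq> UNIV \<longrightarrow> L = N)"
proof -
  obtain B where B: "finite B" "V.span (B \<union> VP) = UNIV" using finite_dim_mod_VP by blast
  define \<A> where "\<A> = {N. LT_stable N \<and> VP \<subseteq> N \<and> N \<noteq> UNIV}"
  have "\<exists>M\<in>\<A>. \<forall>X\<in>\<A>. M \<subseteq> X \<longrightarrow> X = M"
  proof (rule subset_Zorn_nonempty)
    show "\<A> \<noteq> {}" using LT_stable_VP V_plus_not_VP unfolding \<A>_def by blast
    fix \<C> assume ne: "\<C> \<noteq> {}" and chain: "subset.chain \<A> \<C>"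
    have CA: "LT_stable N" "VP \<subseteq> N" "N \<noteq> UNIV" if "N \<in> \<C>" for N
      using chain that unfolding subset.chain_def \<A>_def by blast+
    have pair: "\<exists>N\<in>\<C>. v \<in> N \<and> w \<in> N" if "v \<in> \<Union>\<C>" "w \<in> \<Union>\<C>" for v w
      using finite_subset_Union_chain[of "{v, w}" \<C> \<A>] that ne chain by auto
    have "V.subspace (\<Union>\<C>)"
      unfolding V.subspace_def
    proof (intro conjI ballI allI)
      show "0 \<in> \<Union>\<C>" using ne CA(1) V.subspace_0 unfolding LT_stable_def by blast
    next
      fix v w assume "v \<in> \<Union>\<C>" "w \<in> \<Union>\<C>"
      then obtain N where "N \<in> \<C>" "v \<in> N" "w \<in> N" using pair by blast
      then show "v + w \<in> \<Union>\<C>" using CA(1)[of N] V.subspace_add[of N v w] unfolding LT_stable_def by blast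
    next
      fix c v assume "v \<in> \<Union>\<C>"
      then obtain N where "N \<in> \<C>" "v \<in> N" by blast
      then show "sV c v \<in> \<Union>\<C>" using CA(1)[of N] V.subspace_scale[of N v c] unfolding LT_stable_def by blast
    qed
    then have "LT_stable (\<Union>\<C>)"
      using CA(1) unfolding LT_stable_def by blast
    moreover have "VP \<subseteq> \<Union>\<C>" using ne CA(2) by blast
    moreover have "\<Union>\<C> \<noteq> UNIV"
    proof
      assume "\<Union>\<C> = UNIV"
      then obtain N where N: "N \<in> \<C>" "B \<subseteq> N"
        using finite_subset_Union_chain[OF B(1) _ ne chain] by auto
      then have "V.span (B \<union> VP) \<subseteq> N"
        using CA(1,2)[OF N(1)] by (intro V.span_minimal) (auto simp: LT_stable_def)
      then show False using B(2) CA(3)[OF N(1)] by blast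
    qed
    ultimately show "\<Union>\<C> \<in> \<A>" unfolding \<A>_def by blast
  qed
  then obtain M where M: "M \<in> \<A>" "\<And>X. X \<in> \<A> \<Longrightarrow> M \<subseteq> X \<Longrightarrow> X = M" by blast
  then have "L = M" if "LT_stable L" "M \<subseteq> L" "L \<noteq> UNIV" for L
    using that unfolding \<A>_def by blast
  then show ?thesis using M(1) unfolding \<A>_def by blast
qed

lemma quotient_by_V_prime:
  "(lie_submodule (LT T) (LT_module sV \<rho>) (V_prime T sV \<rho> z) \<and> V_prime T sV \<rho> z \<noteq> UNIV)
    \<and> (lie_module (LT T) (quotient_module (LT_module sV \<rho>) (V_prime T sV \<rho> z)) \<and>
       fd_module (quotient_module (LT_module sV \<rho>) (V_prime T sV \<rho> z)))
    \<and> (\<exists>V''. lie_submodule (LT T) (LT_module sV \<rho>) V'' \<and> V_prime T sV \<rho> z \<subseteq> V'' \<and>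
         fd_module (quotient_module (LT_module sV \<rho>) V'') \<and>
         irreducible_module (LT T) (quotient_module (LT_module sV \<rho>) V''))"
  unfolding V_prime_eq
proof (intro conjI)
  show "lie_submodule (LT T) (LT_module sV \<rho>) VP"
    using LT_stable_VP by (simp add: lie_submodule_LT_iff LT_stable_def)
  show "VP \<noteq> UNIV" using V_plus_not_VP by blast
  show "lie_module (LT T) (quotient_module (LT_module sV \<rho>) VP)"
    by (rule lie_module_quotient[OF LT_stable_VP])
  obtain B where B: "finite B" "V.span (B \<union> VP) = UNIV" using finite_dim_mod_VP by blast
  show "fd_module (quotient_module (LT_module sV \<rho>) VP)"
    by (rule fd_module_quotient[OF LT_stable_VP B])
  obtain N where N: "LT_stable N" "VP \<subseteq> N" "N \<noteq> UNIV"
    and max: "\<And>L. LT_stable L \<Longrightarrow> N \<subseteq> L \<Longrightarrow> L \<noteq> UNIV \<Longrightarrow> L = N"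
    using maximal_submodule_exists by blast
  have "V.span (B \<union> VP) \<subseteq> V.span (B \<union> N)" using N(2) by (intro V.span_mono) blast
  then have BN: "V.span (B \<union> N) = UNIV" using B(2) by blast
  show "\<exists>V''. lie_submodule (LT T) (LT_module sV \<rho>) V'' \<and> VP \<subseteq> V'' \<and>
         fd_module (quotient_module (LT_module sV \<rho>) V'') \<and>
         irreducible_module (LT T) (quotient_module (LT_module sV \<rho>) V'')"
    using N fd_module_quotient[OF N(1) B(1) BN] irreducible_quotient[OF N(1,3) max]
    by (intro exI[of _ N]) (simp add: lie_submodule_LT_iff LT_stable_def)
qed

end

theorem theorem5p9:
  fixes T :: "('g::ab_group_add, 'n::finite) lie_torus_data"
    and sV :: "complex \<Rightarrow> 'v \<Rightarrow> 'v::ab_group_add"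
    and \<rho> :: "('g, 'n) glt \<Rightarrow> 'v \<Rightarrow> 'v"
    and lam :: "'g \<Rightarrow> complex"
    and f :: "'n \<Rightarrow> int ^ 'n"
    and l :: "'n \<Rightarrow> int"
    and z :: "'n \<Rightarrow> 'v \<Rightarrow> 'v"
  assumes torus: "lie_torus T"
    and irred: "irreducible_module (GLT T) (module_on UNIV sV \<rho>)"
    and integ: "integrable_module T sV \<rho>"
    and K_trivial: "\<forall>i v. \<rho> (K_elt i) v = 0"
    and lam_dual: "lam \<in> hdual T"
    and lam_acts: "\<forall>h\<in>cartan T. \<forall>v\<in>V_plus T \<rho>.
          \<rho> (loop_elt (Poly_Mapping.single 0 h)) v = sV (lam h) v"
    and lam_nonzero: "lam \<noteq> 0"
    and f_basis: "\<forall>k. \<exists>!c. k = (\<Sum>i\<in>UNIV. c i *s f i)"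
    and l_nonzero: "\<forall>i. l i \<noteq> 0"
    and lattice: "degree_lattice T \<rho> = {\<Sum>i\<in>UNIV. (c i * l i) *s f i |c. True}"
    and z_hco: "\<forall>i. highest_central_operator T sV \<rho> (l i *s f i) (z i)"
    and z_nonzero: "\<forall>i. \<exists>v\<in>V_plus T \<rho>. z i v \<noteq> 0"
    and W_submodule: "\<forall>u\<in>LT_zero T. \<forall>w\<in>W_plus T sV \<rho> z. \<rho> (loop_elt u) w \<in> W_plus T sV \<rho> z"
    and W_proper: "W_plus T sV \<rho> z \<subset> V_plus T \<rho>"
  shows "(lie_submodule (LT T) (LT_module sV \<rho>) (V_prime T sV \<rho> z) \<and> V_prime T sV \<rho> z \<noteq> UNIV)
    \<and> (lie_module (LT T) (quotient_module (LT_module sV \<rho>) (V_prime T sV \<rho> z)) \<and>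
       fd_module (quotient_module (LT_module sV \<rho>) (V_prime T sV \<rho> z)))
    \<and> (\<exists>V''. lie_submodule (LT T) (LT_module sV \<rho>) V'' \<and> V_prime T sV \<rho> z \<subseteq> V'' \<and>
         fd_module (quotient_module (LT_module sV \<rho>) V'') \<and>
         irreducible_module (LT T) (quotient_module (LT_module sV \<rho>) V''))"
proof -
  interpret integrable_setting T sV \<rho> lam f l z
    by unfold_locales (fact torus irred integ K_trivial lam_dual lam_acts lam_nonzero f_basis l_nonzero z_hco
        z_nonzero W_submodule W_proper)+
  show ?thesis by (rule quotient_by_V_prime)
qed

end
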